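(* In dimension $d=1$, let $\{(X_i,Y_i,Z_i)\}_{i\ge1}$ be the i.i.d. sequence on $(\Omega,\mathcal{H},\hat{\mathbb{E}})$ constructed in the context from the random variables $W_k$, $k\in\Lambda$, with uncertainty set $\Theta=\mathcal{L}\times\Gamma\times\Sigma$. Suppose that assumptions (A1)-(A3) (with moment exponent $\delta$) and conditions (H1)-(H2) (with exponent $q_0>0$) of the context hold. Let $S_n^1=\sum_{i=1}^nX_i$, $S_n^2=\sum_{i=1}^nY_i$, $S_n^3=\sum_{i=1}^nZ_i$, let $\phi\in C_{b,\mathrm{Lip}}(\mathbb{R}^3)$, and let $(\xi_t,\eta_t,\zeta_t)_{t\in[0,1]}$ be the nonlinear Lévy process associated with $\Theta$ under $\tilde{\mathbb{E}}$ (see context). Then for all $n\ge1$ $$\Big|\hat{\mathbb{E}}\Big[\phi\Big(\frac{S_n^1}{\sqrt n},\frac{S_n^2}{n},\frac{S_n^3}{n^{1/\alpha}}\Big)\Big]-\tilde{\mathbb{E}}[\phi(\xi_1,\eta_1,\zeta_1)]\Big|\le C\,n^{-\Gamma(\alpha,\delta,q_0)},$$ where $C$ is a positive constant depending on $C_0$, $M_0$, $K_\rho$ and $C_{\alpha,\beta}$ (in particular not on $n$), and $$\Gamma(\alpha,\delta,q_0):=\min\Big\{\frac{4\delta-3\alpha}{2\alpha(2\delta+3)},\ \frac{2-\alpha}{2\alpha},\ \frac{q_0}{2}\Big\}.$$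
   Context: Sublinear expectations. $\mathcal{H}$ is a linear space of real random variables on $\Omega$, stable under Lipschitz functions of finitely many elements; a sublinear expectation $\hat{\mathbb{E}}:\mathcal{H}\to\mathbb{R}$ is monotone, constant preserving, sub-additive and positively homogeneous. Random variables to which $\hat{\mathbb{E}}$ is applied are understood to lie in its domain. $X\overset{d}{=}X'$ means the sublinear expectations of $\varphi(X)$ and $\varphi(X')$ agree for all bounded Lipschitz $\varphi$; $Y$ is independent from $X$ if $\hat{\mathbb{E}}[\varphi(X,Y)]=\hat{\mathbb{E}}[\hat{\mathbb{E}}[\varphi(x,Y)]_{x=X}]$ for all bounded Lipschitz $\varphi$; $\{\chi_i\}$ is i.i.d. if $\chi_{i+1}\overset{d}{=}\chi_i$ and $\chi_{i+1}$ is independent from $(\chi_1,\dots,\chi_i)$ for all $i$. $C_{b,\mathrm{Lip}}$: bounded Lipschitz functions; $C_b^3$: functions with bounded derivatives up to order 3; $a\vee b=\max(a,b)$. Uncertainty set. Fix $\alpha\in(1,2)$, $0<\underline\Lambda<\overline\Lambda$, $\Lambda=(\underline\Lambda,\overline\Lambda)^2$, $\Gamma=[\underline\gamma,\overline\gamma]$, $\Sigma=[\underline\sigma^2,\bar\sigma^2]$. For $k=(k_1,k_2)\in\Lambda$ let $F_k(d\lambda)=\frac{k_1}{|\lambda|^{\alpha+1}}\mathbf 1_{(-\infty,0)}(\lambda)d\lambda+\frac{k_2}{|\lambda|^{\alpha+1}}\mathbf 1_{(0,\infty)}(\lambda)d\lambda$, $\mathcal{L}=\{F_k:k\in\Lambda\}$,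 $\Theta=\mathcal{L}\times\Gamma\times\Sigma$. With $\delta_\lambda\varphi(z)=\varphi(z+\lambda)-\varphi(z)-D\varphi(z)\lambda$ put $G(p,a,\varphi(\cdot))=\sup_{(F_k,q,Q)\in\Theta}\{\int_{\mathbb{R}}\delta_\lambda\varphi(0)F_k(d\lambda)+pq+\frac12aQ\}$. The random variables $W_k$. For each $k\in\Lambda$, $W_k$ is a classical random variable with distribution function $F_{W_k}(z)=\big[\frac{k_1}{\alpha}+\beta_{1,k}(z)\big]\frac1{|z|^\alpha}$ for $z<0$ and $F_{W_k}(z)=1-\big[\frac{k_2}{\alpha}+\beta_{2,k}(z)\big]\frac1{z^\alpha}$ for $z>0$, where $\beta_{1,k}:(-\infty,0]\to\mathbb{R}$, $\beta_{2,k}:[0,\infty)\to\mathbb{R}$ are continuously differentiable with $\lim_{z\to-\infty}\beta_{1,k}(z)=\lim_{z\to\infty}\beta_{2,k}(z)=0$. (H1) $W_k$ has mean zero (for every $k\in\Lambda$). (H2) There are constants $q_0>0$, $C_\beta>0$ such that for all $n\ge1$ (and all $k\in\Lambda$) the following are bounded by $C_\beta n^{-q_0}$: $|\beta_{1,k}(-n^{1/\alpha})|$, $\int_{-\infty}^{-1}\frac{|\beta_{1,k}(n^{1/\alpha}z)|}{|z|^\alpha}dz$, $\int_{-1}^0\frac{|\beta_{1,k}(n^{1/\alpha}z)|}{|z|^{\alpha-1}}dz$, $|\beta_{2,k}(n^{1/\alpha})|$, $\int_1^\infty\frac{|\beta_{2,k}(n^{1/\alpha}z)|}{z^\alpha}dz$,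 $\int_0^1\frac{|\beta_{2,k}(n^{1/\alpha}z)|}{z^{\alpha-1}}dz$. The sequence. On $\Omega_0=\mathbb{R}^3$, $\mathcal{H}_0=C_{\mathrm{Lip}}(\mathbb{R}^3)$, let $$\hat{\mathbb{E}}_0[\phi]=\sup_{(k,q,\sigma^2)\in\Lambda\times\Gamma\times\Sigma}\int_{\mathbb{R}}\int_{\mathbb{R}}\phi(\sigma x,q,z)\tfrac1{\sqrt{2\pi}}e^{-x^2/2}\,dx\,dF_{W_k}(z),$$ and let $X,Y,Z$ be the coordinate maps on $\mathbb{R}^3$. $(\Omega,\mathcal{H},\hat{\mathbb{E}})=(\Omega_0^{\mathbb{N}},\mathcal{H}_0^{\otimes\mathbb{N}},\hat{\mathbb{E}}_0^{\otimes\mathbb{N}})$ is the product sublinear expectation space and $(X_i,Y_i,Z_i)(\omega)=(X,Y,Z)(\omega_i)$, so $\{(X_i,Y_i,Z_i)\}$ is i.i.d. with $(X_i,Y_i,Z_i)\overset{d}{=}(X,Y,Z)$. Assumptions. Write $M_\xi^p=\hat{\mathbb{E}}[|\xi|^p]$ and $S_n^3=\sum_{i=1}^nZ_i$. (A1) $\hat{\mathbb{E}}[X_1]=\hat{\mathbb{E}}[-X_1]=0$, $M_{X_1}^3<\infty$, $M_{Y_1}^2<\infty$. (A2) $\hat{\mathbb{E}}[Z_1]=\hat{\mathbb{E}}[-Z_1]=0$, $M_*:=\sup_{n\ge1}\hat{\mathbb{E}}[n^{-1/\alpha}|S_n^3|]<\infty$, $M_{Z_1}^\delta<\infty$ for some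 $\delta\in(\frac34\alpha\vee1,\alpha)$. (A3) For each $(p,a)\in\mathbb{R}^2$ and $\varphi\in C_b^3(\mathbb{R})$, $\frac1s\big|\hat{\mathbb{E}}[\varphi(z+s^{1/\alpha}Z_1)-\varphi(z)+spY_1+\frac s2aX_1^2]-sG(p,a,\varphi(z+\cdot))\big|\le\hat l(s,L_0)$, where $\hat l$ is a function of $s\in[0,1]$ and $L_0=|p|+|a|+\|\varphi\|_\infty+\sum_{i=1}^3\|D^i\varphi\|_\infty$ such that for each $C>0$, $\hat l(s,L_0)\to0$ as $s\to0$ uniformly in $z\in\mathbb{R}$ and $L_0\le C$. PIDE and Lévy process. The PIDE is $\partial_tu-G(D_yu,D_x^2u,u(t,x,y,z+\cdot))=0$ on $(0,1]\times\mathbb{R}^3$, $u(0,\cdot)=\phi$, understood in the viscosity sense (bounded continuous $u$ with $u(0,\cdot)=\phi$, such that for test functions $\psi\in C_b^{2,3}((0,1]\times\mathbb{R}^3)$ touching $u$ globally from above (resp. below) at a point, $\partial_t\psi-G(D_y\psi,D_x^2\psi,\psi(t,x,y,z+\cdot))\le0$ (resp. $\ge0$) there). A nonlinear Lévy process is a càdlàg process started at $0$ with stationary and independent increments with respect to a sublinear expectation. The process $(\xi_t,\eta_t,\zeta_t)_{t\in[0,1]}$ associated with $\Theta$ is a nonlinear Lévy process under a sublinear expectation $\tilde{\mathbb{E}}$ such that for every $\phi\in C_{b,\mathrm{Lip}}(\mathbb{R}^3)$, $u(t,x,y,z)=\tilde{\mathbb{E}}[\phi(x+\xi_t,y+\eta_t,z+\zeta_t)]$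 is the unique viscosity solution of the PIDE (its existence is known). Constants. $C_\phi$ is the Lipschitz constant of $\phi$ (with respect to $|x-x'|+|y-y'|+|z-z'|$), $C_0=C_\phi((M_{X_1}^2)^{1/2}+M_{Y_1}^1+M_* )\vee C_\phi$; $M_0=M_{X_1}^2+M_{X_1}^3+M_{Y_1}^1+M_{Y_1}^2+(M_{X_1}^3)^{1/3}(M_{Z_1}^\delta)^{2/3}+(M_{Y_1}^2)^{1/2}(M_{Z_1}^1)^{1/2}+M_{Z_1}^1$; $K_\rho=\max_{i+j\le3}\max_{|\gamma|=j}\int_{-1}^0\int_{|e|<1}|\partial_t^iD^\gamma\rho(\tau,e)|de\,d\tau$ for a fixed nonnegative $\rho\in C_c^\infty(\mathbb{R}\times\mathbb{R}^3)$ with unit integral and support in $[-1,0]\times B_1$; $C_{\alpha,\beta}$ is a constant, depending only on $\alpha$ and $C_\beta$, for which the inequality in (A3) holds with $\hat l(s,L_0)=C_{\alpha,\beta}\big[(\|D\varphi\|_\infty+\|D^2\varphi\|_\infty)s^{q_0}+\|D^2\varphi\|_\infty s^{(2-\alpha)/\alpha}\big]$. (The symbol $\Gamma$ for the interval and the exponent $\Gamma(\alpha,\delta,q_0)$ are unrelated.) *)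

theory Defs
  imports "HOL-Probability.Probability"
begin

section \<open>Sublinear expectations\<close>

text \<open>Functions of finitely many arguments \<open>a 0, \<dots>, a (m - 1)\<close> are represented as functions on
  sequences. The Lipschitz bound forces the value to depend on the first \<open>m\<close> entries only.\<close>

definition lipschitz_coords :: "nat \<Rightarrow> ((nat \<Rightarrow> 'a::metric_space) \<Rightarrow> real) \<Rightarrow> bool" where
  "lipschitz_coords m f \<longleftrightarrow>
     (\<exists>K. \<forall>a b. \<bar>f a - f b\<bar> \<le> K * (\<Sum>i<m. dist (a i) (b i)))"

definition C_b_Lip :: "('a::metric_space \<Rightarrow> real) set" where
  "C_b_Lip = {f. bounded (range f) \<and> (\<exists>K. K-lipschitz_on UNIV f)}"

definition sublinear_expectation ::
    "('w \<Rightarrow> real) set \<Rightarrow> (('w \<Rightarrow> real) \<Rightarrow> real) \<Rightarrow> bool" where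
  "sublinear_expectation H E \<longleftrightarrow>
     (\<forall>X\<in>H. \<forall>Y\<in>H. (\<lambda>w. X w + Y w) \<in> H) \<and>
     (\<forall>X\<in>H. \<forall>c. (\<lambda>w. c * X w) \<in> H) \<and>
     (\<forall>m f X. lipschitz_coords m f \<and> (\<forall>i<m. X i \<in> H) \<longrightarrow> (\<lambda>w. f (\<lambda>i. X i w)) \<in> H) \<and>
     (\<forall>X\<in>H. \<forall>Y\<in>H. (\<forall>w. X w \<le> Y w) \<longrightarrow> E X \<le> E Y) \<and>
     (\<forall>c. E (\<lambda>_. c) = c) \<and>
     (\<forall>X\<in>H. \<forall>Y\<in>H. E (\<lambda>w. X w + Y w) \<le> E X + E Y) \<and>
     (\<forall>X\<in>H. \<forall>c\<ge>0. E (\<lambda>w. c * X w) = c * E X)"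

definition same_distribution ::
    "(('w \<Rightarrow> real) \<Rightarrow> real) \<Rightarrow> ('w \<Rightarrow> 'a::metric_space) \<Rightarrow> ('w \<Rightarrow> 'a) \<Rightarrow> bool" where
  "same_distribution E X X' \<longleftrightarrow> (\<forall>f\<in>C_b_Lip. E (\<lambda>w. f (X w)) = E (\<lambda>w. f (X' w)))"

text \<open>\<open>independent_from E Y m X\<close>: \<open>Y\<close> is independent from \<open>(X 0, \<dots>, X (m - 1))\<close>. The order of the
  two iterated expectations matters.\<close>

definition independent_from ::
    "(('w \<Rightarrow> real) \<Rightarrow> real) \<Rightarrow> ('w \<Rightarrow> 'b::metric_space) \<Rightarrow> nat \<Rightarrow> (nat \<Rightarrow> 'w \<Rightarrow> 'a::metric_space) \<Rightarrow> bool"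
where
  "independent_from E Y m X \<longleftrightarrow>
     (\<forall>f. bounded (range (\<lambda>(a, b). f a b)) \<and>
          (\<exists>K. \<forall>a b a' b'. \<bar>f a b - f a' b'\<bar> \<le> K * ((\<Sum>i<m. dist (a i) (a' i)) + dist b b')) \<longrightarrow>
        E (\<lambda>w. f (\<lambda>i. X i w) (Y w)) = E (\<lambda>w. E (\<lambda>w'. f (\<lambda>i. X i w) (Y w'))))"

text \<open>The product functional \<open>E0\<^sup>\<otimes>\<^sup>\<nat>\<close> on functions of finitely many coordinates. Coordinate \<open>0\<close> is
  integrated outermost, so that each coordinate is independent from the preceding ones
  (\<open>product_expectation_independent\<close>). If \<open>E0\<close> preserves constants, every \<open>n\<close> such that \<open>f\<close>
  depends only on the first \<open>n\<close> coordinates gives the same value (\<open>product_expectation_eq\<close>).\<close>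

primrec iterated_expectation ::
    "(('a \<Rightarrow> real) \<Rightarrow> real) \<Rightarrow> nat \<Rightarrow> ((nat \<Rightarrow> 'a) \<Rightarrow> real) \<Rightarrow> real" where
  "iterated_expectation E0 0 f = f (\<lambda>_. undefined)"
| "iterated_expectation E0 (Suc n) f =
     E0 (\<lambda>v. iterated_expectation E0 n (\<lambda>w. f (case_nat v w)))"

definition product_expectation ::
    "(('a \<Rightarrow> real) \<Rightarrow> real) \<Rightarrow> ((nat \<Rightarrow> 'a) \<Rightarrow> real) \<Rightarrow> real" where
  "product_expectation E0 f =
     iterated_expectation E0 (LEAST n. \<forall>w w'. (\<forall>i<n. w i = w' i) \<longrightarrow> f w = f w') f"

lemma iterated_expectation_mono_index:
  assumes const: "\<And>c. E0 (\<lambda>_. c) = c"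
    and dep: "\<forall>w w'. (\<forall>i<n. w i = w' i) \<longrightarrow> f w = f w'" and "n \<le> m"
  shows "iterated_expectation E0 m f = iterated_expectation E0 n f"
  using dep \<open>n \<le> m\<close>
proof (induction m arbitrary: n f)
  case 0
  then show ?case by simp
next
  case (Suc m)
  show ?case
  proof (cases n)
    case 0
    with Suc.prems have c: "f w = f (\<lambda>_. undefined)" for w by blast
    have "iterated_expectation E0 m (\<lambda>w. f (case_nat v w)) = f (\<lambda>_. undefined)" for v
    proof -
      have "(\<lambda>w. f (case_nat v w)) = (\<lambda>_. f (\<lambda>_. undefined))" by (rule ext) (rule c)
      then show ?thesis using Suc.IH[of 0 "\<lambda>_. f (\<lambda>_. undefined)"] by simp
    qed
    then show ?thesis using 0 const by simp
  next
    case (Suc n')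
    have "iterated_expectation E0 m (\<lambda>w. f (case_nat v w))
        = iterated_expectation E0 n' (\<lambda>w. f (case_nat v w))" for v
    proof (rule Suc.IH)
      show "\<forall>w w'. (\<forall>i<n'. w i = w' i) \<longrightarrow> f (case_nat v w) = f (case_nat v w')"
        using Suc.prems(1) Suc by (auto split: nat.split)
    qed (use Suc.prems Suc in simp)
    then show ?thesis using Suc by simp
  qed
qed

lemma product_expectation_eq:
  assumes "\<And>c. E0 (\<lambda>_. c) = c" and dep: "\<forall>w w'. (\<forall>i<n. w i = w' i) \<longrightarrow> f w = f w'"
  shows "product_expectation E0 f = iterated_expectation E0 n f"
proof -
  let ?P = "\<lambda>n. \<forall>w w'. (\<forall>i<n. w i = w' i) \<longrightarrow> f w = f w'"
  have "?P (LEAST n. ?P n)" by (rule LeastI[of ?P, OF dep])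
  moreover have "(LEAST n. ?P n) \<le> n" by (rule Least_le[of ?P, OF dep])
  ultimately show ?thesis
    unfolding product_expectation_def by (rule iterated_expectation_mono_index[OF assms(1), symmetric])
qed

lemma iterated_expectation_Suc_last:
  assumes "\<forall>w w' v. (\<forall>i<m. w i = w' i) \<longrightarrow> f w v = f w' v"
  shows "iterated_expectation E0 (Suc m) (\<lambda>w. f w (w m))
       = iterated_expectation E0 m (\<lambda>w. E0 (f w))"
  using assms
proof (induction m arbitrary: f)
  case 0
  then have "f (case_nat v (\<lambda>_. undefined)) = f (\<lambda>_. undefined)" for v by auto
  then show ?case by simp
next
  case (Suc m)
  have "iterated_expectation E0 (Suc m) (\<lambda>w. f (case_nat v w) (w m))
      = iterated_expectation E0 m (\<lambda>w. E0 (f (case_nat v w)))" for v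
  proof (rule Suc.IH)
    show "\<forall>w w' u. (\<forall>i<m. w i = w' i) \<longrightarrow> f (case_nat v w) u = f (case_nat v w') u"
      using Suc.prems by (auto split: nat.split)
  qed
  then show ?case by simp
qed

lemma product_expectation_coordinate:
  assumes "\<And>c. E0 (\<lambda>_. c) = c"
  shows "product_expectation E0 (\<lambda>w. g (w m)) = E0 g"
proof -
  have "product_expectation E0 (\<lambda>w. g (w m)) = iterated_expectation E0 (Suc m) (\<lambda>w. g (w m))"
    by (rule product_expectation_eq) (use assms in auto)
  also have "\<dots> = iterated_expectation E0 m (\<lambda>w. E0 g)"
    using iterated_expectation_Suc_last[of m "\<lambda>_. g"] by simp
  also have "\<dots> = E0 g"
    using iterated_expectation_mono_index[of E0 0 "\<lambda>_. E0 g" m] assms by simp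
  finally show ?thesis .
qed

lemma product_expectation_independent:
  assumes const: "\<And>c. E0 (\<lambda>_. c) = c"
  shows "independent_from (product_expectation E0) (\<lambda>w. w m) m (\<lambda>i w. w i)"
  unfolding independent_from_def
proof (intro allI impI)
  fix f :: "(nat \<Rightarrow> 'a) \<Rightarrow> 'a \<Rightarrow> real"
  assume "bounded (range (\<lambda>(a, b). f a b)) \<and>
    (\<exists>K. \<forall>a b a' b'. \<bar>f a b - f a' b'\<bar> \<le> K * ((\<Sum>i<m. dist (a i) (a' i)) + dist b b'))"
  then obtain K where K:
    "\<And>a b a' b'. \<bar>f a b - f a' b'\<bar> \<le> K * ((\<Sum>i<m. dist (a i) (a' i)) + dist b b')" by blast
  have dep: "f a v = f a' v" if "\<forall>i<m. a i = a' i" for a a' v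
    using K[of a v a' v] that by simp
  have dep': "f a = f a'" if "\<forall>i<m. a i = a' i" for a a'
    using dep[OF that] by blast
  have "product_expectation E0 (\<lambda>w. f w (w m)) = iterated_expectation E0 (Suc m) (\<lambda>w. f w (w m))"
  proof (rule product_expectation_eq[OF const], intro allI impI)
    fix w w' :: "nat \<Rightarrow> 'a"
    assume eq: "\<forall>i<Suc m. w i = w' i"
    then have "\<forall>i<m. w i = w' i" by simp
    from dep'[OF this] eq show "f w (w m) = f w' (w' m)" by simp
  qed
  also have "\<dots> = iterated_expectation E0 m (\<lambda>w. E0 (f w))"
    by (rule iterated_expectation_Suc_last) (use dep in blast)
  also have "\<dots> = product_expectation E0 (\<lambda>w. E0 (f w))"
    by (rule product_expectation_eq[OF const, symmetric]) (auto intro!: arg_cong[where f = E0] dep')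
  moreover have "product_expectation E0 (\<lambda>w'. f w (w' m)) = E0 (f w)" for w
    by (rule product_expectation_coordinate[OF const])
  ultimately show "product_expectation E0 (\<lambda>w. f (\<lambda>i. w i) (w m))
      = product_expectation E0 (\<lambda>w. product_expectation E0 (\<lambda>w'. f (\<lambda>i. w i) (w' m)))"
    by simp
qed


section \<open>Uncertainty set and the operator \<open>G\<close>\<close>

type_synonym R3 = "real \<times> real \<times> real"

definition Lambda_set :: "real \<Rightarrow> real \<Rightarrow> (real \<times> real) set" where
  "Lambda_set lo hi = {lo<..<hi} \<times> {lo<..<hi}"

definition levy_measure :: "real \<Rightarrow> real \<times> real \<Rightarrow> real measure" where
  "levy_measure \<alpha> k = density lborel
     (\<lambda>l. ennreal ((fst k * indicator {..<0} l + snd k * indicator {0<..} l) / \<bar>l\<bar> powr (\<alpha> + 1)))"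

text \<open>Parameters \<open>(k, q, Q)\<close>, where \<open>Q\<close> stands for the variance \<open>\<sigma>\<^sup>2\<close>.\<close>

definition parameters ::
    "real \<Rightarrow> real \<Rightarrow> real \<Rightarrow> real \<Rightarrow> real \<Rightarrow> real \<Rightarrow> ((real \<times> real) \<times> real \<times> real) set" where
  "parameters lo hi \<gamma>lo \<gamma>hi \<sigma>lo \<sigma>hi = Lambda_set lo hi \<times> {\<gamma>lo..\<gamma>hi} \<times> {\<sigma>lo\<^sup>2..\<sigma>hi\<^sup>2}"

definition Theta ::
    "real \<Rightarrow> ((real \<times> real) \<times> real \<times> real) set \<Rightarrow> (real measure \<times> real \<times> real) set" where
  "Theta \<alpha> P = (\<lambda>(k, q, Q). (levy_measure \<alpha> k, q, Q)) ` P"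

definition jump_increment :: "real \<Rightarrow> (real \<Rightarrow> real) \<Rightarrow> real \<Rightarrow> real" where
  "jump_increment l f z = f (z + l) - f z - deriv f z * l"

definition G_op ::
    "(real measure \<times> real \<times> real) set \<Rightarrow> real \<Rightarrow> real \<Rightarrow> (real \<Rightarrow> real) \<Rightarrow> real" where
  "G_op \<Theta> p a f =
     (SUP (F, q, Q)\<in>\<Theta>. (\<integral>l. jump_increment l f 0 \<partial>F) + p * q + 1/2 * a * Q)"


section \<open>The classical random variables \<open>W\<^sub>k\<close>\<close>

text \<open>\<open>W\<^sub>k\<close> enters through its law \<open>\<mu> k\<close> only.\<close>

definition C1_on :: "real set \<Rightarrow> (real \<Rightarrow> real) \<Rightarrow> bool" where
  "C1_on S f \<longleftrightarrow>
     (\<exists>f'. continuous_on S f' \<and> (\<forall>z\<in>S. (f has_real_derivative f' z) (at z within S)))"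

definition W_laws ::
    "real \<Rightarrow> (real \<times> real) set \<Rightarrow> (real \<times> real \<Rightarrow> real measure) \<Rightarrow>
     (real \<times> real \<Rightarrow> real \<Rightarrow> real) \<Rightarrow> (real \<times> real \<Rightarrow> real \<Rightarrow> real) \<Rightarrow> bool" where
  "W_laws \<alpha> \<Lambda> \<mu> \<beta>1 \<beta>2 \<longleftrightarrow> (\<forall>k\<in>\<Lambda>.
     real_distribution (\<mu> k) \<and>
     (\<forall>z<0. cdf (\<mu> k) z = (fst k / \<alpha> + \<beta>1 k z) * (1 / \<bar>z\<bar> powr \<alpha>)) \<and>
     (\<forall>z>0. cdf (\<mu> k) z = 1 - (snd k / \<alpha> + \<beta>2 k z) * (1 / z powr \<alpha>)) \<and>
     C1_on {..0} (\<beta>1 k) \<and> C1_on {0..} (\<beta>2 k) \<and>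
     (\<beta>1 k \<longlongrightarrow> 0) at_bot \<and> (\<beta>2 k \<longlongrightarrow> 0) at_top)"

definition H1 :: "(real \<times> real) set \<Rightarrow> (real \<times> real \<Rightarrow> real measure) \<Rightarrow> bool" where
  "H1 \<Lambda> \<mu> \<longleftrightarrow> (\<forall>k\<in>\<Lambda>. integrable (\<mu> k) (\<lambda>z. z) \<and> (\<integral>z. z \<partial>\<mu> k) = 0)"

definition H2 ::
    "real \<Rightarrow> (real \<times> real) set \<Rightarrow> (real \<times> real \<Rightarrow> real \<Rightarrow> real) \<Rightarrow> (real \<times> real \<Rightarrow> real \<Rightarrow> real) \<Rightarrow>
     real \<Rightarrow> real \<Rightarrow> bool" where
  "H2 \<alpha> \<Lambda> \<beta>1 \<beta>2 q\<^sub>0 C\<^sub>\<beta> \<longleftrightarrow> q\<^sub>0 > 0 \<and> C\<^sub>\<beta> > 0 \<and>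
     (\<forall>k\<in>\<Lambda>. \<forall>n::nat. n \<ge> 1 \<longrightarrow>
        (let r = real n powr (1/\<alpha>); B = C\<^sub>\<beta> * real n powr (- q\<^sub>0) in
           \<bar>\<beta>1 k (- r)\<bar> \<le> B \<and>
           (\<integral>\<^sup>+z\<in>{..-1}. ennreal (\<bar>\<beta>1 k (r * z)\<bar> / \<bar>z\<bar> powr \<alpha>) \<partial>lborel) \<le> ennreal B \<and>
           (\<integral>\<^sup>+z\<in>{-1..0}. ennreal (\<bar>\<beta>1 k (r * z)\<bar> / \<bar>z\<bar> powr (\<alpha> - 1)) \<partial>lborel) \<le> ennreal B \<and>
           \<bar>\<beta>2 k r\<bar> \<le> B \<and>
           (\<integral>\<^sup>+z\<in>{1..}. ennreal (\<bar>\<beta>2 k (r * z)\<bar> / z powr \<alpha>) \<partial>lborel) \<le> ennreal B \<and>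
           (\<integral>\<^sup>+z\<in>{0..1}. ennreal (\<bar>\<beta>2 k (r * z)\<bar> / z powr (\<alpha> - 1)) \<partial>lborel) \<le> ennreal B))"


section \<open>The sequence \<open>(X\<^sub>i, Y\<^sub>i, Z\<^sub>i)\<close> and the assumptions on it\<close>

text \<open>The defining formula of \<open>E_0\<close> is used for all functions for which it makes sense, not just for
  those in \<open>C_Lip\<close>: moments such as \<open>E[\<bar>X\<^sub>1\<bar>\<^sup>3]\<close> are outside \<open>C_Lip\<close>. The supremum is real-valued, so
  finiteness is expressed separately by \<open>finite_E_0\<close>.\<close>

definition E_0 ::
    "((real \<times> real) \<times> real \<times> real) set \<Rightarrow> (real \<times> real \<Rightarrow> real measure) \<Rightarrow> (R3 \<Rightarrow> real) \<Rightarrow> real" where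
  "E_0 P \<mu> f = (SUP (k, q, Q)\<in>P.
     (\<integral>z. (\<integral>x. f (sqrt Q * x, q, z) * std_normal_density x \<partial>lborel) \<partial>\<mu> k))"

lemma E_0_const:
  assumes "P \<noteq> {}" and "\<And>k q Q. (k, q, Q) \<in> P \<Longrightarrow> prob_space (\<mu> k)"
  shows "E_0 P \<mu> (\<lambda>_. c) = c"
proof -
  have "(\<integral>z. (\<integral>x. c * std_normal_density x \<partial>lborel) \<partial>\<mu> k) = c" if "(k, q, Q) \<in> P" for k q Q
    using assms(2)[OF that] by (simp add: prob_space.prob_space)
  then have "E_0 P \<mu> (\<lambda>_. c) = (SUP _\<in>P. c)"
    unfolding E_0_def by (intro SUP_cong) auto
  then show ?thesis using assms(1) by simp
qed

definition finite_E_0 ::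
    "((real \<times> real) \<times> real \<times> real) set \<Rightarrow> (real \<times> real \<Rightarrow> real measure) \<Rightarrow> (R3 \<Rightarrow> real) \<Rightarrow> bool" where
  "finite_E_0 P \<mu> f \<longleftrightarrow> (SUP (k, q, Q)\<in>P.
     (\<integral>\<^sup>+z. (\<integral>\<^sup>+x. ennreal (\<bar>f (sqrt Q * x, q, z)\<bar> * std_normal_density x) \<partial>lborel) \<partial>\<mu> k)) < \<infinity>"

definition E_hat ::
    "((real \<times> real) \<times> real \<times> real) set \<Rightarrow> (real \<times> real \<Rightarrow> real measure) \<Rightarrow>
     ((nat \<Rightarrow> R3) \<Rightarrow> real) \<Rightarrow> real" where
  "E_hat P \<mu> = product_expectation (E_0 P \<mu>)"

text \<open>Indices start at \<open>0\<close>: \<open>X_seq i\<close> is \<open>X\<^sub>i\<^sub>+\<^sub>1\<close>, and similarly for \<open>Y\<close> and \<open>Z\<close>.\<close>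

definition X_seq :: "nat \<Rightarrow> (nat \<Rightarrow> R3) \<Rightarrow> real" where "X_seq i w = fst (w i)"
definition Y_seq :: "nat \<Rightarrow> (nat \<Rightarrow> R3) \<Rightarrow> real" where "Y_seq i w = fst (snd (w i))"
definition Z_seq :: "nat \<Rightarrow> (nat \<Rightarrow> R3) \<Rightarrow> real" where "Z_seq i w = snd (snd (w i))"

definition S1 :: "nat \<Rightarrow> (nat \<Rightarrow> R3) \<Rightarrow> real" where "S1 n w = (\<Sum>i<n. X_seq i w)"
definition S2 :: "nat \<Rightarrow> (nat \<Rightarrow> R3) \<Rightarrow> real" where "S2 n w = (\<Sum>i<n. Y_seq i w)"
definition S3 :: "nat \<Rightarrow> (nat \<Rightarrow> R3) \<Rightarrow> real" where "S3 n w = (\<Sum>i<n. Z_seq i w)"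

definition moment :: "(('w \<Rightarrow> real) \<Rightarrow> real) \<Rightarrow> ('w \<Rightarrow> real) \<Rightarrow> real \<Rightarrow> real" where
  "moment E \<xi> p = E (\<lambda>w. \<bar>\<xi> w\<bar> powr p)"

definition A1 ::
    "((real \<times> real) \<times> real \<times> real) set \<Rightarrow> (real \<times> real \<Rightarrow> real measure) \<Rightarrow> bool" where
  "A1 P \<mu> \<longleftrightarrow>
     E_hat P \<mu> (X_seq 0) = 0 \<and> E_hat P \<mu> (\<lambda>w. - X_seq 0 w) = 0 \<and>
     finite_E_0 P \<mu> (\<lambda>(x, y, z). \<bar>x\<bar> powr 3) \<and> finite_E_0 P \<mu> (\<lambda>(x, y, z). \<bar>y\<bar> powr 2)"

definition scaled_abs_mean ::
    "real \<Rightarrow> ((real \<times> real) \<times> real \<times> real) set \<Rightarrow> (real \<times> real \<Rightarrow> real measure) \<Rightarrow> nat \<Rightarrow> real" where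
  "scaled_abs_mean \<alpha> P \<mu> n = E_hat P \<mu> (\<lambda>w. real n powr (- 1/\<alpha>) * \<bar>S3 n w\<bar>)"

definition M_star ::
    "real \<Rightarrow> ((real \<times> real) \<times> real \<times> real) set \<Rightarrow> (real \<times> real \<Rightarrow> real measure) \<Rightarrow> real" where
  "M_star \<alpha> P \<mu> = (SUP n\<in>{1..}. scaled_abs_mean \<alpha> P \<mu> n)"

definition A2 ::
    "real \<Rightarrow> real \<Rightarrow> ((real \<times> real) \<times> real \<times> real) set \<Rightarrow> (real \<times> real \<Rightarrow> real measure) \<Rightarrow> bool" where
  "A2 \<alpha> \<delta> P \<mu> \<longleftrightarrow>
     E_hat P \<mu> (Z_seq 0) = 0 \<and> E_hat P \<mu> (\<lambda>w. - Z_seq 0 w) = 0 \<and>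
     bdd_above (scaled_abs_mean \<alpha> P \<mu> ` {1..}) \<and>
     max (3/4 * \<alpha>) 1 < \<delta> \<and> \<delta> < \<alpha> \<and> finite_E_0 P \<mu> (\<lambda>(x, y, z). \<bar>z\<bar> powr \<delta>)"

definition sup_norm :: "(real \<Rightarrow> real) \<Rightarrow> real" where
  "sup_norm f = (SUP z. \<bar>f z\<bar>)"

definition C_b_3 :: "(real \<Rightarrow> real) set" where
  "C_b_3 = {f. (\<forall>i<3. \<forall>z. (deriv ^^ i) f field_differentiable (at z)) \<and>
               continuous_on UNIV ((deriv ^^ 3) f) \<and>
               (\<forall>i\<le>3. bounded (range ((deriv ^^ i) f)))}"

definition L_0 :: "real \<Rightarrow> real \<Rightarrow> (real \<Rightarrow> real) \<Rightarrow> real" where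
  "L_0 p a f = \<bar>p\<bar> + \<bar>a\<bar> + sup_norm f + (\<Sum>i=1..3. sup_norm ((deriv ^^ i) f))"

definition consistency_error ::
    "real \<Rightarrow> ((real \<times> real) \<times> real \<times> real) set \<Rightarrow> (real \<times> real \<Rightarrow> real measure) \<Rightarrow>
     real \<Rightarrow> real \<Rightarrow> (real \<Rightarrow> real) \<Rightarrow> real \<Rightarrow> real \<Rightarrow> real" where
  "consistency_error \<alpha> P \<mu> p a f s z =
     1/s * \<bar>E_hat P \<mu> (\<lambda>w. f (z + s powr (1/\<alpha>) * Z_seq 0 w) - f z + s * p * Y_seq 0 w
                             + s/2 * a * (X_seq 0 w)\<^sup>2)
            - s * G_op (Theta \<alpha> P) p a (\<lambda>l. f (z + l))\<bar>"

definition A3 ::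
    "real \<Rightarrow> ((real \<times> real) \<times> real \<times> real) set \<Rightarrow> (real \<times> real \<Rightarrow> real measure) \<Rightarrow> bool" where
  "A3 \<alpha> P \<mu> \<longleftrightarrow> (\<exists>l :: real \<Rightarrow> real \<Rightarrow> real.
     (\<forall>C>0. uniform_limit {0..C} l (\<lambda>_. 0) (at_right 0)) \<and>
     (\<forall>p a. \<forall>f\<in>C_b_3. \<forall>s\<in>{0<..1}. \<forall>z.
        consistency_error \<alpha> P \<mu> p a f s z \<le> l s (L_0 p a f)))"

text \<open>\<open>A3_const\<close> says that \<open>C\<^sub>\<alpha>\<^sub>\<beta>\<close> is admissible as the constant \<open>C_{\<alpha>,\<beta>}\<close>.\<close>

definition A3_const ::
    "real \<Rightarrow> ((real \<times> real) \<times> real \<times> real) set \<Rightarrow> (real \<times> real \<Rightarrow> real measure) \<Rightarrow>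
     real \<Rightarrow> real \<Rightarrow> bool" where
  "A3_const \<alpha> P \<mu> q\<^sub>0 C\<^sub>\<alpha>\<^sub>\<beta> \<longleftrightarrow>
     (\<forall>p a. \<forall>f\<in>C_b_3. \<forall>s\<in>{0<..1}. \<forall>z.
        consistency_error \<alpha> P \<mu> p a f s z \<le>
          C\<^sub>\<alpha>\<^sub>\<beta> * ((sup_norm (deriv f) + sup_norm ((deriv ^^ 2) f)) * s powr q\<^sub>0
                 + sup_norm ((deriv ^^ 2) f) * s powr ((2 - \<alpha>) / \<alpha>)))"


section \<open>The PIDE and the nonlinear Levy process\<close>

text \<open>Derivative in direction \<open>b\<close>, relative to \<open>S\<close>: one-sided in time at \<open>t = 1\<close> when
  \<open>S = (0,1] \<times> \<real>\<^sup>3\<close>.\<close>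

definition dir_deriv ::
    "'a::real_normed_vector set \<Rightarrow> 'a \<Rightarrow> ('a \<Rightarrow> real) \<Rightarrow> 'a \<Rightarrow> real" where
  "dir_deriv S b f v =
     vector_derivative (\<lambda>s. f (v + s *\<^sub>R b)) (at 0 within {s. v + s *\<^sub>R b \<in> S})"

text \<open>\<open>C_b_along S B m f\<close>: all iterated partial derivatives of \<open>f\<close> of order at most \<open>m\<close> in directions
  from \<open>B\<close> exist, are continuous and bounded on \<open>S\<close>.\<close>

primrec C_b_along ::
    "'a::real_normed_vector set \<Rightarrow> 'a set \<Rightarrow> nat \<Rightarrow> ('a \<Rightarrow> real) \<Rightarrow> bool" where
  "C_b_along S B 0 f \<longleftrightarrow> continuous_on S f \<and> bounded (f ` S)"
| "C_b_along S B (Suc m) f \<longleftrightarrow> continuous_on S f \<and> bounded (f ` S) \<and>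
     (\<forall>b\<in>B. (\<forall>v\<in>S. (\<lambda>s. f (v + s *\<^sub>R b)) differentiable (at 0 within {s. v + s *\<^sub>R b \<in> S})) \<and>
             C_b_along S B m (dir_deriv S b f))"

definition e_t :: "real \<times> R3" where "e_t = (1, 0, 0, 0)"
definition e_x :: "real \<times> R3" where "e_x = (0, 1, 0, 0)"
definition e_y :: "real \<times> R3" where "e_y = (0, 0, 1, 0)"
definition e_z :: "real \<times> R3" where "e_z = (0, 0, 0, 1)"

definition PIDE_domain :: "(real \<times> R3) set" where
  "PIDE_domain = {0<..1} \<times> UNIV"

definition C_b_2_3 :: "(real \<times> R3 \<Rightarrow> real) set" where
  "C_b_2_3 = {\<psi>. C_b_along PIDE_domain {e_t} 2 \<psi> \<and> C_b_along PIDE_domain {e_x, e_y, e_z} 3 \<psi>}"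

definition PIDE_op ::
    "(real measure \<times> real \<times> real) set \<Rightarrow> (real \<times> R3 \<Rightarrow> real) \<Rightarrow> real \<times> R3 \<Rightarrow> real" where
  "PIDE_op \<Theta> \<psi> v =
     dir_deriv PIDE_domain e_t \<psi> v
     - G_op \<Theta> (dir_deriv PIDE_domain e_y \<psi> v)
         (dir_deriv PIDE_domain e_x (dir_deriv PIDE_domain e_x \<psi>) v)
         (\<lambda>l. \<psi> (v + l *\<^sub>R e_z))"

definition viscosity_solution ::
    "(real measure \<times> real \<times> real) set \<Rightarrow> (R3 \<Rightarrow> real) \<Rightarrow> (real \<times> R3 \<Rightarrow> real) \<Rightarrow> bool" where
  "viscosity_solution \<Theta> \<phi> u \<longleftrightarrow>
     continuous_on ({0..1} \<times> UNIV) u \<and> bounded (u ` ({0..1} \<times> UNIV)) \<and>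
     (\<forall>v. u (0, v) = \<phi> v) \<and>
     (\<forall>\<psi>\<in>C_b_2_3. \<forall>v\<in>PIDE_domain.
        \<psi> v = u v \<and> (\<forall>v'\<in>PIDE_domain. u v' \<le> \<psi> v') \<longrightarrow> PIDE_op \<Theta> \<psi> v \<le> 0) \<and>
     (\<forall>\<psi>\<in>C_b_2_3. \<forall>v\<in>PIDE_domain.
        \<psi> v = u v \<and> (\<forall>v'\<in>PIDE_domain. \<psi> v' \<le> u v') \<longrightarrow> PIDE_op \<Theta> \<psi> v \<ge> 0)"

text \<open>The second conjunct only asks that the bounded Lipschitz functions of finitely many \<open>L t\<close> lie
  in the domain \<open>H\<close> of \<open>E\<close>; this holds in particular if all components of \<open>L t\<close> lie in \<open>H\<close>.\<close>

definition nonlinear_Levy_process ::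
    "('w \<Rightarrow> real) set \<Rightarrow> (('w \<Rightarrow> real) \<Rightarrow> real) \<Rightarrow> (real \<Rightarrow> 'w \<Rightarrow> R3) \<Rightarrow> bool" where
  "nonlinear_Levy_process H E L \<longleftrightarrow>
     sublinear_expectation H E \<and>
     (\<forall>m ts f. (\<forall>i<m. ts i \<in> {0..1}) \<and> bounded (range f) \<and> lipschitz_coords m f \<longrightarrow>
        (\<lambda>w. f (\<lambda>i. L (ts i) w)) \<in> H) \<and>
     (\<forall>w. L 0 w = 0) \<and>
     (\<forall>w. \<forall>t\<in>{0..<1}. ((\<lambda>s. L s w) \<longlongrightarrow> L t w) (at_right t)) \<and>
     (\<forall>w. \<forall>t\<in>{0<..1}. \<exists>l. ((\<lambda>s. L s w) \<longlongrightarrow> l) (at_left t)) \<and>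
     (\<forall>t\<ge>0. \<forall>s\<ge>0. t + s \<le> 1 \<longrightarrow>
        same_distribution E (\<lambda>w. L (t + s) w - L t w) (L s) \<and>
        (\<forall>m ts. (\<forall>i<m. ts i \<in> {0..t}) \<longrightarrow>
           independent_from E (\<lambda>w. L (t + s) w - L t w) m (\<lambda>i. L (ts i))))"

definition associated_Levy_process ::
    "(real measure \<times> real \<times> real) set \<Rightarrow> ('w \<Rightarrow> real) set \<Rightarrow> (('w \<Rightarrow> real) \<Rightarrow> real) \<Rightarrow>
     (real \<Rightarrow> 'w \<Rightarrow> R3) \<Rightarrow> bool" where
  "associated_Levy_process \<Theta> H E L \<longleftrightarrow>
     nonlinear_Levy_process H E L \<and>
     (\<forall>\<phi>\<in>C_b_Lip.
        viscosity_solution \<Theta> \<phi> (\<lambda>(t, v). E (\<lambda>w. \<phi> (v + L t w))) \<and>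
        (\<forall>u. viscosity_solution \<Theta> \<phi> u \<longrightarrow>
           (\<forall>t\<in>{0..1}. \<forall>v. u (t, v) = E (\<lambda>w. \<phi> (v + L t w)))))"


section \<open>Constants\<close>

definition Lip_const :: "(R3 \<Rightarrow> real) \<Rightarrow> real" where
  "Lip_const \<phi> = Inf {K. K \<ge> 0 \<and> (\<forall>x y z x' y' z'.
     \<bar>\<phi> (x, y, z) - \<phi> (x', y', z')\<bar> \<le> K * (\<bar>x - x'\<bar> + \<bar>y - y'\<bar> + \<bar>z - z'\<bar>))}"

definition C_0 ::
    "real \<Rightarrow> ((real \<times> real) \<times> real \<times> real) set \<Rightarrow> (real \<times> real \<Rightarrow> real measure) \<Rightarrow>
     (R3 \<Rightarrow> real) \<Rightarrow> real" where
  "C_0 \<alpha> P \<mu> \<phi> =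
     max (Lip_const \<phi> * (moment (E_hat P \<mu>) (X_seq 0) 2 powr (1/2) + moment (E_hat P \<mu>) (Y_seq 0) 1
            + M_star \<alpha> P \<mu>))
         (Lip_const \<phi>)"

definition M_0 ::
    "real \<Rightarrow> ((real \<times> real) \<times> real \<times> real) set \<Rightarrow> (real \<times> real \<Rightarrow> real measure) \<Rightarrow> real" where
  "M_0 \<delta> P \<mu> =
     (let MX = moment (E_hat P \<mu>) (X_seq 0);
          MY = moment (E_hat P \<mu>) (Y_seq 0);
          MZ = moment (E_hat P \<mu>) (Z_seq 0)
      in MX 2 + MX 3 + MY 1 + MY 2 + MX 3 powr (1/3) * MZ \<delta> powr (2/3)
         + MY 2 powr (1/2) * MZ 1 powr (1/2) + MZ 1)"

definition mollifier :: "(real \<times> R3 \<Rightarrow> real) \<Rightarrow> bool" where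
  "mollifier \<rho> \<longleftrightarrow>
     (\<forall>m. C_b_along UNIV Basis m \<rho>) \<and> (\<forall>v. \<rho> v \<ge> 0) \<and> integral\<^sup>L lborel \<rho> = 1 \<and>
     compact (closure {v. \<rho> v \<noteq> 0}) \<and> closure {v. \<rho> v \<noteq> 0} \<subseteq> {-1..0} \<times> ball 0 1"

text \<open>\<open>(a, b, c)\<close> is the spatial multi-index.\<close>

definition K_rho :: "(real \<times> R3 \<Rightarrow> real) \<Rightarrow> real" where
  "K_rho \<rho> = Max {(LINT v:{-1..0} \<times> ball 0 1|lborel.
       \<bar>(dir_deriv UNIV e_t ^^ i) ((dir_deriv UNIV e_x ^^ a) ((dir_deriv UNIV e_y ^^ b)
          ((dir_deriv UNIV e_z ^^ c) \<rho>))) v\<bar>) | i a b c. i + (a + b + c) \<le> 3}"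

definition rate_exponent :: "real \<Rightarrow> real \<Rightarrow> real \<Rightarrow> real" where
  "rate_exponent \<alpha> \<delta> q\<^sub>0 =
     Min {(4 * \<delta> - 3 * \<alpha>) / (2 * \<alpha> * (2 * \<delta> + 3)), (2 - \<alpha>) / (2 * \<alpha>), q\<^sub>0 / 2}"

end

theory Submission
  imports Defs
begin

text \<open>
  Let \<open>T h f v\<close> be the one-step expectation of \<open>f\<close> at \<open>v\<close> plus an increment scaled to the step size \<open>h\<close>.
  The product structure of \<open>E_hat\<close> turns the expectation on the left-hand side into the \<open>n\<close>-th iterate of
  \<open>T (1/n)\<close>, applied to \<open>\<phi>\<close> at \<open>0\<close>. The operators \<open>T h\<close> are monotone, sublinear and translation
  invariant, and they preserve Lipschitz constants.

  The heart of the proof is a comparison of two step sizes, \<open>h\<close> and \<open>h / m\<close>. On a smooth function \<open>g\<close>, one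
  step \<open>h\<close> changes \<open>g\<close> by \<open>h\<close> times the right-hand side \<open>Gen g\<close> of the equation, up to a small multiple of
  \<open>h\<close> (\<open>step_consistent\<close>). The same holds for \<open>m\<close> steps \<open>h / m\<close> (\<open>steps_consistent\<close>), since \<open>Gen g\<close> is
  Lipschitz and the mean displacement within time \<open>h\<close> is of order \<open>sqrt h\<close> (\<open>displacement_le\<close>). A function
  that is merely Lipschitz is mollified at a scale \<open>\<epsilon>\<close> first. By Jensen's inequality a mollified iterate
  dominates the iterate of the mollified function, and this one-sided relation is enough to replace
  one scheme by the other round by round, in both directions (\<open>scheme_comparison\<close>). Derivatives
  of order \<open>j\<close> of the mollified function are of order \<open>\<epsilon>\<close> to the power \<open>1 - j\<close>, so \<open>\<epsilon> = h powr r\<close> with the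
  exponent \<open>r\<close> of the theorem makes the total error of order \<open>h powr r\<close> (\<open>refinement_rate\<close>).

  Hence the schemes with step sizes \<open>1/2\<^sup>m\<close> converge uniformly, at this rate, to a function
  \<open>solution\<close>. Its value at time \<open>t\<close> is the limit of iterates applied to its value at time \<open>t - s\<close>. If a test
  function touches \<open>solution\<close> from above or from below at a point, then monotonicity and the small-time
  expansion of these iterates give the viscosity inequality there (\<open>solution_viscosity\<close>).
  By uniqueness, \<open>solution\<close> is the function defined by the nonlinear Levy process, and the rate of
  convergence of the schemes is the assertion of the theorem.
\<close>

section \<open>Lipschitz functions on the state space\<close>

text \<open>The norm to which the Lipschitz constant \<open>Lip_const\<close> refers.\<close>

definition ell1 :: "R3 \<Rightarrow> real" where
  "ell1 v = \<bar>fst v\<bar> + \<bar>fst (snd v)\<bar> + \<bar>snd (snd v)\<bar>"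

lemma ell1_simps [simp]: "ell1 (x, y, z) = \<bar>x\<bar> + \<bar>y\<bar> + \<bar>z\<bar>"
  by (simp add: ell1_def)

lemma ell1_nonneg [simp]: "0 \<le> ell1 v"
  by (simp add: ell1_def)

lemma ell1_zero [simp]: "ell1 0 = 0"
  by (simp add: ell1_def)

lemma ell1_add_le: "ell1 (v + w) \<le> ell1 v + ell1 w"
  by (simp add: ell1_def)

lemma ell1_minus_commute: "ell1 (v - w) = ell1 (w - v)"
  by (simp add: ell1_def abs_minus_commute)

lemma ell1_scaleR [simp]: "ell1 (s *\<^sub>R v) = \<bar>s\<bar> * ell1 v"
  by (simp add: ell1_def abs_mult algebra_simps)

lemma ell1_le_norm: "ell1 v \<le> 3 * norm v"
proof -
  have "\<bar>fst v\<bar> \<le> norm v" using norm_fst_le[of "fst v" "snd v"] by simp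
  moreover have 1: "norm (snd v) \<le> norm v" using norm_snd_le[of "snd v" "fst v"] by simp
  moreover have "\<bar>fst (snd v)\<bar> \<le> norm (snd v)"
    using norm_fst_le[of "fst (snd v)" "snd (snd v)"] by simp
  moreover have "\<bar>snd (snd v)\<bar> \<le> norm (snd v)"
    using norm_snd_le[of "snd (snd v)" "fst (snd v)"] by simp
  ultimately show ?thesis unfolding ell1_def by linarith
qed

lemma norm_le_ell1: "norm v \<le> ell1 v"
proof -
  obtain x y z where v: "v = (x, y, z)" by (cases v) auto
  have "norm v \<le> norm x + norm (y, z)" unfolding v by (rule norm_Pair_le)
  also have "norm (y, z) \<le> norm y + norm z" by (rule norm_Pair_le)
  finally show ?thesis by (simp add: v)
qed

definition Lip1 :: "real \<Rightarrow> (R3 \<Rightarrow> real) \<Rightarrow> bool" where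
  "Lip1 K f \<longleftrightarrow> 0 \<le> K \<and> (\<forall>v w. \<bar>f v - f w\<bar> \<le> K * ell1 (v - w))"

lemma Lip1D: "Lip1 K f \<Longrightarrow> \<bar>f v - f w\<bar> \<le> K * ell1 (v - w)"
  unfolding Lip1_def by blast

lemma Lip1_nonneg: "Lip1 K f \<Longrightarrow> 0 \<le> K"
  by (simp add: Lip1_def)

lemma Lip1_mono: "Lip1 K f \<Longrightarrow> K \<le> K' \<Longrightarrow> Lip1 K' f"
  unfolding Lip1_def by (meson ell1_nonneg mult_right_mono order_trans)

lemma Lip1_const: "Lip1 0 (\<lambda>_. c)"
  by (simp add: Lip1_def)

lemma Lip1_add:
  assumes "Lip1 K f" "Lip1 L g"
  shows "Lip1 (K + L) (\<lambda>v. f v + g v)"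
  unfolding Lip1_def
proof (intro conjI allI)
  show "0 \<le> K + L" using assms by (simp add: Lip1_def)
  fix v w
  have "\<bar>f v - f w\<bar> \<le> K * ell1 (v - w)" "\<bar>g v - g w\<bar> \<le> L * ell1 (v - w)"
    using assms by (auto dest: Lip1D)
  then show "\<bar>f v + g v - (f w + g w)\<bar> \<le> (K + L) * ell1 (v - w)"
    unfolding ring_distribs by linarith
qed

lemma Lip1_cmult:
  assumes "Lip1 K f"
  shows "Lip1 (\<bar>c\<bar> * K) (\<lambda>v. c * f v)"
  unfolding Lip1_def
proof (intro conjI allI)
  show "0 \<le> \<bar>c\<bar> * K" using assms by (simp add: Lip1_def)
  fix v w
  have "\<bar>c * f v - c * f w\<bar> = \<bar>c\<bar> * \<bar>f v - f w\<bar>"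
    by (simp add: abs_mult flip: right_diff_distrib)
  also have "\<dots> \<le> \<bar>c\<bar> * (K * ell1 (v - w))"
    by (intro mult_left_mono Lip1D assms) auto
  finally show "\<bar>c * f v - c * f w\<bar> \<le> \<bar>c\<bar> * K * ell1 (v - w)" by (simp add: mult.assoc)
qed

lemma Lip1_uminus: "Lip1 K f \<Longrightarrow> Lip1 K (\<lambda>v. - f v)"
  using Lip1_cmult[of K f "-1"] by simp

lemma Lip1_diff: "Lip1 K f \<Longrightarrow> Lip1 L g \<Longrightarrow> Lip1 (K + L) (\<lambda>v. f v - g v)"
  using Lip1_add[OF _ Lip1_uminus, of K f L g] by simp

lemma Lip1_shift: "Lip1 K f \<Longrightarrow> Lip1 K (\<lambda>v. f (v + a))"
  unfolding Lip1_def by (metis add_diff_cancel_right)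

lemma Lip1_ell1_dist: "Lip1 1 (\<lambda>v. ell1 (v - a))"
  unfolding Lip1_def
proof (intro conjI allI)
  fix v w
  have "ell1 (v - a) \<le> ell1 (v - w) + ell1 (w - a)" "ell1 (w - a) \<le> ell1 (w - v) + ell1 (v - a)"
    using ell1_add_le[of "v - w" "w - a"] ell1_add_le[of "w - v" "v - a"] by simp_all
  then show "\<bar>ell1 (v - a) - ell1 (w - a)\<bar> \<le> 1 * ell1 (v - w)"
    using ell1_minus_commute[of v w] by simp
qed simp

lemma Lip1_continuous_on:
  assumes "Lip1 K f"
  shows "continuous_on S f"
proof (rule continuous_on_subset)
  have "(3 * K)-lipschitz_on UNIV f"
  proof (rule lipschitz_onI)
    fix v w
    have "\<bar>f v - f w\<bar> \<le> K * ell1 (v - w)" using assms by (rule Lip1D)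
    also have "\<dots> \<le> K * (3 * norm (v - w))"
      using ell1_le_norm assms by (intro mult_left_mono) (auto simp: Lip1_def)
    finally show "dist (f v) (f w) \<le> 3 * K * dist v w"
      by (simp add: dist_norm)
  qed (use assms in \<open>simp add: Lip1_def\<close>)
  then show "continuous_on UNIV f" by (rule lipschitz_on_continuous_on)
qed simp

lemma Lip1_measurable: "Lip1 K f \<Longrightarrow> f \<in> borel_measurable borel"
  using Lip1_continuous_on borel_measurable_continuous_onI by blast


section \<open>Calculus of the one-step expectation\<close>

text \<open>Dominates every monomial that occurs in the Taylor remainder of one step. It is a product of
  functions of the single coordinates, so its mean under a product law is a product of moments.\<close>

definition weight :: "R3 \<Rightarrow> real" where
  "weight = (\<lambda>(x, y, z). (1 + \<bar>x\<bar> ^ 3) * (1 + y\<^sup>2) * (1 + \<bar>z\<bar>))"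

lemma weight_ge:
  "1 \<le> weight (x, y, z)" "\<bar>x\<bar> \<le> weight (x, y, z)" "x\<^sup>2 \<le> weight (x, y, z)" "\<bar>x\<bar> ^ 3 \<le> weight (x, y, z)"
  "\<bar>y\<bar> \<le> weight (x, y, z)" "y\<^sup>2 \<le> weight (x, y, z)" "\<bar>z\<bar> \<le> weight (x, y, z)"
  "x\<^sup>2 * \<bar>z\<bar> \<le> weight (x, y, z)" "x\<^sup>2 * \<bar>y\<bar> \<le> weight (x, y, z)" "\<bar>y\<bar> * \<bar>z\<bar> \<le> weight (x, y, z)"
proof -
  have a1: "\<bar>x\<bar> \<le> 1 + \<bar>x\<bar> ^ 3"
  proof (cases "\<bar>x\<bar> \<le> 1")
    case False
    then have "\<bar>x\<bar> ^ 1 \<le> \<bar>x\<bar> ^ 3" by (intro power_increasing) auto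
    then show ?thesis by simp
  qed (simp add: add_increasing2)
  have a2: "x\<^sup>2 \<le> 1 + \<bar>x\<bar> ^ 3"
  proof (cases "\<bar>x\<bar> \<le> 1")
    case True
    then have "x\<^sup>2 \<le> 1" by (simp add: abs_square_le_1)
    then show ?thesis by (simp add: add_increasing2)
  next
    case False
    then have "\<bar>x\<bar> ^ 2 \<le> \<bar>x\<bar> ^ 3" by (intro power_increasing) auto
    then show ?thesis by simp
  qed
  have b1: "\<bar>y\<bar> \<le> 1 + y\<^sup>2"
  proof -
    have "0 \<le> (\<bar>y\<bar> - 1)\<^sup>2" by simp
    then have "2 * \<bar>y\<bar> \<le> 1 + y\<^sup>2" by (simp add: power2_diff)
    then show ?thesis by linarith
  qed
  let ?X = "1 + \<bar>x\<bar> ^ 3" and ?Y = "1 + y\<^sup>2" and ?Z = "1 + \<bar>z\<bar>"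
  have *: "a * b * c \<le> ?X * ?Y * ?Z"
    if "0 \<le> a" "a \<le> ?X" "0 \<le> b" "b \<le> ?Y" "0 \<le> c" "c \<le> ?Z" for a b c
    using that by (intro mult_mono) auto
  note w = weight_def prod.case
  show "1 \<le> weight (x, y, z)" using *[of 1 1 1] by (simp add: w)
  show "\<bar>x\<bar> \<le> weight (x, y, z)" using *[of "\<bar>x\<bar>" 1 1] a1 by (simp add: w)
  show "x\<^sup>2 \<le> weight (x, y, z)" using *[of "x\<^sup>2" 1 1] a2 by (simp add: w)
  show "\<bar>x\<bar> ^ 3 \<le> weight (x, y, z)" using *[of "\<bar>x\<bar> ^ 3" 1 1] by (simp add: w)
  show "\<bar>y\<bar> \<le> weight (x, y, z)" using *[of 1 "\<bar>y\<bar>" 1] b1 by (simp add: w)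
  show "y\<^sup>2 \<le> weight (x, y, z)" using *[of 1 "y\<^sup>2" 1] by (simp add: w)
  show "\<bar>z\<bar> \<le> weight (x, y, z)" using *[of 1 1 "\<bar>z\<bar>"] by (simp add: w)
  show "x\<^sup>2 * \<bar>z\<bar> \<le> weight (x, y, z)" using *[of "x\<^sup>2" 1 "\<bar>z\<bar>"] a2 by (simp add: w)
  show "x\<^sup>2 * \<bar>y\<bar> \<le> weight (x, y, z)" using *[of "x\<^sup>2" "\<bar>y\<bar>" 1] a2 b1 by (simp add: w)
  show "\<bar>y\<bar> * \<bar>z\<bar> \<le> weight (x, y, z)" using *[of 1 "\<bar>y\<bar>" "\<bar>z\<bar>"] b1 by (simp add: w)
qed

lemma weight_nonneg: "0 \<le> weight v"
  by (cases v) (simp add: weight_def)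

text \<open>On this class all means are uniformly bounded over the parameters, which makes the real-valued
  supremum in \<open>E_0\<close> meaningful and sublinear.\<close>

definition admissible :: "(R3 \<Rightarrow> real) \<Rightarrow> bool" where
  "admissible F \<longleftrightarrow> F \<in> borel_measurable borel \<and> (\<exists>C. \<forall>v. \<bar>F v\<bar> \<le> C * weight v)"

lemma admissibleI:
  "F \<in> borel_measurable borel \<Longrightarrow> (\<And>v. \<bar>F v\<bar> \<le> C * weight v) \<Longrightarrow> admissible F"
  by (auto simp: admissible_def)

lemma admissible_const [intro]: "admissible (\<lambda>_. c)"
proof (rule admissibleI[of _ "\<bar>c\<bar>"])
  fix v :: R3
  show "\<bar>c\<bar> \<le> \<bar>c\<bar> * weight v"
    using mult_left_mono[OF weight_ge(1), of "\<bar>c\<bar>"] by (cases v) auto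
qed simp

lemma admissible_add [intro]:
  assumes "admissible F" "admissible G"
  shows "admissible (\<lambda>v. F v + G v)"
proof -
  obtain C D where CD: "\<And>v. \<bar>F v\<bar> \<le> C * weight v" "\<And>v. \<bar>G v\<bar> \<le> D * weight v"
    using assms by (auto simp: admissible_def)
  show ?thesis
  proof (rule admissibleI[of _ "C + D"])
    show "(\<lambda>v. F v + G v) \<in> borel_measurable borel"
      using assms by (auto simp: admissible_def)
    show "\<bar>F v + G v\<bar> \<le> (C + D) * weight v" for v
      using CD[of v] unfolding distrib_right by linarith
  qed
qed

lemma admissible_cmult [intro]:
  assumes "admissible F"
  shows "admissible (\<lambda>v. c * F v)"
proof -
  obtain C where C: "\<And>v. \<bar>F v\<bar> \<le> C * weight v"
    using assms by (auto simp: admissible_def)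
  show ?thesis
  proof (rule admissibleI[of _ "\<bar>c\<bar> * C"])
    show "(\<lambda>v. c * F v) \<in> borel_measurable borel"
      using assms by (auto simp: admissible_def)
    show "\<bar>c * F v\<bar> \<le> \<bar>c\<bar> * C * weight v" for v
      using mult_left_mono[OF C, of "\<bar>c\<bar>"] by (simp add: abs_mult mult.assoc)
  qed
qed

lemma admissible_uminus [intro]: "admissible F \<Longrightarrow> admissible (\<lambda>v. - F v)"
  using admissible_cmult[of F "-1"] by simp

lemma admissible_diff [intro]: "admissible F \<Longrightarrow> admissible G \<Longrightarrow> admissible (\<lambda>v. F v - G v)"
  using admissible_add[OF _ admissible_uminus, of F G] by simp

lemma admissible_bounded_by:
  assumes "F \<in> borel_measurable borel" "admissible G" "\<And>v. \<bar>F v\<bar> \<le> G v"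
  shows "admissible F"
proof -
  obtain C where C: "\<And>v. \<bar>G v\<bar> \<le> C * weight v"
    using assms by (auto simp: admissible_def)
  have "\<bar>F v\<bar> \<le> C * weight v" for v
    using assms(3)[of v] C[of v] by linarith
  then show ?thesis
    by (rule admissibleI[OF assms(1)])
qed

lemma admissible_monomials:
  "admissible (\<lambda>v. fst v)" "admissible (\<lambda>v. \<bar>fst v\<bar>)" "admissible (\<lambda>v. (fst v)\<^sup>2)" "admissible (\<lambda>v. \<bar>fst v\<bar> ^ 3)"
  "admissible (\<lambda>v. fst (snd v))" "admissible (\<lambda>v. \<bar>fst (snd v)\<bar>)" "admissible (\<lambda>v. (fst (snd v))\<^sup>2)"
  "admissible (\<lambda>v. \<bar>snd (snd v)\<bar>)"
  "admissible (\<lambda>v. (fst v)\<^sup>2 * \<bar>snd (snd v)\<bar>)" "admissible (\<lambda>v. (fst v)\<^sup>2 * \<bar>fst (snd v)\<bar>)"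
  "admissible (\<lambda>v. \<bar>fst (snd v)\<bar> * \<bar>snd (snd v)\<bar>)"
proof -
  have *: "admissible F" if "F \<in> borel_measurable borel" "\<And>x y z. \<bar>F (x, y, z)\<bar> \<le> weight (x, y, z)" for F
    using that by (intro admissibleI[of F 1]) auto
  have m: "(\<lambda>v::R3. fst v) \<in> borel_measurable borel" "(\<lambda>v::R3. fst (snd v)) \<in> borel_measurable borel"
    "(\<lambda>v::R3. snd (snd v)) \<in> borel_measurable borel"
    by (auto intro!: borel_measurable_continuous_onI continuous_intros)
  show "admissible (\<lambda>v. fst v)" "admissible (\<lambda>v. \<bar>fst v\<bar>)" "admissible (\<lambda>v. (fst v)\<^sup>2)" "admissible (\<lambda>v. \<bar>fst v\<bar> ^ 3)"
    "admissible (\<lambda>v. fst (snd v))" "admissible (\<lambda>v. \<bar>fst (snd v)\<bar>)" "admissible (\<lambda>v. (fst (snd v))\<^sup>2)"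
    "admissible (\<lambda>v. \<bar>snd (snd v)\<bar>)"
    "admissible (\<lambda>v. (fst v)\<^sup>2 * \<bar>snd (snd v)\<bar>)" "admissible (\<lambda>v. (fst v)\<^sup>2 * \<bar>fst (snd v)\<bar>)"
    "admissible (\<lambda>v. \<bar>fst (snd v)\<bar> * \<bar>snd (snd v)\<bar>)"
    by (rule *; use m in measurable | simp add: abs_mult weight_ge)+
qed

definition mean_at :: "(real \<times> real \<Rightarrow> real measure) \<Rightarrow> (real \<times> real) \<times> real \<times> real \<Rightarrow> (R3 \<Rightarrow> real) \<Rightarrow> real" where
  "mean_at \<mu> = (\<lambda>(k, q, Q) F. \<integral>z. (\<integral>x. F (sqrt Q * x, q, z) * std_normal_density x \<partial>lborel) \<partial>\<mu> k)"

lemma E_0_eq_SUP_mean_at: "E_0 P \<mu> F = (SUP \<theta>\<in>P. mean_at \<mu> \<theta> F)"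
  unfolding E_0_def mean_at_def by (simp add: case_prod_unfold)

text \<open>The law of \<open>(\<sigma>\<xi>, q, W)\<close> with \<open>W\<close> distributed according to \<open>N\<close> and \<open>\<xi>\<close> an independent standard
  normal variable. The factor \<open>N\<close> comes first because \<open>E_0\<close> integrates over \<open>z\<close> outermost.\<close>

definition joint_law :: "real measure \<Rightarrow> real \<Rightarrow> real \<Rightarrow> R3 measure" where
  "joint_law N q Q = distr (N \<Otimes>\<^sub>M density lborel std_normal_density) borel (\<lambda>p. (sqrt Q * snd p, q, fst p))"

lemma std_normal_abs_cube_le:
  "integrable lborel (\<lambda>x. \<bar>x\<bar> ^ 3 * std_normal_density x)"
  "(\<integral>x. \<bar>x\<bar> ^ 3 * std_normal_density x \<partial>lborel) \<le> 2"
proof -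
  have 1: "has_bochner_integral lborel (\<lambda>x. std_normal_density x * \<bar>x\<bar> ^ 3) (sqrt (2/pi) * 2)"
    using std_normal_moment_abs_odd[of 1] by (simp add: numeral_3_eq_3)
  then show "integrable lborel (\<lambda>x. \<bar>x\<bar> ^ 3 * std_normal_density x)"
    by (auto simp: has_bochner_integral_iff mult.commute)
  have "sqrt (2/pi) \<le> 1" using pi_gt3 by (simp add: field_simps)
  then show "(\<integral>x. \<bar>x\<bar> ^ 3 * std_normal_density x \<partial>lborel) \<le> 2"
    using 1 by (simp add: has_bochner_integral_iff mult.commute)
qed

lemma std_normal_square:
  "integrable lborel (\<lambda>x. x\<^sup>2 * std_normal_density x)"
  "(\<integral>x. x\<^sup>2 * std_normal_density x \<partial>lborel) = 1"
  using std_normal_moment_even[of 1] by (auto simp: has_bochner_integral_iff mult.commute)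

lemma std_normal_first:
  "integrable lborel (\<lambda>x. x * std_normal_density x)"
  "(\<integral>x. x * std_normal_density x \<partial>lborel) = 0"
  using std_normal_moment_odd[of 0] by (auto simp: has_bochner_integral_iff mult.commute)

lemma prob_space_std_normal: "prob_space (density lborel std_normal_density)"
  by (rule prob_space_normal_density) simp

text \<open>The iterated integrals in \<open>E_0\<close> become integrals against one probability measure, so that
  linearity and monotonicity hold without integrability conditions on the inner integrals.\<close>

lemma joint_law_mean:
  assumes N: "real_distribution N" and iz: "integrable N (\<lambda>z. z)" and adm: "admissible F"
  shows "integrable (joint_law N q Q) F"
    and "(\<integral>v. F v \<partial>joint_law N q Q) = (\<integral>z. (\<integral>x. F (sqrt Q * x, q, z) * std_normal_density x \<partial>lborel) \<partial>N)"
    and "integrable N (\<lambda>z. \<integral>x. F (sqrt Q * x, q, z) * std_normal_density x \<partial>lborel)"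
proof -
  interpret N: real_distribution N by fact
  let ?D = "density lborel std_normal_density"
  interpret D: prob_space ?D by (rule prob_space_std_normal)
  interpret pair_sigma_finite N ?D ..
  let ?m = "\<lambda>p :: real \<times> real. (sqrt Q * snd p, q, fst p)"
  have m: "?m \<in> measurable (N \<Otimes>\<^sub>M ?D) borel"
    by (subst measurable_cong_sets[OF sets_pair_measure_cong[OF N.events_eq_borel sets_density] refl])
       (auto intro!: borel_measurable_Pair)
  have F[measurable]: "F \<in> borel_measurable borel" using adm by (simp add: admissible_def)
  have dens: "(\<integral>x. g x \<partial>?D) = (\<integral>x. g x * std_normal_density x \<partial>lborel)"
    if "g \<in> borel_measurable borel" for g :: "real \<Rightarrow> real"
    using that by (subst integral_density) (auto simp: mult.commute)
  have idens: "integrable ?D g \<longleftrightarrow> integrable lborel (\<lambda>x. g x * std_normal_density x)"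
    if "g \<in> borel_measurable borel" for g :: "real \<Rightarrow> real"
    using that by (subst integrable_density) (auto simp: mult.commute)
  let ?w = "\<lambda>x. 1 + \<bar>sqrt Q * x\<bar> ^ 3"
  have iD: "integrable ?D ?w"
  proof (subst idens)
    have "(\<lambda>x. (1 + \<bar>sqrt Q * x\<bar> ^ 3) * std_normal_density x)
        = (\<lambda>x. std_normal_density x + \<bar>sqrt Q\<bar> ^ 3 * (\<bar>x\<bar> ^ 3 * std_normal_density x))"
      by (simp add: abs_mult power_mult_distrib algebra_simps)
    then show "integrable lborel (\<lambda>x. (1 + \<bar>sqrt Q * x\<bar> ^ 3) * std_normal_density x)"
      using std_normal_abs_cube_le(1) by simp
  qed simp
  have iW: "integrable (N \<Otimes>\<^sub>M ?D) (\<lambda>p. ((1 + q\<^sup>2) * (1 + \<bar>fst p\<bar>)) * ?w (snd p))"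
  proof (rule Fubini_integrable)
    show "(\<lambda>p. ((1 + q\<^sup>2) * (1 + \<bar>fst p\<bar>)) * ?w (snd p)) \<in> borel_measurable (N \<Otimes>\<^sub>M ?D)"
      by (subst measurable_cong_sets[OF sets_pair_measure_cong[OF N.events_eq_borel sets_density] refl]) measurable
    have "(\<integral>x. norm ((1 + q\<^sup>2) * (1 + \<bar>z\<bar>) * ?w x) \<partial>?D) = (1 + q\<^sup>2) * (1 + \<bar>z\<bar>) * (\<integral>x. ?w x \<partial>?D)" for z :: real
    proof -
      have "norm ((1 + q\<^sup>2) * (1 + \<bar>z\<bar>) * ?w x) = (1 + q\<^sup>2) * (1 + \<bar>z\<bar>) * ?w x" for x
        by (simp add: abs_mult)
      then show ?thesis by simp
    qed
    then show "integrable N (\<lambda>x. \<integral>y. norm ((1 + q\<^sup>2) * (1 + \<bar>fst (x, y)\<bar>) * ?w (snd (x, y))) \<partial>?D)"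
      using iz by simp
    show "AE x in N. integrable ?D (\<lambda>y. (1 + q\<^sup>2) * (1 + \<bar>fst (x, y)\<bar>) * ?w (snd (x, y)))"
      using iD by simp
  qed
  obtain C where C: "\<And>v. \<bar>F v\<bar> \<le> C * weight v" using adm by (auto simp: admissible_def)
  have iF: "integrable (N \<Otimes>\<^sub>M ?D) (\<lambda>p. F (?m p))"
  proof (rule Bochner_Integration.integrable_bound)
    show "integrable (N \<Otimes>\<^sub>M ?D) (\<lambda>p. C * (((1 + q\<^sup>2) * (1 + \<bar>fst p\<bar>)) * ?w (snd p)))"
      using iW by simp
    show "(\<lambda>p. F (?m p)) \<in> borel_measurable (N \<Otimes>\<^sub>M ?D)"
      using measurable_compose[OF m F] .
    show "AE p in N \<Otimes>\<^sub>M ?D. norm (F (?m p)) \<le> norm (C * (((1 + q\<^sup>2) * (1 + \<bar>fst p\<bar>)) * ?w (snd p)))"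
    proof (rule AE_I2)
      fix p
      have "\<bar>F (?m p)\<bar> \<le> C * weight (?m p)" by (rule C)
      also have "\<dots> = C * (((1 + q\<^sup>2) * (1 + \<bar>fst p\<bar>)) * ?w (snd p))"
        by (simp add: weight_def)
      finally show "norm (F (?m p)) \<le> norm (C * (((1 + q\<^sup>2) * (1 + \<bar>fst p\<bar>)) * ?w (snd p)))" by simp
    qed
  qed
  show "integrable (joint_law N q Q) F"
    unfolding joint_law_def by (subst integrable_distr_eq[OF m F]) (rule iF)
  have inner: "(\<integral>x. F (sqrt Q * x, q, z) \<partial>?D) = (\<integral>x. F (sqrt Q * x, q, z) * std_normal_density x \<partial>lborel)" for z
    by (rule dens) measurable
  have "(\<integral>v. F v \<partial>joint_law N q Q) = (\<integral>p. F (?m p) \<partial>(N \<Otimes>\<^sub>M ?D))"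
    unfolding joint_law_def by (rule integral_distr[OF m F])
  also have "\<dots> = (\<integral>z. (\<integral>x. F (?m (z, x)) \<partial>?D) \<partial>N)"
    by (rule integral_fst'[OF iF, symmetric])
  finally show "(\<integral>v. F v \<partial>joint_law N q Q) = (\<integral>z. (\<integral>x. F (sqrt Q * x, q, z) * std_normal_density x \<partial>lborel) \<partial>N)"
    by (simp add: inner)
  have "integrable N (\<lambda>z. (\<integral>x. F (?m (z, x)) \<partial>?D))" by (rule integrable_fst'[OF iF])
  then show "integrable N (\<lambda>z. \<integral>x. F (sqrt Q * x, q, z) * std_normal_density x \<partial>lborel)"
    by (simp add: inner)
qed

text \<open>A single number \<open>M\<close> bounds all parameters; being at least \<open>1\<close>, it also bounds its own smaller
  powers.\<close>

locale moment_bounds =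
  fixes P :: "((real \<times> real) \<times> real \<times> real) set" and \<mu> :: "real \<times> real \<Rightarrow> real measure" and M :: real
  assumes P_nonempty: "P \<noteq> {}"
    and real_distr: "\<And>k q Q. (k, q, Q) \<in> P \<Longrightarrow> real_distribution (\<mu> k)"
    and Q_nonneg: "\<And>k q Q. (k, q, Q) \<in> P \<Longrightarrow> 0 \<le> Q"
    and Q_le: "\<And>k q Q. (k, q, Q) \<in> P \<Longrightarrow> Q \<le> M"
    and q_le: "\<And>k q Q. (k, q, Q) \<in> P \<Longrightarrow> \<bar>q\<bar> \<le> M"
    and integrable_id: "\<And>k q Q. (k, q, Q) \<in> P \<Longrightarrow> integrable (\<mu> k) (\<lambda>z. z)"
    and abs_mean_le: "\<And>k q Q. (k, q, Q) \<in> P \<Longrightarrow> (\<integral>z. \<bar>z\<bar> \<partial>\<mu> k) \<le> M"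
    and M_ge_1: "1 \<le> M"
begin

abbreviation mean :: "(real \<times> real) \<times> real \<times> real \<Rightarrow> (R3 \<Rightarrow> real) \<Rightarrow> real" where
  "mean \<equiv> mean_at \<mu>"

abbreviation E1 :: "(R3 \<Rightarrow> real) \<Rightarrow> real" where
  "E1 \<equiv> E_0 P \<mu>"

lemma mean_eq_integral:
  assumes "(k, q, Q) \<in> P" "admissible F"
  shows "integrable (joint_law (\<mu> k) q Q) F" "mean (k, q, Q) F = (\<integral>v. F v \<partial>joint_law (\<mu> k) q Q)"
  using joint_law_mean[OF real_distr[OF assms(1)] integrable_id[OF assms(1)] assms(2)]
  by (simp_all add: mean_at_def)

lemma mean_add:
  assumes "\<theta> \<in> P" "admissible F" "admissible G"
  shows "mean \<theta> (\<lambda>v. F v + G v) = mean \<theta> F + mean \<theta> G"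
proof -
  obtain k q Q where \<theta>: "\<theta> = (k, q, Q)" by (cases \<theta>)
  have P: "(k, q, Q) \<in> P" using assms(1) \<theta> by simp
  show ?thesis
    using mean_eq_integral[OF P assms(2)] mean_eq_integral[OF P assms(3)]
      mean_eq_integral(2)[OF P admissible_add[OF assms(2,3)]] by (simp add: \<theta>)
qed

lemma mean_cmult:
  assumes "\<theta> \<in> P" "admissible F"
  shows "mean \<theta> (\<lambda>v. c * F v) = c * mean \<theta> F"
proof -
  obtain k q Q where \<theta>: "\<theta> = (k, q, Q)" by (cases \<theta>)
  have P: "(k, q, Q) \<in> P" using assms(1) \<theta> by simp
  show ?thesis
    using mean_eq_integral[OF P assms(2)]
      mean_eq_integral(2)[OF P admissible_cmult[OF assms(2)], of c] by (simp add: \<theta>)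
qed

lemma mean_diff:
  assumes "\<theta> \<in> P" "admissible F" "admissible G"
  shows "mean \<theta> (\<lambda>v. F v - G v) = mean \<theta> F - mean \<theta> G"
  using mean_add[OF assms(1,2) admissible_uminus[OF assms(3)]] mean_cmult[OF assms(1,3), of "-1"]
  by simp

lemma mean_const:
  assumes "\<theta> \<in> P"
  shows "mean \<theta> (\<lambda>_. c) = c"
proof -
  obtain k q Q where \<theta>: "\<theta> = (k, q, Q)" by (cases \<theta>)
  interpret real_distribution "\<mu> k" using real_distr assms \<theta> by blast
  show ?thesis using prob_space by (simp add: mean_at_def \<theta>)
qed

lemma mean_mono:
  assumes "\<theta> \<in> P" "admissible F" "admissible G" "\<And>v. F v \<le> G v"
  shows "mean \<theta> F \<le> mean \<theta> G"
proof -
  obtain k q Q where \<theta>: "\<theta> = (k, q, Q)" by (cases \<theta>)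
  show ?thesis
    using assms mean_eq_integral[of k q Q F] mean_eq_integral[of k q Q G] unfolding \<theta>
    by (auto intro!: integral_mono)
qed

lemma mean_abs_le:
  assumes "\<theta> \<in> P" "admissible F" "admissible G" "\<And>v. \<bar>F v\<bar> \<le> G v"
  shows "\<bar>mean \<theta> F\<bar> \<le> mean \<theta> G"
proof -
  have "F v \<le> G v" "- F v \<le> G v" for v using assms(4)[of v] by auto
  then have "mean \<theta> F \<le> mean \<theta> G" "mean \<theta> (\<lambda>v. - F v) \<le> mean \<theta> G"
    using assms by (auto intro!: mean_mono)
  then show ?thesis using mean_cmult[OF assms(1,2), of "-1"] by simp
qed

lemma mean_factor:
  "mean (k, q, Q) (\<lambda>v. f (fst v) * g (snd (snd v)) * h (fst (snd v)))
    = (\<integral>x. f (sqrt Q * x) * std_normal_density x \<partial>lborel) * (\<integral>z. g z \<partial>\<mu> k) * h q"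
proof -
  have eq: "f (sqrt Q * x) * g z * h q * std_normal_density x
      = (g z * h q) * (f (sqrt Q * x) * std_normal_density x)" for x z by simp
  have "mean (k, q, Q) (\<lambda>v. f (fst v) * g (snd (snd v)) * h (fst (snd v)))
      = (\<integral>z. (\<integral>x. (g z * h q) * (f (sqrt Q * x) * std_normal_density x) \<partial>lborel) \<partial>\<mu> k)"
    unfolding mean_at_def prod.case fst_conv snd_conv eq ..
  also have "\<dots> = (\<integral>z. g z \<partial>\<mu> k) * h q * (\<integral>x. f (sqrt Q * x) * std_normal_density x \<partial>lborel)"
    by (simp only: integral_mult_right_zero integral_mult_left_zero)
  finally show ?thesis by (simp only: ac_simps)
qed

lemma gaussian_moments:
  assumes "0 \<le> Q" "Q \<le> M"
  shows "(\<integral>x. (sqrt Q * x)\<^sup>2 * std_normal_density x \<partial>lborel) = Q"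
    and "(\<integral>x. \<bar>sqrt Q * x\<bar> ^ 3 * std_normal_density x \<partial>lborel) \<le> 2 * M\<^sup>2"
proof -
  have "(\<lambda>x. (sqrt Q * x)\<^sup>2 * std_normal_density x) = (\<lambda>x. Q * (x\<^sup>2 * std_normal_density x))"
    using assms by (simp add: power_mult_distrib mult.assoc)
  then show "(\<integral>x. (sqrt Q * x)\<^sup>2 * std_normal_density x \<partial>lborel) = Q"
    by (simp add: std_normal_square(2))
  have "(\<integral>x. \<bar>sqrt Q * x\<bar> ^ 3 * std_normal_density x \<partial>lborel)
      = sqrt Q ^ 3 * (\<integral>x. \<bar>x\<bar> ^ 3 * std_normal_density x \<partial>lborel)"
    using assms by (simp add: abs_mult power_mult_distrib mult.assoc)
  also have "\<dots> \<le> sqrt Q ^ 3 * 2"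
    using std_normal_abs_cube_le(2) assms by (intro mult_left_mono) auto
  also have "sqrt Q ^ 3 = sqrt Q * Q"
    using assms by (simp add: numeral_3_eq_3)
  also have "sqrt Q * Q \<le> M * M"
  proof (rule mult_mono)
    have "sqrt Q \<le> sqrt (M\<^sup>2)"
      using assms M_ge_1 by (intro real_sqrt_le_mono) (auto simp: power2_eq_square intro: order_trans[of _ "M * 1"])
    then show "sqrt Q \<le> M" using M_ge_1 by simp
  qed (use assms M_ge_1 in auto)
  finally show "(\<integral>x. \<bar>sqrt Q * x\<bar> ^ 3 * std_normal_density x \<partial>lborel) \<le> 2 * M\<^sup>2"
    by (simp add: power2_eq_square)
qed

lemma mean_moments:
  assumes "\<theta> \<in> P"
  shows "mean \<theta> (\<lambda>v. (fst v)\<^sup>2) \<le> M" "mean \<theta> (\<lambda>v. \<bar>fst v\<bar> ^ 3) \<le> 2 * M\<^sup>2"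
    "mean \<theta> (\<lambda>v. \<bar>fst (snd v)\<bar>) \<le> M" "mean \<theta> (\<lambda>v. (fst (snd v))\<^sup>2) \<le> M\<^sup>2"
    "mean \<theta> (\<lambda>v. \<bar>snd (snd v)\<bar>) \<le> M"
    "mean \<theta> (\<lambda>v. (fst v)\<^sup>2 * \<bar>snd (snd v)\<bar>) \<le> M\<^sup>2" "mean \<theta> (\<lambda>v. (fst v)\<^sup>2 * \<bar>fst (snd v)\<bar>) \<le> M\<^sup>2"
    "mean \<theta> (\<lambda>v. \<bar>fst (snd v)\<bar> * \<bar>snd (snd v)\<bar>) \<le> M\<^sup>2"
proof -
  obtain k q Q where \<theta>: "\<theta> = (k, q, Q)" by (cases \<theta>)
  have P: "(k, q, Q) \<in> P" using assms \<theta> by simp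
  interpret real_distribution "\<mu> k" using real_distr P by blast
  note Q = Q_nonneg[OF P] Q_le[OF P] and q = q_le[OF P] and z = abs_mean_le[OF P]
  note g = gaussian_moments[OF Q]
  have [simp]: "prob UNIV = 1" using prob_space by simp
  have n: "(\<integral>x. std_normal_density x \<partial>lborel) = 1" by simp
  have z0: "0 \<le> (\<integral>z. \<bar>z\<bar> \<partial>\<mu> k)" by simp
  show "mean \<theta> (\<lambda>v. (fst v)\<^sup>2) \<le> M"
    using mean_factor[of k q Q "\<lambda>x. x\<^sup>2" "\<lambda>_. 1" "\<lambda>_. 1"] Q by (simp add: \<theta> g(1))
  show "mean \<theta> (\<lambda>v. \<bar>fst v\<bar> ^ 3) \<le> 2 * M\<^sup>2"
    using mean_factor[of k q Q "\<lambda>x. \<bar>x\<bar> ^ 3" "\<lambda>_. 1" "\<lambda>_. 1"] g(2) by (simp add: \<theta>)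
  show "mean \<theta> (\<lambda>v. \<bar>fst (snd v)\<bar>) \<le> M"
    using mean_factor[of k q Q "\<lambda>x. 1" "\<lambda>_. 1" "\<lambda>y. \<bar>y\<bar>"] q by (simp add: \<theta>)
  show "mean \<theta> (\<lambda>v. (fst (snd v))\<^sup>2) \<le> M\<^sup>2"
    using mean_factor[of k q Q "\<lambda>x. 1" "\<lambda>_. 1" "\<lambda>y. y\<^sup>2"] power_mono[OF q, of 2] by (simp add: \<theta>)
  show "mean \<theta> (\<lambda>v. \<bar>snd (snd v)\<bar>) \<le> M"
    using mean_factor[of k q Q "\<lambda>x. 1" "\<lambda>z. \<bar>z\<bar>" "\<lambda>y. 1"] z by (simp add: \<theta>)
  show "mean \<theta> (\<lambda>v. (fst v)\<^sup>2 * \<bar>snd (snd v)\<bar>) \<le> M\<^sup>2"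
    using mean_factor[of k q Q "\<lambda>x. x\<^sup>2" "\<lambda>z. \<bar>z\<bar>" "\<lambda>y. 1"] mult_mono[OF Q(2) z _ z0] M_ge_1
    by (simp add: \<theta> g(1) power2_eq_square[of M])
  show "mean \<theta> (\<lambda>v. (fst v)\<^sup>2 * \<bar>fst (snd v)\<bar>) \<le> M\<^sup>2"
    using mean_factor[of k q Q "\<lambda>x. x\<^sup>2" "\<lambda>z. 1" "\<lambda>y. \<bar>y\<bar>"] mult_mono[OF Q(2) q] M_ge_1
    by (simp add: \<theta> g(1) power2_eq_square[of M])
  show "mean \<theta> (\<lambda>v. \<bar>fst (snd v)\<bar> * \<bar>snd (snd v)\<bar>) \<le> M\<^sup>2"
    using mean_factor[of k q Q "\<lambda>x. 1" "\<lambda>z. \<bar>z\<bar>" "\<lambda>y. \<bar>y\<bar>"] mult_mono[OF z q] M_ge_1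
    by (simp add: \<theta> power2_eq_square[of M] mult.commute)
qed

lemma mean_weight_le:
  assumes "\<theta> \<in> P"
  shows "mean \<theta> weight \<le> (1 + 2 * M\<^sup>2) * (1 + M) * (1 + M\<^sup>2)"
proof -
  obtain k q Q where \<theta>: "\<theta> = (k, q, Q)" by (cases \<theta>)
  have P: "(k, q, Q) \<in> P" using assms \<theta> by simp
  interpret real_distribution "\<mu> k" using real_distr P by blast
  note Q = Q_nonneg[OF P] Q_le[OF P] and q = q_le[OF P] and z = abs_mean_le[OF P]
  have i3: "integrable lborel (\<lambda>x. \<bar>sqrt Q * x\<bar> ^ 3 * std_normal_density x)"
    using std_normal_abs_cube_le(1) by (simp add: abs_mult power_mult_distrib mult.assoc)
  have "(\<integral>x. (1 + \<bar>sqrt Q * x\<bar> ^ 3) * std_normal_density x \<partial>lborel)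
      = 1 + (\<integral>x. \<bar>sqrt Q * x\<bar> ^ 3 * std_normal_density x \<partial>lborel)"
    unfolding distrib_right using i3 by (subst Bochner_Integration.integral_add) auto
  then have x: "(\<integral>x. (1 + \<bar>sqrt Q * x\<bar> ^ 3) * std_normal_density x \<partial>lborel) \<le> 1 + 2 * M\<^sup>2"
    using gaussian_moments(2)[OF Q] by simp
  have z': "(\<integral>z. 1 + \<bar>z\<bar> \<partial>\<mu> k) \<le> 1 + M"
    using integrable_id[OF P] z prob_space by simp
  have "weight = (\<lambda>v. (1 + \<bar>fst v\<bar> ^ 3) * (1 + \<bar>snd (snd v)\<bar>) * (1 + (fst (snd v))\<^sup>2))"
    by (auto simp: weight_def fun_eq_iff)
  then have "mean \<theta> weight = (\<integral>x. (1 + \<bar>sqrt Q * x\<bar> ^ 3) * std_normal_density x \<partial>lborel)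
      * (\<integral>z. 1 + \<bar>z\<bar> \<partial>\<mu> k) * (1 + q\<^sup>2)"
    unfolding \<theta> using mean_factor[of k q Q "\<lambda>x. 1 + \<bar>x\<bar> ^ 3" "\<lambda>z. 1 + \<bar>z\<bar>" "\<lambda>y. 1 + y\<^sup>2"] by simp
  also have "\<dots> \<le> (1 + 2 * M\<^sup>2) * (1 + M) * (1 + M\<^sup>2)"
    using x z' power_mono[OF q, of 2] M_ge_1 by (intro mult_mono) auto
  finally show ?thesis .
qed

lemma admissible_weight: "admissible weight"
  by (rule admissibleI[of _ 1])
     (auto simp: weight_def case_prod_unfold intro!: borel_measurable_continuous_onI continuous_intros)

lemma mean_bounded:
  assumes "admissible F"
  shows "\<exists>B. \<forall>\<theta>\<in>P. \<bar>mean \<theta> F\<bar> \<le> B"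
proof -
  obtain C where C: "\<And>v. \<bar>F v\<bar> \<le> C * weight v" using assms by (auto simp: admissible_def)
  have C': "\<bar>F v\<bar> \<le> \<bar>C\<bar> * weight v" for v
    using C[of v] mult_right_mono[OF abs_ge_self[of C] weight_nonneg[of v]] by linarith
  have "\<bar>mean \<theta> F\<bar> \<le> \<bar>C\<bar> * ((1 + 2 * M\<^sup>2) * (1 + M) * (1 + M\<^sup>2))" if "\<theta> \<in> P" for \<theta>
  proof -
    have "\<bar>mean \<theta> F\<bar> \<le> mean \<theta> (\<lambda>v. \<bar>C\<bar> * weight v)"
      using C' assms that by (intro mean_abs_le admissible_cmult admissible_weight) auto
    also have "\<dots> = \<bar>C\<bar> * mean \<theta> weight" using that admissible_weight by (rule mean_cmult)
    also have "\<dots> \<le> \<bar>C\<bar> * ((1 + 2 * M\<^sup>2) * (1 + M) * (1 + M\<^sup>2))"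
      by (intro mult_left_mono mean_weight_le that) auto
    finally show ?thesis .
  qed
  then show ?thesis by blast
qed

lemma E1_upper:
  assumes "\<theta> \<in> P" "admissible F"
  shows "mean \<theta> F \<le> E1 F"
proof -
  obtain B where "\<forall>\<theta>\<in>P. \<bar>mean \<theta> F\<bar> \<le> B" using mean_bounded assms by blast
  then have "bdd_above ((\<lambda>\<theta>. mean \<theta> F) ` P)" by (intro bdd_aboveI2[of _ _ B]) (auto simp: abs_le_iff)
  then show ?thesis unfolding E_0_eq_SUP_mean_at by (rule cSUP_upper[OF assms(1)])
qed

lemma E1_least: "(\<And>\<theta>. \<theta> \<in> P \<Longrightarrow> mean \<theta> F \<le> c) \<Longrightarrow> E1 F \<le> c"
  unfolding E_0_eq_SUP_mean_at by (rule cSUP_least[OF P_nonempty])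

lemma E1_const: "E1 (\<lambda>_. c) = c"
  unfolding E_0_eq_SUP_mean_at using P_nonempty by (simp add: mean_const)

lemma E1_mono:
  assumes "admissible F" "admissible G" "\<And>v. F v \<le> G v"
  shows "E1 F \<le> E1 G"
proof (rule E1_least)
  fix \<theta> assume "\<theta> \<in> P"
  then have "mean \<theta> F \<le> mean \<theta> G" "mean \<theta> G \<le> E1 G" using assms by (auto intro: mean_mono E1_upper)
  then show "mean \<theta> F \<le> E1 G" by simp
qed

lemma E1_add_le:
  assumes "admissible F" "admissible G"
  shows "E1 (\<lambda>v. F v + G v) \<le> E1 F + E1 G"
proof (rule E1_least)
  fix \<theta> assume "\<theta> \<in> P"
  then show "mean \<theta> (\<lambda>v. F v + G v) \<le> E1 F + E1 G"
    using assms E1_upper[of \<theta> F] E1_upper[of \<theta> G] by (simp add: mean_add)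
qed

lemma E1_le_add_diff: "admissible F \<Longrightarrow> admissible G \<Longrightarrow> E1 F \<le> E1 G + E1 (\<lambda>v. F v - G v)"
  using E1_add_le[of G "\<lambda>v. F v - G v"] by (simp add: admissible_diff)

lemma E1_cmult:
  assumes "admissible F" "0 \<le> c"
  shows "E1 (\<lambda>v. c * F v) = c * E1 F"
proof (cases "c = 0")
  case False
  have le: "E1 (\<lambda>v. d * G v) \<le> d * E1 G" if "admissible G" "0 \<le> d" for d G
    by (rule E1_least) (use that E1_upper in \<open>auto simp: mean_cmult intro!: mult_left_mono\<close>)
  have "c * E1 F = c * E1 (\<lambda>v. (1 / c) * (c * F v))" using False by simp
  also have "\<dots> \<le> c * ((1 / c) * E1 (\<lambda>v. c * F v))"
    using assms by (intro mult_left_mono le) auto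
  also have "\<dots> = E1 (\<lambda>v. c * F v)" using False by simp
  finally show ?thesis using le[OF assms] by simp
qed (simp add: E1_const)

lemma E1_add_const:
  assumes "admissible F"
  shows "E1 (\<lambda>v. F v + c) = E1 F + c"
proof (rule antisym)
  show "E1 (\<lambda>v. F v + c) \<le> E1 F + c"
    using E1_add_le[OF assms admissible_const[of c]] by (simp add: E1_const)
  have "E1 F = E1 (\<lambda>v. (F v + c) + (- c))" by simp
  also have "\<dots> \<le> E1 (\<lambda>v. F v + c) + (- c)"
    using E1_add_le[OF admissible_add[OF assms admissible_const] admissible_const, of c "- c"]
    by (simp add: E1_const)
  finally show "E1 F + c \<le> E1 (\<lambda>v. F v + c)" by simp
qed

text \<open>Two families of numbers that differ by at most \<open>d\<close> have suprema that differ by at most \<open>d\<close>. In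
  contrast to \<open>E1_contraction\<close> only the means are compared, so terms of mean zero may be dropped.\<close>

lemma E1_close:
  assumes "admissible F" "admissible G" "\<And>\<theta>. \<theta> \<in> P \<Longrightarrow> \<bar>mean \<theta> F - mean \<theta> G\<bar> \<le> d"
  shows "\<bar>E1 F - E1 G\<bar> \<le> d"
proof -
  have "E1 F \<le> E1 G + d"
  proof (rule E1_least)
    fix \<theta> assume "\<theta> \<in> P"
    then show "mean \<theta> F \<le> E1 G + d" using assms(3)[of \<theta>] E1_upper[OF _ assms(2), of \<theta>] by linarith
  qed
  moreover have "E1 G \<le> E1 F + d"
  proof (rule E1_least)
    fix \<theta> assume "\<theta> \<in> P"
    then show "mean \<theta> G \<le> E1 F + d" using assms(3)[of \<theta>] E1_upper[OF _ assms(1), of \<theta>] by linarith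
  qed
  ultimately show ?thesis by linarith
qed

lemma E1_contraction:
  assumes "admissible F" "admissible G" "\<And>v. \<bar>F v - G v\<bar> \<le> d"
  shows "\<bar>E1 F - E1 G\<bar> \<le> d"
proof (rule E1_close)
  fix \<theta> assume \<theta>: "\<theta> \<in> P"
  have "\<bar>mean \<theta> (\<lambda>v. F v - G v)\<bar> \<le> mean \<theta> (\<lambda>_. d)"
    using assms \<theta> by (intro mean_abs_le) auto
  then show "\<bar>mean \<theta> F - mean \<theta> G\<bar> \<le> d"
    using assms \<theta> by (simp add: mean_diff mean_const)
qed (use assms in auto)

end


section \<open>The discrete scheme\<close>

text \<open>One increment at step size \<open>h\<close>, with the scaling exponents \<open>1/2\<close>, \<open>1\<close> and \<open>1/\<alpha>\<close> of the central
  limit theorem, the law of large numbers and the \<open>\<alpha>\<close>-stable limit theorem.\<close>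

definition jump_scale :: "real \<Rightarrow> real \<Rightarrow> R3 \<Rightarrow> R3" where
  "jump_scale \<alpha> h v = (sqrt h * fst v, h * fst (snd v), h powr (1/\<alpha>) * snd (snd v))"

definition is_Lip :: "(R3 \<Rightarrow> real) \<Rightarrow> bool" where
  "is_Lip f \<longleftrightarrow> (\<exists>K. Lip1 K f)"

lemma is_LipI: "Lip1 K f \<Longrightarrow> is_Lip f"
  by (auto simp: is_Lip_def)

lemma is_Lip_add: "is_Lip f \<Longrightarrow> is_Lip g \<Longrightarrow> is_Lip (\<lambda>v. f v + g v)"
  unfolding is_Lip_def using Lip1_add by blast

lemma is_Lip_cmult: "is_Lip f \<Longrightarrow> is_Lip (\<lambda>v. c * f v)"
  unfolding is_Lip_def using Lip1_cmult by blast

lemma is_Lip_uminus: "is_Lip f \<Longrightarrow> is_Lip (\<lambda>v. - f v)"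
  unfolding is_Lip_def using Lip1_uminus by blast

lemma is_Lip_diff: "is_Lip f \<Longrightarrow> is_Lip g \<Longrightarrow> is_Lip (\<lambda>v. f v - g v)"
  unfolding is_Lip_def using Lip1_diff by blast

lemma is_Lip_const: "is_Lip (\<lambda>_. c)"
  unfolding is_Lip_def using Lip1_const by blast

lemma is_Lip_shift: "is_Lip f \<Longrightarrow> is_Lip (\<lambda>v. f (v + a))"
  unfolding is_Lip_def using Lip1_shift by blast

lemma is_Lip_ell1_dist: "is_Lip (\<lambda>v. ell1 (v - a))"
  using Lip1_ell1_dist by (rule is_LipI)

lemmas is_Lip_intros = is_Lip_add is_Lip_cmult is_Lip_uminus is_Lip_diff is_Lip_const
  is_Lip_ell1_dist

lemma ell1_jump_scale_le:
  "ell1 (jump_scale \<alpha> h v) = \<bar>sqrt h\<bar> * \<bar>fst v\<bar> + \<bar>h\<bar> * \<bar>fst (snd v)\<bar> + h powr (1/\<alpha>) * \<bar>snd (snd v)\<bar>"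
  by (simp add: jump_scale_def abs_mult)

lemma jump_scale_measurable: "jump_scale \<alpha> h \<in> borel_measurable borel"
  unfolding jump_scale_def[abs_def] by (intro borel_measurable_continuous_onI continuous_intros)

lemma admissible_Lip_scaled:
  assumes "is_Lip f"
  shows "admissible (\<lambda>w. f (v + jump_scale \<alpha> h w))"
proof -
  obtain K where K: "Lip1 K f" using assms by (auto simp: is_Lip_def)
  show ?thesis
  proof (rule admissible_bounded_by)
    show "(\<lambda>w. f (v + jump_scale \<alpha> h w)) \<in> borel_measurable borel"
      using Lip1_measurable[OF K] jump_scale_measurable by measurable
    show "admissible (\<lambda>w. \<bar>f v\<bar> + K * (\<bar>sqrt h\<bar> * \<bar>fst w\<bar> + \<bar>h\<bar> * \<bar>fst (snd w)\<bar> + h powr (1/\<alpha>) * \<bar>snd (snd w)\<bar>))"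
      by (intro admissible_add admissible_const admissible_cmult admissible_monomials)
    fix w
    show "\<bar>f (v + jump_scale \<alpha> h w)\<bar> \<le> \<bar>f v\<bar> + K * (\<bar>sqrt h\<bar> * \<bar>fst w\<bar> + \<bar>h\<bar> * \<bar>fst (snd w)\<bar> + h powr (1/\<alpha>) * \<bar>snd (snd w)\<bar>)"
      using Lip1D[OF K, of "v + jump_scale \<alpha> h w" v]
      unfolding add_diff_cancel_left' ell1_jump_scale_le by linarith
  qed
qed

lemma jump_scale_sum_third: "snd (snd (\<Sum>i<n::nat. jump_scale \<alpha> h (w i))) = h powr (1/\<alpha>) * (\<Sum>i<n. snd (snd (w i)))"
  by (induction n) (auto simp: jump_scale_def algebra_simps)

locale scheme = moment_bounds +
  fixes \<alpha> Mst :: real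
  assumes alpha: "1 < \<alpha>" "\<alpha> < 2"
    and Mst_nonneg: "0 \<le> Mst"
    and scaled_abs_mean_le: "\<And>n. 1 \<le> n \<Longrightarrow> scaled_abs_mean \<alpha> P \<mu> n \<le> Mst"
begin

definition T :: "real \<Rightarrow> (R3 \<Rightarrow> real) \<Rightarrow> R3 \<Rightarrow> real" where
  "T h f v = E1 (\<lambda>w. f (v + jump_scale \<alpha> h w))"

text \<open>The product expectation integrates coordinate \<open>0\<close> outermost, so splitting off this coordinate
  amounts to one application of \<open>T\<close> to the iterate of the remaining ones.\<close>

lemma E_hat_eq_T_power:
  "E_hat P \<mu> (\<lambda>w. f (v + (\<Sum>i<n. jump_scale \<alpha> h (w i)))) = (T h ^^ n) f v"
proof -
  have "iterated_expectation E1 n (\<lambda>w. f (v + (\<Sum>i<n. jump_scale \<alpha> h (w i)))) = (T h ^^ n) f v" for v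
  proof (induction n arbitrary: v)
    case (Suc n)
    have "iterated_expectation E1 (Suc n) (\<lambda>w. f (v + (\<Sum>i<Suc n. jump_scale \<alpha> h (w i))))
        = E1 (\<lambda>a. iterated_expectation E1 n (\<lambda>w. f ((v + jump_scale \<alpha> h a) + (\<Sum>i<n. jump_scale \<alpha> h (w i)))))"
      by (simp add: sum.lessThan_Suc_shift add.assoc del: sum.lessThan_Suc)
    also have "\<dots> = (T h ^^ Suc n) f v"
      unfolding Suc.IH by (simp add: T_def[of h "(T h ^^ n) f"])
    finally show ?case .
  qed simp
  moreover have "E_hat P \<mu> (\<lambda>w. f (v + (\<Sum>i<n. jump_scale \<alpha> h (w i))))
      = iterated_expectation E1 n (\<lambda>w. f (v + (\<Sum>i<n. jump_scale \<alpha> h (w i))))"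
    unfolding E_hat_def
  proof (rule product_expectation_eq[OF E1_const], intro allI impI)
    fix w w' :: "nat \<Rightarrow> R3"
    assume "\<forall>i<n. w i = w' i"
    then have "(\<Sum>i<n. jump_scale \<alpha> h (w i)) = (\<Sum>i<n. jump_scale \<alpha> h (w' i))" by simp
    then show "f (v + (\<Sum>i<n. jump_scale \<alpha> h (w i))) = f (v + (\<Sum>i<n. jump_scale \<alpha> h (w' i)))" by simp
  qed
  ultimately show ?thesis by simp
qed

lemma T_mono: "is_Lip f \<Longrightarrow> is_Lip g \<Longrightarrow> (\<And>v. f v \<le> g v) \<Longrightarrow> T h f v \<le> T h g v"
  unfolding T_def by (intro E1_mono admissible_Lip_scaled) auto

lemma T_add_le: "is_Lip f \<Longrightarrow> is_Lip g \<Longrightarrow> T h (\<lambda>v. f v + g v) v \<le> T h f v + T h g v"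
  unfolding T_def by (intro E1_add_le admissible_Lip_scaled) auto

lemma T_cmult: "is_Lip f \<Longrightarrow> 0 \<le> c \<Longrightarrow> T h (\<lambda>v. c * f v) v = c * T h f v"
  unfolding T_def by (intro E1_cmult admissible_Lip_scaled) auto

lemma T_const: "T h (\<lambda>_. c) v = c"
  unfolding T_def by (rule E1_const)

lemma T_contraction:
  "is_Lip f \<Longrightarrow> is_Lip g \<Longrightarrow> (\<And>v. \<bar>f v - g v\<bar> \<le> d) \<Longrightarrow> \<bar>T h f v - T h g v\<bar> \<le> d"
  unfolding T_def by (intro E1_contraction admissible_Lip_scaled) auto

lemma T_shift: "T h (\<lambda>v. f (v + a)) v = T h f (v + a)"
  unfolding T_def by (simp add: ac_simps)

lemma T_Lip1:
  assumes "Lip1 K f"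
  shows "Lip1 K (T h f)"
  unfolding Lip1_def
proof (intro conjI allI)
  show "0 \<le> K" using assms by (rule Lip1_nonneg)
  fix v w
  have f: "is_Lip f" using assms by (rule is_LipI)
  show "\<bar>T h f v - T h f w\<bar> \<le> K * ell1 (v - w)"
    unfolding T_def
  proof (intro E1_contraction admissible_Lip_scaled f)
    fix a show "\<bar>f (v + jump_scale \<alpha> h a) - f (w + jump_scale \<alpha> h a)\<bar> \<le> K * ell1 (v - w)"
      using Lip1D[OF assms, of "v + jump_scale \<alpha> h a" "w + jump_scale \<alpha> h a"] by simp
  qed
qed

lemma Tn_Lip1: "Lip1 K f \<Longrightarrow> Lip1 K ((T h ^^ n) f)"
  by (induction n) (auto intro: T_Lip1)

lemma Tn_is_Lip: "is_Lip f \<Longrightarrow> is_Lip ((T h ^^ n) f)"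
  unfolding is_Lip_def using Tn_Lip1 by blast

lemma Tn_mono:
  "is_Lip f \<Longrightarrow> is_Lip g \<Longrightarrow> (\<And>v. f v \<le> g v) \<Longrightarrow> (T h ^^ n) f v \<le> (T h ^^ n) g v"
  by (induction n arbitrary: v) (auto intro: T_mono Tn_is_Lip)

lemma Tn_add_le:
  assumes "is_Lip f" "is_Lip g"
  shows "(T h ^^ n) (\<lambda>v. f v + g v) v \<le> (T h ^^ n) f v + (T h ^^ n) g v"
proof (induction n arbitrary: v)
  case (Suc n)
  have "(T h ^^ Suc n) (\<lambda>v. f v + g v) v \<le> T h (\<lambda>v. (T h ^^ n) f v + (T h ^^ n) g v) v"
    using Suc assms by (auto intro!: T_mono Tn_is_Lip is_Lip_intros)
  also have "\<dots> \<le> (T h ^^ Suc n) f v + (T h ^^ Suc n) g v"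
    using assms by (auto intro!: T_add_le Tn_is_Lip)
  finally show ?case .
qed simp

lemma Tn_cmult:
  assumes "is_Lip f" "0 \<le> c"
  shows "(T h ^^ n) (\<lambda>v. c * f v) v = c * (T h ^^ n) f v"
proof (induction n arbitrary: v)
  case (Suc n)
  have "(T h ^^ n) (\<lambda>v. c * f v) = (\<lambda>v. c * (T h ^^ n) f v)" using Suc by blast
  then show ?case using assms by (simp add: T_cmult Tn_is_Lip)
qed simp

lemma Tn_const: "(T h ^^ n) (\<lambda>_. c) = (\<lambda>_. c)"
proof (induction n)
  case (Suc n)
  show ?case by (rule ext) (simp add: Suc T_const)
qed simp

lemma Tn_contraction:
  "is_Lip f \<Longrightarrow> is_Lip g \<Longrightarrow> (\<And>v. \<bar>f v - g v\<bar> \<le> d) \<Longrightarrow> \<bar>(T h ^^ n) f v - (T h ^^ n) g v\<bar> \<le> d"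
  by (induction n arbitrary: v) (auto intro!: T_contraction Tn_is_Lip)

lemma Tn_le_add_const:
  assumes "is_Lip f" "is_Lip g" "\<And>v. f v \<le> g v + c"
  shows "(T h ^^ n) f v \<le> (T h ^^ n) g v + c"
proof -
  have "(T h ^^ n) f v \<le> (T h ^^ n) (\<lambda>v. g v + c) v"
    using assms by (intro Tn_mono is_Lip_intros) auto
  also have "\<dots> \<le> (T h ^^ n) g v + c"
    using Tn_add_le[OF assms(2) is_Lip_const[of c]] by (simp add: Tn_const)
  finally show ?thesis .
qed

lemma Tn_uminus_ge:
  assumes "is_Lip f"
  shows "- (T h ^^ n) (\<lambda>v. - f v) v \<le> (T h ^^ n) f v"
  using Tn_add_le[OF assms is_Lip_uminus[OF assms], of n h v] by (simp add: Tn_const)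

lemma Tn_growth:
  assumes "is_Lip f" "\<And>v. T h f v \<le> f v + c"
  shows "(T h ^^ n) f v \<le> f v + real n * c"
proof (induction n arbitrary: v)
  case (Suc n)
  have "(T h ^^ Suc n) f v \<le> T h (\<lambda>v. f v + real n * c) v"
    using Suc assms by (auto intro!: T_mono Tn_is_Lip is_Lip_intros)
  also have "\<dots> \<le> T h f v + real n * c"
    using T_add_le[OF assms(1) is_Lip_const[of "real n * c"]] by (simp add: T_const)
  also have "\<dots> \<le> f v + real (Suc n) * c"
    using assms(2)[of v] by (simp add: algebra_simps)
  finally show ?case .
qed simp

end

section \<open>Displacement of the scheme\<close>

text \<open>A second-order expansion of \<open>\<lambda>x. sqrt (r\<^sup>2 + x\<^sup>2)\<close>, whose second derivative is at most \<open>1/r\<close>.\<close>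

lemma sqrt_square_increment_le:
  fixes r x a :: real
  assumes "0 < r"
  shows "sqrt (r\<^sup>2 + (x + a)\<^sup>2) \<le> sqrt (r\<^sup>2 + x\<^sup>2) + a * (x / sqrt (r\<^sup>2 + x\<^sup>2)) + a\<^sup>2 / (2 * r)"
proof -
  define b where "b = sqrt (r\<^sup>2 + x\<^sup>2)"
  have b2: "b\<^sup>2 = r\<^sup>2 + x\<^sup>2" by (simp add: b_def)
  have "sqrt (r\<^sup>2) \<le> b" unfolding b_def by (rule real_sqrt_le_mono) simp
  then have rb: "r \<le> b" using assms by simp
  then have b0: "0 < b" using assms by simp
  define u where "u = 2 * a * x + a\<^sup>2"
  have sq: "r\<^sup>2 + (x + a)\<^sup>2 = b\<^sup>2 + u" by (simp add: b2 u_def power2_sum)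
  have nonneg: "0 \<le> b\<^sup>2 + u" by (simp flip: sq)
  have "0 \<le> (2 * b\<^sup>2 + u) / (2 * b)" 
    using nonneg b0 zero_le_power2[of b] by (intro divide_nonneg_pos) linarith+
  then have pos: "0 \<le> b + u / (2 * b)" using b0 by (simp add: power2_eq_square field_simps)
  have "(b + u / (2 * b))\<^sup>2 = b\<^sup>2 + u + (u / (2 * b))\<^sup>2"
    using b0 by (simp add: power2_sum)
  then have "sqrt (b\<^sup>2 + u) \<le> b + u / (2 * b)"
    using pos by (intro real_le_lsqrt) auto
  also have "\<dots> = b + a * (x / b) + a\<^sup>2 / (2 * b)"
    using b0 by (simp add: u_def field_simps)
  also have "\<dots> \<le> b + a * (x / b) + a\<^sup>2 / (2 * r)"
    using rb assms by (simp add: frac_le)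
  finally show ?thesis by (simp add: sq b_def)
qed

lemma powr_inverse_le_sqrt:
  assumes "0 \<le> t" "t \<le> 1" "0 < \<alpha>" "\<alpha> < 2"
  shows "t powr (1/\<alpha>) \<le> sqrt t"
proof (cases "t = 0")
  case False
  then have "t powr (1/\<alpha>) \<le> t powr (1/2)"
    using assms by (intro powr_mono') (auto simp: field_simps)
  then show ?thesis using assms by (simp add: powr_half_sqrt)
qed simp

lemma le_sqrt_of_le_1: "0 \<le> t \<Longrightarrow> t \<le> 1 \<Longrightarrow> t \<le> sqrt (t::real)"
  by (rule real_le_rsqrt) (simp add: power2_eq_square mult_left_le)

lemma Lip1_of_coordinate_x:
  assumes "\<And>a b. \<bar>f a - f b\<bar> \<le> K * \<bar>a - b\<bar>" "0 \<le> K"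
  shows "Lip1 K (\<lambda>v. f (fst v))"
  unfolding Lip1_def
proof (intro conjI allI)
  fix v w :: R3
  have "\<bar>f (fst v) - f (fst w)\<bar> \<le> K * \<bar>fst v - fst w\<bar>" by (rule assms)
  also have "\<dots> \<le> K * ell1 (v - w)" using assms(2) by (intro mult_left_mono) (auto simp: ell1_def)
  finally show "\<bar>f (fst v) - f (fst w)\<bar> \<le> K * ell1 (v - w)" .
qed fact

lemma is_Lip_smoothed_abs: "is_Lip (\<lambda>w. sqrt (r\<^sup>2 + (fst w - c)\<^sup>2))"
proof (rule is_LipI[OF Lip1_of_coordinate_x[of "\<lambda>x. sqrt (r\<^sup>2 + (x - c)\<^sup>2)" 1]])
  have *: "sqrt (r\<^sup>2 + (x - c)\<^sup>2) - sqrt (r\<^sup>2 + (y - c)\<^sup>2) \<le> \<bar>x - y\<bar>" for x y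
    using real_sqrt_sum_squares_triangle_ineq[of r 0 "y - c" "x - y"] by simp
  show "\<bar>sqrt (r\<^sup>2 + (x - c)\<^sup>2) - sqrt (r\<^sup>2 + (y - c)\<^sup>2)\<bar> \<le> 1 * \<bar>x - y\<bar>" for x y
    using *[of x y] *[of y x] by (simp only: abs_le_iff abs_minus_commute mult_1) auto
qed simp

lemma Lip1_abs_coordinates:
  "Lip1 1 (\<lambda>v. \<bar>fst (snd (v - a))\<bar>)" "Lip1 1 (\<lambda>v. \<bar>snd (snd (v - a))\<bar>)" "Lip1 1 (\<lambda>v. \<bar>snd (snd v)\<bar>)"
  by (auto simp: Lip1_def)

context moment_bounds
begin

text \<open>Conditionally on the other coordinates the first one is a centred Gaussian.\<close>

lemma mean_odd:
  assumes "\<theta> \<in> P"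
  shows "mean \<theta> (\<lambda>w. fst w * k (snd w)) = 0"
proof -
  obtain l q Q where \<theta>: "\<theta> = (l, q, Q)" by (cases \<theta>)
  have eq: "sqrt Q * x * k (q, z) * std_normal_density x = (sqrt Q * k (q, z)) * (x * std_normal_density x)" for x z
    by simp
  show ?thesis
    unfolding \<theta> mean_at_def prod.case fst_conv snd_conv eq integral_mult_right_zero std_normal_first(2)
    by simp
qed

end

context scheme
begin

text \<open>The smoothed modulus has a linear term, whose mean vanishes, and a quadratic one of mean \<open>O(h)\<close>.
  Hence \<open>n\<close> steps cost \<open>O(n h / r)\<close>; with \<open>\<bar>x\<bar>\<close> in its place each step would cost \<open>O(sqrt h)\<close>.\<close>

lemma smoothed_abs_growth:
  assumes "0 < r" "0 \<le> h"
  shows "(T h ^^ n) (\<lambda>w. sqrt (r\<^sup>2 + (fst w - c)\<^sup>2)) v \<le> sqrt (r\<^sup>2 + (fst v - c)\<^sup>2) + real n * (h * M / (2 * r))"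
proof (rule Tn_growth)
  let ?b = "\<lambda>x. sqrt (r\<^sup>2 + (x - c)\<^sup>2)"
  show L: "is_Lip (\<lambda>w. ?b (fst w))" by (rule is_Lip_smoothed_abs)
  fix v :: R3
  show "T h (\<lambda>w. ?b (fst w)) v \<le> ?b (fst v) + h * M / (2 * r)"
    unfolding T_def
  proof (rule E1_least)
    fix \<theta> assume \<theta>: "\<theta> \<in> P"
    let ?x = "fst v - c"
    let ?A = "\<lambda>w::R3. ?b (fst v)" and ?B = "\<lambda>w::R3. (sqrt h * (?x / ?b (fst v))) * fst w"
      and ?C = "\<lambda>w::R3. (h / (2 * r)) * (fst w)\<^sup>2"
    have adm: "admissible ?A" "admissible ?B" "admissible ?C"
      by (intro admissible_const admissible_cmult admissible_monomials)+
    have "mean \<theta> (\<lambda>w. ?b (fst (v + jump_scale \<alpha> h w))) \<le> mean \<theta> (\<lambda>w. (?A w + ?B w) + ?C w)"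
    proof (rule mean_mono[OF \<theta> admissible_Lip_scaled[OF L]])
      show "admissible (\<lambda>w. (?A w + ?B w) + ?C w)" using adm by (intro admissible_add)
      fix w :: R3
      show "?b (fst (v + jump_scale \<alpha> h w)) \<le> ?A w + ?B w + ?C w"
        using sqrt_square_increment_le[OF assms(1), of ?x "sqrt h * fst w"] assms
        by (simp add: jump_scale_def power_mult_distrib algebra_simps)
    qed
    also have "\<dots> = mean \<theta> ?A + mean \<theta> ?B + mean \<theta> ?C"
      using adm \<theta> by (simp only: mean_add admissible_add)
    also have "mean \<theta> ?A = ?b (fst v)" using \<theta> by (rule mean_const)
    also have "mean \<theta> ?B = 0"
      using mean_odd[OF \<theta>, of "\<lambda>_. sqrt h * (?x / ?b (fst v))"] by (simp add: mult.commute)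
    also have "mean \<theta> ?C \<le> (h / (2 * r)) * M"
      using mean_moments(1)[OF \<theta>] assms by (subst mean_cmult[OF \<theta> admissible_monomials(3)]) (intro mult_left_mono, auto)
    finally show "mean \<theta> (\<lambda>w. ?b (fst (v + jump_scale \<alpha> h w))) \<le> ?b (fst v) + h * M / (2 * r)" by simp
  qed
qed

lemma abs_y_growth:
  assumes "0 \<le> h"
  shows "(T h ^^ n) (\<lambda>w. \<bar>fst (snd (w - a))\<bar>) v \<le> \<bar>fst (snd (v - a))\<bar> + real n * (h * M)"
proof (rule Tn_growth)
  show L: "is_Lip (\<lambda>w. \<bar>fst (snd (w - a))\<bar>)" by (rule is_LipI[OF Lip1_abs_coordinates(1)])
  fix v :: R3
  show "T h (\<lambda>w. \<bar>fst (snd (w - a))\<bar>) v \<le> \<bar>fst (snd (v - a))\<bar> + h * M"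
    unfolding T_def
  proof (rule E1_least)
    fix \<theta> assume \<theta>: "\<theta> \<in> P"
    have adm: "admissible (\<lambda>w. h * \<bar>fst (snd w)\<bar>)"
      by (intro admissible_cmult admissible_monomials)
    have "mean \<theta> (\<lambda>w. \<bar>fst (snd (v + jump_scale \<alpha> h w - a))\<bar>)
        \<le> mean \<theta> (\<lambda>w. \<bar>fst (snd (v - a))\<bar> + h * \<bar>fst (snd w)\<bar>)"
    proof (rule mean_mono[OF \<theta> admissible_Lip_scaled[OF L]])
      show "admissible (\<lambda>w. \<bar>fst (snd (v - a))\<bar> + h * \<bar>fst (snd w)\<bar>)"
        using adm by (intro admissible_add admissible_const)
      fix w :: R3
      have "\<bar>fst (snd v) + h * fst (snd w) - fst (snd a)\<bar> \<le> \<bar>fst (snd v) - fst (snd a)\<bar> + \<bar>h * fst (snd w)\<bar>"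
        by linarith
      then show "\<bar>fst (snd (v + jump_scale \<alpha> h w - a))\<bar> \<le> \<bar>fst (snd (v - a))\<bar> + h * \<bar>fst (snd w)\<bar>"
        using assms by (simp add: jump_scale_def abs_mult)
    qed
    also have "\<dots> = \<bar>fst (snd (v - a))\<bar> + h * mean \<theta> (\<lambda>w. \<bar>fst (snd w)\<bar>)"
      using mean_add[OF \<theta> admissible_const adm] mean_const[OF \<theta>] mean_cmult[OF \<theta> admissible_monomials(6)] by simp
    also have "\<dots> \<le> \<bar>fst (snd (v - a))\<bar> + h * M"
      using mean_moments(3)[OF \<theta>] assms by (simp add: mult_left_mono)
    finally show "mean \<theta> (\<lambda>w. \<bar>fst (snd (v + jump_scale \<alpha> h w - a))\<bar>) \<le> \<bar>fst (snd (v - a))\<bar> + h * M" .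
  qed
qed

text \<open>Second moments of the third coordinate may be infinite, so its displacement is controlled by the
  scaled absolute means. By positive homogeneity a step size \<open>h\<close> in place of \<open>1/n\<close> only contributes
  the factor \<open>(n h)\<close> to the power \<open>1/\<alpha>\<close>.\<close>

lemma abs_z_growth:
  assumes "0 \<le> h" "1 \<le> n"
  shows "(T h ^^ n) (\<lambda>w. \<bar>snd (snd (w - v))\<bar>) v \<le> (real n * h) powr (1/\<alpha>) * Mst"
proof -
  have "(T h ^^ n) (\<lambda>w. \<bar>snd (snd (w - v))\<bar>) v
      = E_hat P \<mu> (\<lambda>w. \<bar>snd (snd ((v + (\<Sum>i<n. jump_scale \<alpha> h (w i))) - v))\<bar>)"
    by (rule E_hat_eq_T_power[symmetric])
  also have "(\<lambda>w :: nat \<Rightarrow> R3. \<bar>snd (snd ((v + (\<Sum>i<n. jump_scale \<alpha> h (w i))) - v))\<bar>)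
      = (\<lambda>w. (real n * h) powr (1/\<alpha>) * \<bar>snd (snd (0 + (\<Sum>i<n. jump_scale \<alpha> (1 / real n) (w i))))\<bar>)"
    using assms by (simp add: jump_scale_sum_third abs_mult powr_mult powr_divide del: powr_one_gt_zero_iff)
  also have "E_hat P \<mu> \<dots> = (T (1 / real n) ^^ n) (\<lambda>v. (real n * h) powr (1/\<alpha>) * \<bar>snd (snd v)\<bar>) 0"
    by (rule E_hat_eq_T_power)
  also have "\<dots> = (real n * h) powr (1/\<alpha>) * (T (1 / real n) ^^ n) (\<lambda>v. \<bar>snd (snd v)\<bar>) 0"
    by (rule Tn_cmult[OF is_LipI[OF Lip1_abs_coordinates(3)]]) simp
  also have "(T (1 / real n) ^^ n) (\<lambda>v. \<bar>snd (snd v)\<bar>) 0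
      = E_hat P \<mu> (\<lambda>w. \<bar>snd (snd (0 + (\<Sum>i<n. jump_scale \<alpha> (1 / real n) (w i))))\<bar>)"
    by (rule E_hat_eq_T_power[symmetric])
  also have "\<dots> = scaled_abs_mean \<alpha> P \<mu> n"
    using assms by (simp add: scaled_abs_mean_def S3_def Z_seq_def jump_scale_sum_third abs_mult powr_divide powr_minus_divide)
  also have "(real n * h) powr (1/\<alpha>) * scaled_abs_mean \<alpha> P \<mu> n \<le> (real n * h) powr (1/\<alpha>) * Mst"
    using scaled_abs_mean_le[OF assms(2)] by (intro mult_left_mono) auto
  finally show ?thesis .
qed

text \<open>The constant in the bound \<open>Omega * sqrt t\<close> for the mean displacement within time \<open>t \<le> 1\<close>.\<close>

definition Omega :: real where "Omega = 1 + 2 * M + Mst"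

lemma Omega_ge_1: "1 \<le> Omega"
  using M_ge_1 Mst_nonneg by (simp add: Omega_def)

lemma displacement_le:
  assumes "0 < h" "real n * h \<le> 1"
  shows "(T h ^^ n) (\<lambda>w. ell1 (w - v)) v \<le> Omega * sqrt (real n * h)"
proof (cases "n = 0")
  case False
  define t where "t = real n * h"
  have t: "0 < t" "t \<le> 1" using assms False by (auto simp: t_def)
  \<comment> \<open>this smoothing radius balances the two contributions r and t M / (2 r)\<close>
  let ?r = "sqrt t"
  let ?x = "\<lambda>w::R3. sqrt (?r\<^sup>2 + (fst w - fst v)\<^sup>2)"
    and ?y = "\<lambda>w. \<bar>fst (snd (w - v))\<bar>" and ?z = "\<lambda>w. \<bar>snd (snd (w - v))\<bar>"
  have Lx: "is_Lip ?x" by (rule is_Lip_smoothed_abs)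
  have Ly: "is_Lip ?y" and Lz: "is_Lip ?z"
    by (rule is_LipI[OF Lip1_abs_coordinates(1)] is_LipI[OF Lip1_abs_coordinates(2)])+
  have "(T h ^^ n) (\<lambda>w. ell1 (w - v)) v \<le> (T h ^^ n) (\<lambda>w. (?x w + ?y w) + ?z w) v"
  proof (rule Tn_mono)
    fix w :: R3
    have "\<bar>fst w - fst v\<bar> \<le> ?x w" by (rule real_le_rsqrt) simp
    then show "ell1 (w - v) \<le> ?x w + ?y w + ?z w" by (simp add: ell1_def)
  qed (intro is_Lip_intros Lx Ly Lz)+
  also have "\<dots> \<le> (T h ^^ n) (\<lambda>w. ?x w + ?y w) v + (T h ^^ n) ?z v"
    by (intro Tn_add_le is_Lip_intros Lx Ly Lz)
  also have "(T h ^^ n) (\<lambda>w. ?x w + ?y w) v \<le> (T h ^^ n) ?x v + (T h ^^ n) ?y v"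
    by (intro Tn_add_le Lx Ly)
  also have "(T h ^^ n) ?x v \<le> sqrt (?r\<^sup>2 + (fst v - fst v)\<^sup>2) + real n * (h * M / (2 * ?r))"
    using t assms by (intro smoothed_abs_growth) auto
  also have "\<dots> = ?r + (t / ?r) * M / 2" using t by (simp add: t_def)
  also have "t / ?r = ?r" using t by (simp add: real_div_sqrt)
  also have "(T h ^^ n) ?y v \<le> t * M"
    using abs_y_growth[of h n v v] assms by (simp add: t_def)
  also have "t * M \<le> ?r * M"
    using le_sqrt_of_le_1[of t] t M_ge_1 by (intro mult_right_mono) auto
  also have "(T h ^^ n) ?z v \<le> t powr (1/\<alpha>) * Mst"
    using abs_z_growth[of h n v] assms False by (simp add: t_def)
  also have "\<dots> \<le> ?r * Mst"
    using powr_inverse_le_sqrt[of t \<alpha>] t alpha Mst_nonneg by (intro mult_right_mono) auto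
  finally have "(T h ^^ n) (\<lambda>w. ell1 (w - v)) v \<le> ?r + ?r * M / 2 + ?r * M + ?r * Mst"
    by simp
  also have "\<dots> \<le> Omega * ?r"
  proof -
    have "0 \<le> ?r * M" using t M_ge_1 by simp
    then show ?thesis by (simp add: Omega_def algebra_simps)
  qed
  finally show ?thesis by (simp add: t_def)
qed simp

lemma Tn_displacement:
  assumes "Lip1 K f" "0 < h" "real n * h \<le> 1"
  shows "(T h ^^ n) f v \<le> f v + K * (Omega * sqrt (real n * h))"
proof -
  have K: "0 \<le> K" using assms(1) by (rule Lip1_nonneg)
  have "(T h ^^ n) f v \<le> (T h ^^ n) (\<lambda>w. K * ell1 (w - v) + f v) v"
  proof (rule Tn_mono)
    fix w show "f w \<le> K * ell1 (w - v) + f v" using Lip1D[OF assms(1), of w v] by linarith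
  qed (intro is_Lip_intros is_LipI[OF assms(1)])+
  also have "\<dots> \<le> (T h ^^ n) (\<lambda>w. K * ell1 (w - v)) v + (T h ^^ n) (\<lambda>w. f v) v"
    by (intro Tn_add_le is_Lip_intros)
  also have "\<dots> = K * (T h ^^ n) (\<lambda>w. ell1 (w - v)) v + f v"
    using K by (simp add: Tn_cmult is_Lip_intros Tn_const)
  also have "\<dots> \<le> K * (Omega * sqrt (real n * h)) + f v"
    using displacement_le[OF assms(2,3)] K by (intro add_right_mono mult_left_mono)
  finally show ?thesis by simp
qed

lemma Tn_displacement_abs:
  assumes "Lip1 K f" "0 < h" "real n * h \<le> 1"
  shows "\<bar>(T h ^^ n) f v - f v\<bar> \<le> K * (Omega * sqrt (real n * h))"
  using Tn_displacement[OF assms, of v] Tn_displacement[OF Lip1_uminus[OF assms(1)] assms(2,3), of v]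
    Tn_uminus_ge[OF is_LipI[OF assms(1)], of n h v] by (simp add: abs_le_iff)

end

section \<open>Consistency of one step\<close>

lemma real_increment_le:
  fixes F F' :: "real \<Rightarrow> real"
  assumes "\<And>s. (F has_real_derivative F' s) (at s)" "\<And>s. \<bar>s\<bar> \<le> \<bar>a\<bar> \<Longrightarrow> \<bar>F' s\<bar> \<le> B"
  shows "\<bar>F a - F 0\<bar> \<le> B * \<bar>a\<bar>"
  using field_differentiable_bound[of "cball 0 \<bar>a\<bar>" F F' B a 0] assms
  by (auto simp: dist_norm has_field_derivative_at_within)

text \<open>\<open>f1\<close> and \<open>f2\<close> are the first two derivatives of \<open>f\<close>; their bounds are the ones that enter the
  consistency estimate.\<close>

definition C3_line :: "(real \<Rightarrow> real) \<Rightarrow> (real \<Rightarrow> real) \<Rightarrow> (real \<Rightarrow> real) \<Rightarrow> real \<Rightarrow> real \<Rightarrow> bool" where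
  "C3_line f f1 f2 B1 B2 \<longleftrightarrow>
     (\<forall>z. (f has_real_derivative f1 z) (at z)) \<and> (\<forall>z. (f1 has_real_derivative f2 z) (at z)) \<and>
     (\<exists>f3. (\<forall>z. (f2 has_real_derivative f3 z) (at z)) \<and> continuous_on UNIV f3 \<and> bounded (range f3)) \<and>
     bounded (range f) \<and> (\<forall>z. \<bar>f1 z\<bar> \<le> B1) \<and> (\<forall>z. \<bar>f2 z\<bar> \<le> B2)"

lemma bounded_range_realI: "(\<And>z. \<bar>f z\<bar> \<le> B) \<Longrightarrow> bounded (range f)" for f :: "'a \<Rightarrow> real"
  by (rule boundedI[of _ B]) auto

lemma bounded_range_diff:
  fixes f g :: "'a \<Rightarrow> real"
  assumes "bounded (range f)" "bounded (range g)"
  shows "bounded (range (\<lambda>z. f z - g z))"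
proof -
  obtain A B where AB: "\<And>z. \<bar>f z\<bar> \<le> A" "\<And>z. \<bar>g z\<bar> \<le> B"
    using assms by (auto simp: bounded_iff)
  show ?thesis
  proof (rule bounded_range_realI)
    show "\<bar>f z - g z\<bar> \<le> A + B" for z using AB(1)[of z] AB(2)[of z] by linarith
  qed
qed

lemma C3_line_derivs:
  assumes "C3_line f f1 f2 B1 B2"
  shows "f \<in> C_b_3" "deriv f = f1" "(deriv ^^ 2) f = f2" "sup_norm f1 \<le> B1" "sup_norm f2 \<le> B2"
proof -
  obtain f3 where d: "\<And>z. (f has_real_derivative f1 z) (at z)" "\<And>z. (f1 has_real_derivative f2 z) (at z)"
      "\<And>z. (f2 has_real_derivative f3 z) (at z)"
    and f3: "continuous_on UNIV f3" "bounded (range f3)"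
    and b: "bounded (range f)" "\<And>z. \<bar>f1 z\<bar> \<le> B1" "\<And>z. \<bar>f2 z\<bar> \<le> B2"
    using assms unfolding C3_line_def by blast
  have d1: "deriv f = f1" and d2: "deriv f1 = f2" using d by (auto intro: DERIV_imp_deriv)
  show 1: "deriv f = f1" by (rule d1)
  show 2: "(deriv ^^ 2) f = f2" using d1 d2 by (simp add: numeral_2_eq_2)
  then have 3: "(deriv ^^ 3) f = f3"
    using d(3) by (auto simp: numeral_3_eq_3 numeral_2_eq_2 intro: DERIV_imp_deriv)
  show "sup_norm f1 \<le> B1" "sup_norm f2 \<le> B2"
    unfolding sup_norm_def using b by (auto intro: cSUP_least)
  have i: "i < 3 \<longleftrightarrow> i = 0 \<or> i = 1 \<or> i = 2" "i \<le> 3 \<longleftrightarrow> i = 0 \<or> i = 1 \<or> i = 2 \<or> i = 3" for i :: nat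
    by auto
  have "bounded (range f1)" "bounded (range f2)"
    using b by (auto intro: bounded_range_realI)
  then show "f \<in> C_b_3"
    using d f3 b(1) 1 2 3 by (auto simp: C_b_3_def i field_differentiable_def)
qed

lemma C3_line_diff:
  assumes "C3_line f f1 f2 B1 B2" "C3_line g g1 g2 D1 D2"
    and "\<And>z. \<bar>f1 z - g1 z\<bar> \<le> E1" "\<And>z. \<bar>f2 z - g2 z\<bar> \<le> E2"
  shows "C3_line (\<lambda>z. f z - g z) (\<lambda>z. f1 z - g1 z) (\<lambda>z. f2 z - g2 z) E1 E2"
proof -
  obtain f3 where f: "\<And>z. (f has_real_derivative f1 z) (at z)" "\<And>z. (f1 has_real_derivative f2 z) (at z)"
      "\<And>z. (f2 has_real_derivative f3 z) (at z)" "continuous_on UNIV f3" "bounded (range f3)" "bounded (range f)"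
    using assms(1) unfolding C3_line_def by blast
  obtain g3 where g: "\<And>z. (g has_real_derivative g1 z) (at z)" "\<And>z. (g1 has_real_derivative g2 z) (at z)"
      "\<And>z. (g2 has_real_derivative g3 z) (at z)" "continuous_on UNIV g3" "bounded (range g3)" "bounded (range g)"
    using assms(2) unfolding C3_line_def by blast
  show ?thesis
    unfolding C3_line_def
    using f g assms(3,4)
    by (auto intro!: DERIV_diff exI[of _ "\<lambda>z. f3 z - g3 z"] continuous_on_diff bounded_range_diff)
qed

lemma C3_line_increment:
  assumes "C3_line f f1 f2 B1 B2"
  shows "\<bar>f a - f b\<bar> \<le> B1 * \<bar>a - b\<bar>"
  using field_differentiable_bound[of UNIV f f1 B1 a b] assms by (auto simp: C3_line_def)

locale consistent_scheme = scheme +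
  fixes c q\<^sub>0 :: real
  assumes c_nonneg: "0 \<le> c" and q0_pos: "0 < q\<^sub>0"
    and consistency: "\<And>p a f s z. f \<in> C_b_3 \<Longrightarrow> s \<in> {0<..1} \<Longrightarrow>
        consistency_error \<alpha> P \<mu> p a f s z \<le>
          c * ((sup_norm (deriv f) + sup_norm ((deriv ^^ 2) f)) * s powr q\<^sub>0
                 + sup_norm ((deriv ^^ 2) f) * s powr ((2 - \<alpha>) / \<alpha>))"
begin

abbreviation generator :: "real \<Rightarrow> real \<Rightarrow> (real \<Rightarrow> real) \<Rightarrow> real" where
  "generator \<equiv> G_op (Theta \<alpha> P)"

definition increment :: "real \<Rightarrow> real \<Rightarrow> real \<Rightarrow> (real \<Rightarrow> real) \<Rightarrow> R3 \<Rightarrow> real" where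
  "increment s p a f w = f (s powr (1/\<alpha>) * snd (snd w)) - f 0 + s * p * fst (snd w) + s/2 * a * (fst w)\<^sup>2"

lemma admissible_increment:
  assumes "C3_line f f1 f2 B1 B2"
  shows "admissible (increment s p a f)"
proof -
  have f: "f \<in> borel_measurable borel"
  proof (rule borel_measurable_continuous_onI, rule DERIV_continuous_on)
    show "(f has_real_derivative f1 z) (at z)" for z using assms by (simp add: C3_line_def)
  qed
  have "admissible (\<lambda>w. f (s powr (1/\<alpha>) * snd (snd w)) - f 0)"
  proof (rule admissible_bounded_by)
    have "(\<lambda>w::R3. snd (snd w)) \<in> borel_measurable borel"
      by (intro borel_measurable_continuous_onI continuous_intros)
    then show "(\<lambda>w::R3. f (s powr (1/\<alpha>) * snd (snd w)) - f 0) \<in> borel_measurable borel"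
      using f by measurable
    show "admissible (\<lambda>w. (B1 * s powr (1/\<alpha>)) * \<bar>snd (snd w)\<bar>)"
      by (intro admissible_cmult admissible_monomials)
    show "\<bar>f (s powr (1/\<alpha>) * snd (snd w)) - f 0\<bar> \<le> (B1 * s powr (1/\<alpha>)) * \<bar>snd (snd w)\<bar>" for w :: R3
      using C3_line_increment[OF assms, of "s powr (1/\<alpha>) * snd (snd w)" 0] by (simp add: abs_mult mult.assoc)
  qed
  then show ?thesis
    unfolding increment_def[abs_def]
    by (intro admissible_add admissible_cmult admissible_monomials)
qed

lemma generator_consistent:
  assumes f: "C3_line f f1 f2 B1 B2" and s: "0 < s" "s \<le> 1"
  shows "\<bar>E1 (increment s p a f) - s * generator p a f\<bar>
    \<le> s * (c * ((B1 + B2) * s powr q\<^sub>0 + B2 * s powr ((2 - \<alpha>) / \<alpha>)))"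
proof -
  note d = C3_line_derivs[OF f]
  have "E_hat P \<mu> (\<lambda>w. f (0 + s powr (1/\<alpha>) * Z_seq 0 w) - f 0 + s * p * Y_seq 0 w + s/2 * a * (X_seq 0 w)\<^sup>2)
      = E1 (increment s p a f)"
    using product_expectation_coordinate[of E1 "increment s p a f" 0] E1_const
    by (simp add: E_hat_def increment_def X_seq_def Y_seq_def Z_seq_def)
  then have "(1/s) * \<bar>E1 (increment s p a f) - s * generator p a f\<bar> = consistency_error \<alpha> P \<mu> p a f s 0"
    by (simp add: consistency_error_def)
  also have "\<dots> \<le> c * ((sup_norm (deriv f) + sup_norm ((deriv ^^ 2) f)) * s powr q\<^sub>0
                 + sup_norm ((deriv ^^ 2) f) * s powr ((2 - \<alpha>) / \<alpha>))"
    using d(1) s by (intro consistency) auto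
  also have "\<dots> \<le> c * ((B1 + B2) * s powr q\<^sub>0 + B2 * s powr ((2 - \<alpha>) / \<alpha>))"
    unfolding d(2,3) using d(4,5) c_nonneg by (intro mult_left_mono add_mono mult_right_mono) auto
  finally have "s * ((1/s) * \<bar>E1 (increment s p a f) - s * generator p a f\<bar>)
      \<le> s * (c * ((B1 + B2) * s powr q\<^sub>0 + B2 * s powr ((2 - \<alpha>) / \<alpha>)))"
    using s by (intro mult_left_mono) auto
  then show ?thesis using s by simp
qed

text \<open>The operator \<open>G\<close> as the derivative at \<open>0\<close> of a sublinear expectation. Subadditivity and bounds of
  \<open>G\<close> are inherited from \<open>E1\<close> this way, without any estimate of Levy integrals.\<close>

lemma generator_limit:
  assumes f: "C3_line f f1 f2 B1 B2"
  shows "((\<lambda>s. E1 (increment s p a f) / s) \<longlongrightarrow> generator p a f) (at_right 0)"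
proof (rule LIM_zero_cancel, rule Lim_null_comparison)
  let ?e = "\<lambda>s. c * ((B1 + B2) * s powr q\<^sub>0 + B2 * s powr ((2 - \<alpha>) / \<alpha>))"
  have id: "((\<lambda>s::real. s) \<longlongrightarrow> 0) (at_right 0)" by (rule tendsto_ident_at)
  have pos: "\<forall>\<^sub>F s::real in at_right 0. 0 \<le> s" using eventually_at_right_less[of 0] by eventually_elim simp
  have "((\<lambda>s::real. s powr q\<^sub>0) \<longlongrightarrow> 0) (at_right 0)" "((\<lambda>s::real. s powr ((2 - \<alpha>) / \<alpha>)) \<longlongrightarrow> 0) (at_right 0)"
    using q0_pos alpha by (auto intro!: tendsto_zero_powrI[OF id tendsto_const pos])
  then have "(?e \<longlongrightarrow> c * ((B1 + B2) * 0 + B2 * 0)) (at_right 0)"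
    by (intro tendsto_mult tendsto_add tendsto_const)
  then show "(?e \<longlongrightarrow> 0) (at_right 0)" by simp
  have "\<forall>\<^sub>F s::real in at_right 0. 0 < s \<and> s \<le> 1"
    unfolding eventually_at_right_field by (intro exI[of _ 1]) auto
  then show "\<forall>\<^sub>F s in at_right 0. norm (E1 (increment s p a f) / s - generator p a f) \<le> ?e s"
  proof eventually_elim
    case (elim s)
    have "E1 (increment s p a f) / s - generator p a f = (E1 (increment s p a f) - s * generator p a f) / s"
      using elim by (simp add: diff_divide_distrib)
    then have "\<bar>E1 (increment s p a f) / s - generator p a f\<bar> = \<bar>E1 (increment s p a f) - s * generator p a f\<bar> / s"
      using elim by (simp add: abs_divide)
    also have "\<dots> \<le> ?e s"
      using generator_consistent[OF f, of s p a] elim by (simp add: pos_divide_le_eq mult.commute)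
    finally show ?case by simp
  qed
qed

lemma generator_diff_le:
  assumes f: "C3_line f f1 f2 B1 B2" and g: "C3_line g g1 g2 D1 D2"
    and fg: "C3_line (\<lambda>z. f z - g z) (\<lambda>z. f1 z - g1 z) (\<lambda>z. f2 z - g2 z) F1 F2"
  shows "generator p a f - generator p' a' g \<le> generator (p - p') (a - a') (\<lambda>z. f z - g z)"
proof (rule tendsto_le)
  show "((\<lambda>s. E1 (increment s p a f) / s - E1 (increment s p' a' g) / s)
      \<longlongrightarrow> generator p a f - generator p' a' g) (at_right 0)"
    by (intro tendsto_diff generator_limit[OF f] generator_limit[OF g])
  show "((\<lambda>s. E1 (increment s (p - p') (a - a') (\<lambda>z. f z - g z)) / s)
      \<longlongrightarrow> generator (p - p') (a - a') (\<lambda>z. f z - g z)) (at_right 0)"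
    by (rule generator_limit[OF fg])
  show "\<forall>\<^sub>F s in at_right 0. E1 (increment s p a f) / s - E1 (increment s p' a' g) / s
      \<le> E1 (increment s (p - p') (a - a') (\<lambda>z. f z - g z)) / s"
    using eventually_at_right_less[of 0]
  proof eventually_elim
    case (elim s)
    have "(\<lambda>w. increment s p a f w - increment s p' a' g w) = increment s (p - p') (a - a') (\<lambda>z. f z - g z)"
      by (simp add: increment_def fun_eq_iff field_simps)
    then have "E1 (increment s p a f) \<le> E1 (increment s p' a' g) + E1 (increment s (p - p') (a - a') (\<lambda>z. f z - g z))"
      using E1_le_add_diff[OF admissible_increment[OF f] admissible_increment[OF g], of s p a s p' a'] by simp
    then show ?case using elim by (simp add: divide_right_mono flip: diff_divide_distrib)
  qed
qed simp

text \<open>The consistency estimate at \<open>s = 1\<close> bounds \<open>G\<close> by a first moment of the increment.\<close>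

lemma generator_le:
  assumes f: "C3_line f f1 f2 B1 B2"
  shows "generator p a f \<le> M * (B1 + \<bar>p\<bar> + \<bar>a\<bar>) + c * (B1 + 2 * B2)"
proof -
  have "E1 (increment 1 p a f) \<le> M * (B1 + \<bar>p\<bar> + \<bar>a\<bar>)"
  proof (rule E1_least)
    fix \<theta> assume \<theta>: "\<theta> \<in> P"
    let ?A = "\<lambda>w::R3. B1 * \<bar>snd (snd w)\<bar>" and ?B = "\<lambda>w::R3. \<bar>p\<bar> * \<bar>fst (snd w)\<bar>"
      and ?C = "\<lambda>w::R3. \<bar>a\<bar> * (fst w)\<^sup>2"
    have adm: "admissible ?A" "admissible ?B" "admissible ?C"
      by (intro admissible_cmult admissible_monomials)+
    have B1: "0 \<le> B1" using f abs_ge_zero order_trans unfolding C3_line_def by blast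
    have "mean \<theta> (increment 1 p a f) \<le> mean \<theta> (\<lambda>w. (?A w + ?B w) + ?C w)"
    proof (rule mean_mono[OF \<theta> admissible_increment[OF f]])
      show "admissible (\<lambda>w. (?A w + ?B w) + ?C w)" using adm by (intro admissible_add)
      fix w :: R3
      have "f (snd (snd w)) - f 0 \<le> ?A w"
        using C3_line_increment[OF f, of "snd (snd w)" 0] by simp
      moreover have "p * fst (snd w) \<le> ?B w" by (simp flip: abs_mult)
      moreover have "1/2 * a * (fst w)\<^sup>2 \<le> ?C w"
        by (intro mult_right_mono) auto
      ultimately show "increment 1 p a f w \<le> ?A w + ?B w + ?C w" by (simp add: increment_def)
    qed
    also have "\<dots> = mean \<theta> ?A + mean \<theta> ?B + mean \<theta> ?C"
      using adm \<theta> by (simp only: mean_add admissible_add)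
    also have "mean \<theta> ?A \<le> B1 * M"
      using mean_moments(5)[OF \<theta>] B1 by (subst mean_cmult[OF \<theta> admissible_monomials(8)]) (intro mult_left_mono)
    also have "mean \<theta> ?B \<le> \<bar>p\<bar> * M"
      using mean_moments(3)[OF \<theta>] by (subst mean_cmult[OF \<theta> admissible_monomials(6)]) (intro mult_left_mono, auto)
    also have "mean \<theta> ?C \<le> \<bar>a\<bar> * M"
      using mean_moments(1)[OF \<theta>] by (subst mean_cmult[OF \<theta> admissible_monomials(3)]) (intro mult_left_mono, auto)
    finally show "mean \<theta> (increment 1 p a f) \<le> M * (B1 + \<bar>p\<bar> + \<bar>a\<bar>)" by (simp add: algebra_simps)
  qed
  then show ?thesis
    using generator_consistent[OF f, of 1 p a] by (simp add: abs_le_iff algebra_simps)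
qed

end


section \<open>Smooth functions\<close>

definition deriv_along :: "R3 \<Rightarrow> (R3 \<Rightarrow> real) \<Rightarrow> (R3 \<Rightarrow> real) \<Rightarrow> bool" where
  "deriv_along b F F' \<longleftrightarrow> (\<forall>v. ((\<lambda>s. F (v + s *\<^sub>R b)) has_real_derivative F' v) (at 0))"

lemma deriv_along_at:
  assumes "deriv_along b F F'"
  shows "((\<lambda>s. F (v + s *\<^sub>R b)) has_real_derivative F' (v + s\<^sub>0 *\<^sub>R b)) (at s\<^sub>0)"
proof -
  have "((\<lambda>s. F ((v + s\<^sub>0 *\<^sub>R b) + s *\<^sub>R b)) has_real_derivative F' (v + s\<^sub>0 *\<^sub>R b)) (at 0)"
    using assms unfolding deriv_along_def by blast
  then have "((\<lambda>s. F (v + (s + s\<^sub>0) *\<^sub>R b)) has_real_derivative F' (v + s\<^sub>0 *\<^sub>R b)) (at 0)"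
    by (simp add: scaleR_left_distrib ac_simps)
  then show ?thesis
    using DERIV_shift[of "\<lambda>s. F (v + s *\<^sub>R b)" "F' (v + s\<^sub>0 *\<^sub>R b)" 0 s\<^sub>0] by simp
qed

lemma deriv_along_abs_le:
  assumes "deriv_along b F F'" "Lip1 K F" "ell1 b = 1"
  shows "\<bar>F' v\<bar> \<le> K"
proof -
  have "((\<lambda>s. (F (v + s *\<^sub>R b) - F v) / s) \<longlongrightarrow> F' v) (at 0)"
    using assms(1) by (simp add: deriv_along_def has_field_derivative_iff del: split_paired_All)
  then have "((\<lambda>s. \<bar>(F (v + s *\<^sub>R b) - F v) / s\<bar>) \<longlongrightarrow> \<bar>F' v\<bar>) (at 0)"
    by (rule tendsto_rabs)
  moreover have "\<forall>\<^sub>F s in at 0. \<bar>(F (v + s *\<^sub>R b) - F v) / s\<bar> \<le> K"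
  proof (rule eventually_at_topological[THEN iffD2], intro exI[of _ UNIV] conjI ballI impI)
    fix s :: real assume "s \<noteq> 0"
    then show "\<bar>(F (v + s *\<^sub>R b) - F v) / s\<bar> \<le> K"
      using Lip1D[OF assms(2), of "v + s *\<^sub>R b" v] assms(3) by (simp add: abs_divide pos_divide_le_eq)
  qed auto
  ultimately show ?thesis
    by (rule tendsto_upperbound) simp
qed

definition dir_x :: R3 where "dir_x = (1, 0, 0)"
definition dir_y :: R3 where "dir_y = (0, 1, 0)"
definition dir_z :: R3 where "dir_z = (0, 0, 1)"

lemma ell1_dirs [simp]: "ell1 dir_x = 1" "ell1 dir_y = 1" "ell1 dir_z = 1"
  by (simp_all add: dir_x_def dir_y_def dir_z_def)

text \<open>Exactly the derivatives that the expansion of one step and the operator \<open>G\<close> see: \<open>N1\<close>, \<open>N2\<close> and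
  \<open>N3\<close> bound derivatives of order one, two and three, through the Lipschitz constants of the derivatives
  one order lower.\<close>

definition smooth3 ::
    "real \<Rightarrow> real \<Rightarrow> real \<Rightarrow> (R3 \<Rightarrow> real) \<Rightarrow> (R3 \<Rightarrow> real) \<Rightarrow> (R3 \<Rightarrow> real) \<Rightarrow> bool" where
  "smooth3 N1 N2 N3 g gy gxx \<longleftrightarrow>
     bounded (range g) \<and> Lip1 N1 g \<and> deriv_along dir_y g gy \<and> Lip1 N2 gy \<and> Lip1 N3 gxx \<and>
     (\<exists>gx. deriv_along dir_x g gx \<and> is_Lip gx \<and> deriv_along dir_x gx gxx) \<and>
     (\<exists>gz gzz gzzz. deriv_along dir_z g gz \<and> Lip1 N2 gz \<and> deriv_along dir_z gz gzz \<and> Lip1 N3 gzz \<and>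
        deriv_along dir_z gzz gzzz \<and> continuous_on UNIV gzzz \<and> bounded (range gzzz))"

context consistent_scheme
begin

text \<open>The right-hand side of the equation for functions of the space variables.\<close>

definition Gen :: "(R3 \<Rightarrow> real) \<Rightarrow> (R3 \<Rightarrow> real) \<Rightarrow> (R3 \<Rightarrow> real) \<Rightarrow> R3 \<Rightarrow> real" where
  "Gen g gy gxx v = generator (gy v) (gxx v) (\<lambda>l. g (v + l *\<^sub>R dir_z))"

definition step_error :: "real \<Rightarrow> real \<Rightarrow> real \<Rightarrow> real \<Rightarrow> real" where
  "step_error N1 N2 N3 h = 4 * M\<^sup>2 * (N2 + N3) * sqrt h
     + c * ((N1 + N2) * h powr q\<^sub>0 + N2 * h powr ((2 - \<alpha>) / \<alpha>))"

lemma smooth3_line: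
  assumes "deriv_along dir_z g gz" "deriv_along dir_z gz gzz" "deriv_along dir_z gzz gzzz"
    and "Lip1 N1 g" "Lip1 N2 gz" "continuous_on UNIV gzzz" "bounded (range gzzz)" "bounded (range g)"
  shows "C3_line (\<lambda>l. g (v + l *\<^sub>R dir_z)) (\<lambda>l. gz (v + l *\<^sub>R dir_z)) (\<lambda>l. gzz (v + l *\<^sub>R dir_z)) N1 N2"
  unfolding C3_line_def
proof (intro conjI allI exI[of _ "\<lambda>l. gzzz (v + l *\<^sub>R dir_z)"])
  show "continuous_on UNIV (\<lambda>l. gzzz (v + l *\<^sub>R dir_z))"
    by (rule continuous_on_compose2[OF assms(6)]) (auto intro!: continuous_intros)
  show "bounded (range (\<lambda>l. gzzz (v + l *\<^sub>R dir_z)))" "bounded (range (\<lambda>l. g (v + l *\<^sub>R dir_z)))"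
    by (rule bounded_subset[OF assms(7)] bounded_subset[OF assms(8)]; auto)+
  fix l
  show "((\<lambda>l. g (v + l *\<^sub>R dir_z)) has_real_derivative gz (v + l *\<^sub>R dir_z)) (at l)"
    "((\<lambda>l. gz (v + l *\<^sub>R dir_z)) has_real_derivative gzz (v + l *\<^sub>R dir_z)) (at l)"
    "((\<lambda>l. gzz (v + l *\<^sub>R dir_z)) has_real_derivative gzzz (v + l *\<^sub>R dir_z)) (at l)"
    by (rule deriv_along_at assms)+
  show "\<bar>gz (v + l *\<^sub>R dir_z)\<bar> \<le> N1" by (rule deriv_along_abs_le[OF assms(1,4)]) simp
  show "\<bar>gzz (v + l *\<^sub>R dir_z)\<bar> \<le> N2" by (rule deriv_along_abs_le[OF assms(2,5)]) simp
qed

text \<open>By subadditivity, \<open>Gen g v - Gen g w\<close> is at most \<open>G\<close> of the difference of the translates of \<open>g\<close> to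
  \<open>v\<close> and \<open>w\<close>; its derivatives up to order two are of the size of the distance.\<close>

lemma Gen_Lip1:
  assumes g: "smooth3 N1 N2 N3 g gy gxx"
  shows "Lip1 ((2 * c + 2 * M) * (N2 + N3)) (Gen g gy gxx)"
proof -
  obtain gz gzz gzzz where z: "deriv_along dir_z g gz" "deriv_along dir_z gz gzz" "deriv_along dir_z gzz gzzz"
      "Lip1 N1 g" "Lip1 N2 gz" "continuous_on UNIV gzzz" "bounded (range gzzz)" "bounded (range g)"
    and L: "Lip1 N3 gzz" "Lip1 N2 gy" "Lip1 N3 gxx"
    using g unfolding smooth3_def by blast
  note line = smooth3_line[OF z]
  have N: "0 \<le> N2" "0 \<le> N3" using L by (auto dest: Lip1_nonneg)
  have le: "Gen g gy gxx v - Gen g gy gxx w \<le> (2 * c + 2 * M) * (N2 + N3) * ell1 (v - w)" for v w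
  proof -
    let ?d = "ell1 (v - w)"
    let ?f = "\<lambda>l. g (v + l *\<^sub>R dir_z)" and ?g = "\<lambda>l. g (w + l *\<^sub>R dir_z)"
    have D: "C3_line (\<lambda>l. ?f l - ?g l) (\<lambda>l. gz (v + l *\<^sub>R dir_z) - gz (w + l *\<^sub>R dir_z))
        (\<lambda>l. gzz (v + l *\<^sub>R dir_z) - gzz (w + l *\<^sub>R dir_z)) (N2 * ?d) (N3 * ?d)"
    proof (rule C3_line_diff[OF line line])
      show "\<bar>gz (v + l *\<^sub>R dir_z) - gz (w + l *\<^sub>R dir_z)\<bar> \<le> N2 * ?d" for l
        using Lip1D[OF z(5), of "v + l *\<^sub>R dir_z" "w + l *\<^sub>R dir_z"] by simp
      show "\<bar>gzz (v + l *\<^sub>R dir_z) - gzz (w + l *\<^sub>R dir_z)\<bar> \<le> N3 * ?d" for l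
        using Lip1D[OF L(1), of "v + l *\<^sub>R dir_z" "w + l *\<^sub>R dir_z"] by simp
    qed
    have "Gen g gy gxx v - Gen g gy gxx w \<le> generator (gy v - gy w) (gxx v - gxx w) (\<lambda>l. ?f l - ?g l)"
      unfolding Gen_def by (rule generator_diff_le[OF line line D])
    also have "\<dots> \<le> M * (N2 * ?d + \<bar>gy v - gy w\<bar> + \<bar>gxx v - gxx w\<bar>) + c * (N2 * ?d + 2 * (N3 * ?d))"
      by (rule generator_le[OF D])
    also have "\<dots> \<le> M * (N2 * ?d + N2 * ?d + N3 * ?d) + c * (N2 * ?d + 2 * (N3 * ?d))"
      using M_ge_1 Lip1D[OF L(2), of v w] Lip1D[OF L(3), of v w]
      by (intro add_right_mono mult_left_mono[of _ _ M] add_mono) auto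
    also have "\<dots> \<le> (2 * c + 2 * M) * (N2 + N3) * ?d"
    proof -
      have "0 \<le> M * (N3 * ?d)" "0 \<le> c * (N2 * ?d)" using M_ge_1 N c_nonneg by auto
      then show ?thesis by (simp add: algebra_simps)
    qed
    finally show ?thesis .
  qed
  show ?thesis
    unfolding Lip1_def
  proof (intro conjI allI)
    show "0 \<le> (2 * c + 2 * M) * (N2 + N3)" using M_ge_1 N c_nonneg by simp
    fix v w
    show "\<bar>Gen g gy gxx v - Gen g gy gxx w\<bar> \<le> (2 * c + 2 * M) * (N2 + N3) * ell1 (v - w)"
      using le[of v w] le[of w v] by (simp add: abs_le_iff ell1_minus_commute[of w v])
  qed
qed

text \<open>Only the increments \<open>a\<close> and \<open>b\<close> are expanded: the jump \<open>d\<close> is not small in the second mean and is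
  left to the consistency estimate. The term linear in \<open>a\<close> keeps its coefficient at the displaced
  point, since it is removed by a mean and not by a bound.\<close>

lemma smooth3_taylor:
  assumes g: "Lip1 N1 g" "deriv_along dir_y g gy" "Lip1 N2 gy" "Lip1 N3 gxx"
    and x: "deriv_along dir_x g gx" "deriv_along dir_x gx gxx"
  shows "\<bar>g (v + (a, b, d)) - (g (v + d *\<^sub>R dir_z) + b * gy v + a\<^sup>2 / 2 * gxx v + a * gx (v + (0, b, d)))\<bar>
    \<le> N3 * \<bar>a\<bar> ^ 3 + N3 * a\<^sup>2 * (\<bar>b\<bar> + \<bar>d\<bar>) + N2 * (b\<^sup>2 + \<bar>b\<bar> * \<bar>d\<bar>)"
proof -
  let ?u = "v + (0, b, d)" and ?p = "v + d *\<^sub>R dir_z"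
  have N3: "0 \<le> N3" and N2: "0 \<le> N2" using g by (auto dest: Lip1_nonneg)
  have x1: "\<bar>gx (?u + s *\<^sub>R dir_x) - gx ?u - s * gxx ?u\<bar> \<le> N3 * \<bar>a\<bar> * \<bar>s\<bar>" if "\<bar>s\<bar> \<le> \<bar>a\<bar>" for s
  proof -
    have "\<bar>(gx (?u + s *\<^sub>R dir_x) - s * gxx ?u) - (gx (?u + 0 *\<^sub>R dir_x) - 0 * gxx ?u)\<bar> \<le> N3 * \<bar>a\<bar> * \<bar>s\<bar>"
    proof (rule real_increment_le)
      show "((\<lambda>s. gx (?u + s *\<^sub>R dir_x) - s * gxx ?u) has_real_derivative gxx (?u + r *\<^sub>R dir_x) - gxx ?u) (at r)" for r
        using deriv_along_at[OF x(2), of ?u r] by (auto intro!: derivative_eq_intros)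
      fix r assume r: "\<bar>r\<bar> \<le> \<bar>s\<bar>"
      have "\<bar>gxx (?u + r *\<^sub>R dir_x) - gxx ?u\<bar> \<le> N3 * \<bar>r\<bar>"
        using Lip1D[OF g(4), of "?u + r *\<^sub>R dir_x" ?u] by simp
      also have "\<dots> \<le> N3 * \<bar>a\<bar>" using r that N3 by (intro mult_left_mono) auto
      finally show "\<bar>gxx (?u + r *\<^sub>R dir_x) - gxx ?u\<bar> \<le> N3 * \<bar>a\<bar>" .
    qed
    then show ?thesis by simp
  qed
  have "\<bar>(g (?u + a *\<^sub>R dir_x) - a * gx ?u - a\<^sup>2 / 2 * gxx ?u)
      - (g (?u + 0 *\<^sub>R dir_x) - 0 * gx ?u - 0\<^sup>2 / 2 * gxx ?u)\<bar> \<le> N3 * \<bar>a\<bar> * \<bar>a\<bar> * \<bar>a\<bar>"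
  proof (rule real_increment_le)
    show "((\<lambda>s. g (?u + s *\<^sub>R dir_x) - s * gx ?u - s\<^sup>2 / 2 * gxx ?u)
        has_real_derivative gx (?u + r *\<^sub>R dir_x) - gx ?u - r * gxx ?u) (at r)" for r
      using deriv_along_at[OF x(1), of ?u r] by (auto intro!: derivative_eq_intros)
    fix r assume r: "\<bar>r\<bar> \<le> \<bar>a\<bar>"
    have "\<bar>gx (?u + r *\<^sub>R dir_x) - gx ?u - r * gxx ?u\<bar> \<le> N3 * \<bar>a\<bar> * \<bar>r\<bar>" by (rule x1[OF r])
    also have "\<dots> \<le> N3 * \<bar>a\<bar> * \<bar>a\<bar>" using r N3 by (intro mult_left_mono) auto
    finally show "\<bar>gx (?u + r *\<^sub>R dir_x) - gx ?u - r * gxx ?u\<bar> \<le> N3 * \<bar>a\<bar> * \<bar>a\<bar>" .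
  qed
  moreover have "?u + a *\<^sub>R dir_x = v + (a, b, d)" by (simp add: dir_x_def add.assoc)
  ultimately have X: "\<bar>g (v + (a, b, d)) - g ?u - a * gx ?u - a\<^sup>2 / 2 * gxx ?u\<bar> \<le> N3 * \<bar>a\<bar> ^ 3"
    by (simp add: power3_eq_cube mult.assoc)
  have XX: "\<bar>a\<^sup>2 / 2 * gxx ?u - a\<^sup>2 / 2 * gxx v\<bar> \<le> N3 * a\<^sup>2 * (\<bar>b\<bar> + \<bar>d\<bar>)"
  proof -
    have "\<bar>gxx ?u - gxx v\<bar> \<le> N3 * (\<bar>b\<bar> + \<bar>d\<bar>)" using Lip1D[OF g(4), of ?u v] by simp
    then have "a\<^sup>2 / 2 * \<bar>gxx ?u - gxx v\<bar> \<le> a\<^sup>2 * (N3 * (\<bar>b\<bar> + \<bar>d\<bar>))"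
      by (intro mult_mono) auto
    moreover have "\<bar>a\<^sup>2 / 2 * gxx ?u - a\<^sup>2 / 2 * gxx v\<bar> = a\<^sup>2 / 2 * \<bar>gxx ?u - gxx v\<bar>"
      by (simp only: abs_mult flip: right_diff_distrib) simp
    ultimately show ?thesis by (simp only: mult_ac)
  qed
  have "\<bar>(g (?p + b *\<^sub>R dir_y) - b * gy v) - (g (?p + 0 *\<^sub>R dir_y) - 0 * gy v)\<bar> \<le> N2 * (\<bar>b\<bar> + \<bar>d\<bar>) * \<bar>b\<bar>"
  proof (rule real_increment_le)
    show "((\<lambda>s. g (?p + s *\<^sub>R dir_y) - s * gy v) has_real_derivative gy (?p + r *\<^sub>R dir_y) - gy v) (at r)" for r
      using deriv_along_at[OF g(2), of ?p r] by (auto intro!: derivative_eq_intros)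
    fix r assume r: "\<bar>r\<bar> \<le> \<bar>b\<bar>"
    have "\<bar>gy (?p + r *\<^sub>R dir_y) - gy v\<bar> \<le> N2 * ell1 (?p + r *\<^sub>R dir_y - v)" by (rule Lip1D[OF g(3)])
    also have "ell1 (?p + r *\<^sub>R dir_y - v) = \<bar>r\<bar> + \<bar>d\<bar>" by (simp add: dir_z_def dir_y_def)
    also have "N2 * (\<bar>r\<bar> + \<bar>d\<bar>) \<le> N2 * (\<bar>b\<bar> + \<bar>d\<bar>)" using r N2 by (intro mult_left_mono) auto
    finally show "\<bar>gy (?p + r *\<^sub>R dir_y) - gy v\<bar> \<le> N2 * (\<bar>b\<bar> + \<bar>d\<bar>)" .
  qed
  moreover have "?p + b *\<^sub>R dir_y = ?u" by (simp add: dir_z_def dir_y_def add.assoc)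
  ultimately have Y: "\<bar>g ?u - b * gy v - g ?p\<bar> \<le> N2 * (b\<^sup>2 + \<bar>b\<bar> * \<bar>d\<bar>)"
    by (simp add: algebra_simps power2_eq_square)
  show ?thesis using X XX Y by linarith
qed

text \<open>The Taylor remainder has mean \<open>O(h * sqrt h)\<close>. The term linear in the Gaussian increment has mean
  zero although its coefficient depends on the jump; estimating the cross term of Gaussian increment
  and jump instead would leave an error of order \<open>1/2 + 1/\<alpha>\<close> in \<open>h\<close>, which is not small enough for
  \<open>\<alpha>\<close> close to \<open>2\<close>.\<close>

lemma step_consistent:
  assumes g: "smooth3 N1 N2 N3 g gy gxx" and h: "0 < h" "h \<le> 1"
  shows "\<bar>T h g v - g v - h * Gen g gy gxx v\<bar> \<le> h * step_error N1 N2 N3 h"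
proof -
  obtain gx where x: "deriv_along dir_x g gx" "is_Lip gx" "deriv_along dir_x gx gxx"
    and L: "Lip1 N1 g" "Lip1 N2 gy" "Lip1 N3 gxx" "deriv_along dir_y g gy"
    using g unfolding smooth3_def by blast
  obtain gz gzz gzzz where z: "deriv_along dir_z g gz" "deriv_along dir_z gz gzz" "deriv_along dir_z gzz gzzz"
      "Lip1 N1 g" "Lip1 N2 gz" "continuous_on UNIV gzzz" "bounded (range gzzz)" "bounded (range g)"
    using g unfolding smooth3_def by blast
  note line = smooth3_line[OF z, of v]
  have N3: "0 \<le> N3" and N2: "0 \<le> N2" using L by (auto dest: Lip1_nonneg)
  let ?f = "\<lambda>l. g (v + l *\<^sub>R dir_z)"
  let ?r = "h powr (1/\<alpha>)"
  let ?F = "\<lambda>w. g (v + jump_scale \<alpha> h w)"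
  let ?I = "increment h (gy v) (gxx v) ?f"
  let ?k = "\<lambda>u. sqrt h * gx (v + (0, h * fst u, ?r * snd u))"
  have admF: "admissible ?F" using L(1) by (intro admissible_Lip_scaled is_LipI)
  have admI: "admissible ?I" by (rule admissible_increment[OF line])
  have admI': "admissible (\<lambda>w. ?I w + g v)" using admI by (intro admissible_add admissible_const)
  have admO: "admissible (\<lambda>w. fst w * ?k (snd w))"
  proof (rule admissible_bounded_by)
    obtain K where K: "Lip1 K gx" using x(2) by (auto simp: is_Lip_def)
    have "continuous_on UNIV (\<lambda>w::R3. fst w * ?k (snd w))"
      by (intro continuous_intros continuous_on_compose2[OF Lip1_continuous_on[OF K, of UNIV]]) auto
    then show "(\<lambda>w::R3. fst w * ?k (snd w)) \<in> borel_measurable borel"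
      by (rule borel_measurable_continuous_onI)
    show "admissible (\<lambda>w. (sqrt h * N1) * \<bar>fst w\<bar>)" by (intro admissible_cmult admissible_monomials)
    show "\<bar>fst w * ?k (snd w)\<bar> \<le> (sqrt h * N1) * \<bar>fst w\<bar>" for w :: R3
    proof -
      have "\<bar>fst w * ?k (snd w)\<bar> = (sqrt h * \<bar>gx (v + (0, h * fst (snd w), ?r * snd (snd w)))\<bar>) * \<bar>fst w\<bar>"
        using h by (simp add: abs_mult)
      also have "\<dots> \<le> (sqrt h * N1) * \<bar>fst w\<bar>"
        using h by (intro mult_right_mono mult_left_mono deriv_along_abs_le[OF x(1) L(1)]) auto
      finally show ?thesis .
    qed
  qed
  have r: "0 \<le> ?r" "?r \<le> sqrt h" and hs: "h \<le> sqrt h"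
    using powr_inverse_le_sqrt[of h \<alpha>] le_sqrt_of_le_1[of h] h alpha by auto
  have "\<bar>E1 ?F - E1 (\<lambda>w. ?I w + g v)\<bar> \<le> h * (4 * M\<^sup>2 * (N2 + N3) * sqrt h)"
  proof (rule E1_close[OF admF admI'])
    fix \<theta> assume \<theta>: "\<theta> \<in> P"
    let ?A = "\<lambda>w::R3. (N3 * (h * sqrt h)) * \<bar>fst w\<bar> ^ 3"
      and ?B = "\<lambda>w::R3. (N3 * (h * sqrt h)) * ((fst w)\<^sup>2 * \<bar>fst (snd w)\<bar>)"
      and ?C = "\<lambda>w::R3. (N3 * (h * sqrt h)) * ((fst w)\<^sup>2 * \<bar>snd (snd w)\<bar>)"
      and ?D = "\<lambda>w::R3. (N2 * (h * sqrt h)) * (fst (snd w))\<^sup>2"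
      and ?E = "\<lambda>w::R3. (N2 * (h * sqrt h)) * (\<bar>fst (snd w)\<bar> * \<bar>snd (snd w)\<bar>)"
    have adm: "admissible ?A" "admissible ?B" "admissible ?C" "admissible ?D" "admissible ?E"
      by (intro admissible_cmult admissible_monomials)+
    have rem: "mean \<theta> ?F - mean \<theta> (\<lambda>w. ?I w + g v) = mean \<theta> (\<lambda>w. (?F w - (?I w + g v)) - fst w * ?k (snd w))"
      using \<theta> admF admI' admO mean_odd[OF \<theta>, of ?k] by (simp only: mean_diff admissible_diff)
    have "\<bar>mean \<theta> (\<lambda>w. (?F w - (?I w + g v)) - fst w * ?k (snd w))\<bar> \<le> mean \<theta> (\<lambda>w. ?A w + ?B w + ?C w + ?D w + ?E w)"
    proof (rule mean_abs_le[OF \<theta>])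
      show "admissible (\<lambda>w. (?F w - (?I w + g v)) - fst w * ?k (snd w))"
        using admF admI' admO by (intro admissible_diff)
      show "admissible (\<lambda>w. ?A w + ?B w + ?C w + ?D w + ?E w)"
        using adm by (intro admissible_add)
      fix w :: R3
      let ?a = "sqrt h * fst w" and ?b = "h * fst (snd w)" and ?d = "?r * snd (snd w)"
      have "\<bar>(?F w - (?I w + g v)) - fst w * ?k (snd w)\<bar>
          = \<bar>g (v + (?a, ?b, ?d)) - (g (v + ?d *\<^sub>R dir_z) + ?b * gy v + ?a\<^sup>2 / 2 * gxx v + ?a * gx (v + (0, ?b, ?d)))\<bar>"
        using h by (simp add: increment_def jump_scale_def power_mult_distrib algebra_simps)
      also have "\<dots> \<le> N3 * \<bar>?a\<bar> ^ 3 + N3 * ?a\<^sup>2 * (\<bar>?b\<bar> + \<bar>?d\<bar>) + N2 * (?b\<^sup>2 + \<bar>?b\<bar> * \<bar>?d\<bar>)"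
        by (rule smooth3_taylor[OF L(1,4,2,3) x(1,3)])
      also have "\<dots> = N3 * (\<bar>?a\<bar> ^ 3) + N3 * (?a\<^sup>2 * \<bar>?b\<bar>) + N3 * (?a\<^sup>2 * \<bar>?d\<bar>) + N2 * ?b\<^sup>2 + N2 * (\<bar>?b\<bar> * \<bar>?d\<bar>)"
        by (simp add: algebra_simps)
      also have "\<dots> \<le> N3 * (h * sqrt h * \<bar>fst w\<bar> ^ 3) + N3 * (h * sqrt h * ((fst w)\<^sup>2 * \<bar>fst (snd w)\<bar>))
          + N3 * (h * sqrt h * ((fst w)\<^sup>2 * \<bar>snd (snd w)\<bar>)) + N2 * (h * sqrt h * (fst (snd w))\<^sup>2)
          + N2 * (h * sqrt h * (\<bar>fst (snd w)\<bar> * \<bar>snd (snd w)\<bar>))"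
      proof (intro add_mono mult_left_mono N2 N3)
        show "\<bar>?a\<bar> ^ 3 \<le> h * sqrt h * \<bar>fst w\<bar> ^ 3"
        proof -
          have 1: "sqrt h ^ 3 = h * sqrt h"
            using h unfolding power3_eq_cube by simp
          have 2: "\<bar>sqrt h\<bar> = sqrt h" using h by simp
          show ?thesis unfolding abs_mult power_mult_distrib 2 1 by (rule order_refl)
        qed
        have a2: "?a\<^sup>2 = h * (fst w)\<^sup>2" using h by (simp add: power_mult_distrib)
        have "h * (fst w)\<^sup>2 * (h * \<bar>fst (snd w)\<bar>) \<le> h * (fst w)\<^sup>2 * (sqrt h * \<bar>fst (snd w)\<bar>)"
          using hs h by (intro mult_left_mono mult_right_mono) auto
        then show "?a\<^sup>2 * \<bar>?b\<bar> \<le> h * sqrt h * ((fst w)\<^sup>2 * \<bar>fst (snd w)\<bar>)"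
          using h by (simp add: a2 abs_mult mult_ac)
        have "h * (fst w)\<^sup>2 * (?r * \<bar>snd (snd w)\<bar>) \<le> h * (fst w)\<^sup>2 * (sqrt h * \<bar>snd (snd w)\<bar>)"
          using r h by (intro mult_left_mono mult_right_mono) auto
        then show "?a\<^sup>2 * \<bar>?d\<bar> \<le> h * sqrt h * ((fst w)\<^sup>2 * \<bar>snd (snd w)\<bar>)"
          using h by (simp add: a2 abs_mult mult_ac)
        have "h * h * (fst (snd w))\<^sup>2 \<le> h * sqrt h * (fst (snd w))\<^sup>2"
          using hs h by (intro mult_left_mono mult_right_mono) auto
        then show "?b\<^sup>2 \<le> h * sqrt h * (fst (snd w))\<^sup>2"
          by (simp add: power2_eq_square mult_ac)
        have "h * \<bar>fst (snd w)\<bar> * (?r * \<bar>snd (snd w)\<bar>) \<le> h * \<bar>fst (snd w)\<bar> * (sqrt h * \<bar>snd (snd w)\<bar>)"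
          using r h by (intro mult_left_mono mult_right_mono) auto
        then show "\<bar>?b\<bar> * \<bar>?d\<bar> \<le> h * sqrt h * (\<bar>fst (snd w)\<bar> * \<bar>snd (snd w)\<bar>)"
          using h by (simp add: abs_mult mult_ac)
      qed
      also have "\<dots> = ?A w + ?B w + ?C w + ?D w + ?E w" by (simp only: mult.assoc)
      finally show "\<bar>(?F w - (?I w + g v)) - fst w * ?k (snd w)\<bar> \<le> ?A w + ?B w + ?C w + ?D w + ?E w" .
    qed
    also have "\<dots> = mean \<theta> ?A + mean \<theta> ?B + mean \<theta> ?C + mean \<theta> ?D + mean \<theta> ?E"
      using adm \<theta> by (simp only: mean_add admissible_add)
    also have "\<dots> \<le> (N3 * (h * sqrt h)) * (2 * M\<^sup>2) + (N3 * (h * sqrt h)) * M\<^sup>2 + (N3 * (h * sqrt h)) * M\<^sup>2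
        + (N2 * (h * sqrt h)) * M\<^sup>2 + (N2 * (h * sqrt h)) * M\<^sup>2"
      unfolding mean_cmult[OF \<theta> admissible_monomials(4)] mean_cmult[OF \<theta> admissible_monomials(10)]
        mean_cmult[OF \<theta> admissible_monomials(9)] mean_cmult[OF \<theta> admissible_monomials(7)]
        mean_cmult[OF \<theta> admissible_monomials(11)]
      using mean_moments[OF \<theta>] N2 N3 h by (intro add_mono mult_left_mono) auto
    also have "\<dots> \<le> h * (4 * M\<^sup>2 * (N2 + N3) * sqrt h)"
    proof -
      have "0 \<le> N2 * (h * sqrt h) * M\<^sup>2" using N2 h by simp
      then show ?thesis by (simp add: algebra_simps)
    qed
    finally show "\<bar>mean \<theta> ?F - mean \<theta> (\<lambda>w. ?I w + g v)\<bar> \<le> h * (4 * M\<^sup>2 * (N2 + N3) * sqrt h)"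
      unfolding rem .
  qed
  moreover have "E1 (\<lambda>w. ?I w + g v) = E1 ?I + g v" by (rule E1_add_const[OF admI])
  moreover have "\<bar>E1 ?I - h * Gen g gy gxx v\<bar> \<le> h * (c * ((N1 + N2) * h powr q\<^sub>0 + N2 * h powr ((2 - \<alpha>) / \<alpha>)))"
    unfolding Gen_def using generator_consistent[OF line h] .
  moreover have "T h g v = E1 ?F" by (simp add: T_def)
  ultimately show ?thesis unfolding step_error_def distrib_left[of h] by linarith
qed

text \<open>One more step adds \<open>h * Gen g\<close> evaluated at the current position, and \<open>Gen g\<close> is Lipschitz, so it
  differs from its value at the start by a multiple of the mean displacement.\<close>

lemma steps_consistent:
  assumes g: "smooth3 N1 N2 N3 g gy gxx" and h: "0 < h" "h \<le> 1" and n: "real n * h \<le> 1"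
  shows "\<bar>(T h ^^ n) g v - g v - real n * h * Gen g gy gxx v\<bar>
    \<le> real n * h * (step_error N1 N2 N3 h + (2 * c + 2 * M) * (N2 + N3) * (Omega * sqrt (real n * h)))"
  (is "_ \<le> real n * h * (?e + ?\<Lambda> * _)")
  using n
proof (induction n)
  case (Suc n)
  let ?G = "Gen g gy gxx"
  let ?t = "real n * h" and ?t' = "real (Suc n) * h"
  have nh: "?t \<le> ?t'" using h by (simp add: algebra_simps)
  then have t1: "?t \<le> 1" using Suc.prems by simp
  have LG: "Lip1 ?\<Lambda> ?G" by (rule Gen_Lip1[OF g])
  have \<Lambda>: "0 \<le> ?\<Lambda>" using LG by (rule Lip1_nonneg)
  have Lg: "is_Lip g" using g by (auto simp: smooth3_def is_Lip_def)
  have LhG: "is_Lip (\<lambda>v. h * ?G v)" using LG by (intro is_Lip_cmult is_LipI)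
  have step: "\<bar>T h g w - (g w + h * ?G w)\<bar> \<le> h * ?e" for w
    using step_consistent[OF g h, of w] by simp
  have "\<bar>(T h ^^ n) (T h g) v - (T h ^^ n) (\<lambda>w. g w + h * ?G w) v\<bar> \<le> h * ?e"
  proof (rule Tn_contraction)
    show "is_Lip (T h g)" using Tn_is_Lip[OF Lg, of 1] by simp
      show "is_Lip (\<lambda>w. g w + h * ?G w)" by (rule is_Lip_add[OF Lg LhG])
  qed (rule step)
  moreover have "\<bar>(T h ^^ n) (\<lambda>w. g w + h * ?G w) v - ((T h ^^ n) g v + h * ?G v)\<bar> \<le> h * (?\<Lambda> * (Omega * sqrt ?t'))"
  proof -
    have w: "h * (?\<Lambda> * (Omega * sqrt ?t)) \<le> h * (?\<Lambda> * (Omega * sqrt ?t'))"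
      using nh h \<Lambda> Omega_ge_1 by (intro mult_left_mono) auto
    have "(T h ^^ n) (\<lambda>w. h * ?G w) v \<le> h * ?G v + h * (?\<Lambda> * (Omega * sqrt ?t))"
    proof -
      have "h * (T h ^^ n) ?G v \<le> h * (?G v + ?\<Lambda> * (Omega * sqrt ?t))"
        using Tn_displacement[OF LG h(1) t1, of v] h by (intro mult_left_mono) auto
      also have "\<dots> = h * ?G v + h * (?\<Lambda> * (Omega * sqrt ?t))" by (rule distrib_left)
      finally show ?thesis using h by (simp only: Tn_cmult[OF is_LipI[OF LG]])
    qed
    moreover have "(T h ^^ n) (\<lambda>w. h * (- ?G w)) v \<le> - (h * ?G v) + h * (?\<Lambda> * (Omega * sqrt ?t))"
    proof -
      have "h * (T h ^^ n) (\<lambda>w. - ?G w) v \<le> h * (- ?G v + ?\<Lambda> * (Omega * sqrt ?t))"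
        using Tn_displacement[OF Lip1_uminus[OF LG] h(1) t1, of v] h by (intro mult_left_mono) auto
      also have "\<dots> = - (h * ?G v) + h * (?\<Lambda> * (Omega * sqrt ?t))" by (simp add: algebra_simps)
      finally show ?thesis using h by (simp only: Tn_cmult[OF is_Lip_uminus[OF is_LipI[OF LG]]])
    qed
    moreover have "(T h ^^ n) (\<lambda>w. g w + h * ?G w) v \<le> (T h ^^ n) g v + (T h ^^ n) (\<lambda>w. h * ?G w) v"
      by (rule Tn_add_le[OF Lg LhG])
    moreover have "(T h ^^ n) g v \<le> (T h ^^ n) (\<lambda>w. g w + h * ?G w) v + (T h ^^ n) (\<lambda>w. h * (- ?G w)) v"
      using Tn_add_le[OF is_Lip_add[OF Lg LhG] is_Lip_uminus[OF LhG], of n h v] by simp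
    ultimately show ?thesis using w by (simp add: abs_le_iff)
  qed
  moreover have "\<bar>(T h ^^ n) g v - g v - ?t * ?G v\<bar> \<le> ?t * (?e + ?\<Lambda> * (Omega * sqrt ?t'))"
  proof -
    have "?t * (?e + ?\<Lambda> * (Omega * sqrt ?t)) \<le> ?t * (?e + ?\<Lambda> * (Omega * sqrt ?t'))"
      using nh h \<Lambda> Omega_ge_1 by (intro mult_left_mono add_left_mono) auto
    then show ?thesis using Suc.IH[OF t1] by linarith
  qed
  moreover have "(T h ^^ Suc n) g v = (T h ^^ n) (T h g) v" by (simp add: funpow_swap1)
  moreover have "?t' * r = ?t * r + h * r" for r by (simp add: algebra_simps)
  ultimately show ?case by (simp only: distrib_left[of h])
qed simp

end

section \<open>Mollification by box averages\<close>

text \<open>Convolution with the uniform distribution on a segment. Its derivative along the segment is a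
  difference quotient, so derivatives of iterated averages are explicit and are bounded by the
  Lipschitz constant alone.\<close>

definition box_avg :: "real \<Rightarrow> R3 \<Rightarrow> (R3 \<Rightarrow> real) \<Rightarrow> R3 \<Rightarrow> real" where
  "box_avg \<epsilon> b f v = integral {0..1} (\<lambda>s. f (v + (\<epsilon> * s) *\<^sub>R b))"

definition diff_quot :: "real \<Rightarrow> R3 \<Rightarrow> (R3 \<Rightarrow> real) \<Rightarrow> R3 \<Rightarrow> real" where
  "diff_quot \<epsilon> b f v = (f (v + \<epsilon> *\<^sub>R b) - f v) / \<epsilon>"

lemma Lip1_segment_continuous: "Lip1 K f \<Longrightarrow> continuous_on S (\<lambda>s::real. f (v + (\<epsilon> * s) *\<^sub>R b))"
  by (rule continuous_on_compose2[OF Lip1_continuous_on[of K f UNIV]]) (auto intro!: continuous_intros)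

lemma Lip1_segment_integrable: "Lip1 K f \<Longrightarrow> (\<lambda>s::real. f (v + (\<epsilon> * s) *\<^sub>R b)) integrable_on {c..d}"
  by (intro integrable_continuous_real Lip1_segment_continuous)

lemma box_avg_close_pointwise:
  assumes "Lip1 K f" "Lip1 L g" "\<And>s. s \<in> {0..1} \<Longrightarrow> \<bar>f (v + (\<epsilon> * s) *\<^sub>R b) - g (w + (\<epsilon> * s) *\<^sub>R b)\<bar> \<le> d"
  shows "\<bar>box_avg \<epsilon> b f v - box_avg \<epsilon> b g w\<bar> \<le> d"
proof -
  have "box_avg \<epsilon> b f v - box_avg \<epsilon> b g w
      = integral {0..1} (\<lambda>s. f (v + (\<epsilon> * s) *\<^sub>R b) - g (w + (\<epsilon> * s) *\<^sub>R b))"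
    unfolding box_avg_def
    by (rule Henstock_Kurzweil_Integration.integral_diff[symmetric]) (rule Lip1_segment_integrable assms)+
  also have "norm \<dots> \<le> d * (1 - 0)"
    using assms by (intro integral_bound continuous_on_diff Lip1_segment_continuous) auto
  finally show ?thesis by simp
qed

lemma box_avg_mono:
  assumes "Lip1 K f" "Lip1 L g" "\<And>v. f v \<le> g v"
  shows "box_avg \<epsilon> b f v \<le> box_avg \<epsilon> b g v"
  unfolding box_avg_def by (intro integral_le Lip1_segment_integrable) (use assms in auto)

lemma box_avg_Lip1:
  assumes "Lip1 K f"
  shows "Lip1 K (box_avg \<epsilon> b f)"
  unfolding Lip1_def
proof (intro conjI allI)
  show "0 \<le> K" using assms by (rule Lip1_nonneg)
  fix v w
  show "\<bar>box_avg \<epsilon> b f v - box_avg \<epsilon> b f w\<bar> \<le> K * ell1 (v - w)"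
  proof (rule box_avg_close_pointwise[OF assms assms])
    fix s
    show "\<bar>f (v + (\<epsilon> * s) *\<^sub>R b) - f (w + (\<epsilon> * s) *\<^sub>R b)\<bar> \<le> K * ell1 (v - w)"
      using Lip1D[OF assms, of "v + (\<epsilon> * s) *\<^sub>R b" "w + (\<epsilon> * s) *\<^sub>R b"] by simp
  qed
qed

lemma box_avg_close:
  assumes "Lip1 K f" "ell1 b = 1" "0 \<le> \<epsilon>"
  shows "\<bar>box_avg \<epsilon> b f v - f v\<bar> \<le> K * \<epsilon>"
proof -
  have K: "0 \<le> K" using assms(1) by (rule Lip1_nonneg)
  have "\<bar>box_avg \<epsilon> b f v - box_avg 0 b (\<lambda>_. f v) v\<bar> \<le> K * \<epsilon>"
  proof -
    have "box_avg 0 b (\<lambda>_. f v) v = box_avg \<epsilon> b (\<lambda>_. f v) v" by (simp add: box_avg_def)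
    moreover have "\<bar>box_avg \<epsilon> b f v - box_avg \<epsilon> b (\<lambda>_. f v) v\<bar> \<le> K * \<epsilon>"
    proof (rule box_avg_close_pointwise[OF assms(1) Lip1_const])
      fix s :: real assume s: "s \<in> {0..1}"
      have "\<bar>f (v + (\<epsilon> * s) *\<^sub>R b) - f v\<bar> \<le> K * (\<epsilon> * s)"
        using Lip1D[OF assms(1), of "v + (\<epsilon> * s) *\<^sub>R b" v] assms s by simp
      also have "\<dots> \<le> K * (\<epsilon> * 1)" using s K assms(3) by (intro mult_left_mono) auto
      finally show "\<bar>f (v + (\<epsilon> * s) *\<^sub>R b) - f v\<bar> \<le> K * \<epsilon>" by simp
    qed
    ultimately show ?thesis by simp
  qed
  then show ?thesis by (simp add: box_avg_def)
qed

lemma box_avg_bounded: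
  assumes "Lip1 K f" "bounded (range f)"
  shows "bounded (range (box_avg \<epsilon> b f))"
proof -
  obtain B where B: "\<And>v. \<bar>f v\<bar> \<le> B" using assms(2) by (auto simp: bounded_iff)
  show ?thesis
  proof (rule bounded_range_realI)
    show "\<bar>box_avg \<epsilon> b f v\<bar> \<le> B" for v
    proof -
      have "\<bar>box_avg \<epsilon> b f v - box_avg \<epsilon> b (\<lambda>_. 0) v\<bar> \<le> B"
        by (rule box_avg_close_pointwise[OF assms(1) Lip1_const]) (simp add: B)
      then show ?thesis by (simp add: box_avg_def)
    qed
  qed
qed

lemma diff_quot_Lip1:
  assumes "Lip1 K f" "0 < \<epsilon>"
  shows "Lip1 (2 * K / \<epsilon>) (diff_quot \<epsilon> b f)"
proof -
  have "Lip1 (\<bar>1 / \<epsilon>\<bar> * (K + K)) (\<lambda>v. (1 / \<epsilon>) * (f (v + \<epsilon> *\<^sub>R b) - f v))"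
    by (intro Lip1_cmult Lip1_diff Lip1_shift assms(1))
  moreover have "(\<lambda>v. (1 / \<epsilon>) * (f (v + \<epsilon> *\<^sub>R b) - f v)) = diff_quot \<epsilon> b f"
    by (simp add: diff_quot_def fun_eq_iff)
  ultimately show ?thesis using assms(2) by (simp add: mult.commute)
qed

lemma deriv_along_diff_quot:
  assumes "deriv_along b' F F'"
  shows "deriv_along b' (diff_quot \<epsilon> b F) (diff_quot \<epsilon> b F')"
  unfolding deriv_along_def
proof
  fix v
  have "((\<lambda>s. F ((v + \<epsilon> *\<^sub>R b) + s *\<^sub>R b')) has_real_derivative F' (v + \<epsilon> *\<^sub>R b)) (at 0)"
    "((\<lambda>s. F (v + s *\<^sub>R b')) has_real_derivative F' v) (at 0)"
    using assms unfolding deriv_along_def by blast+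
  then have "((\<lambda>s. (F ((v + \<epsilon> *\<^sub>R b) + s *\<^sub>R b') - F (v + s *\<^sub>R b')) / \<epsilon>)
      has_real_derivative (F' (v + \<epsilon> *\<^sub>R b) - F' v) / \<epsilon>) (at 0)"
    by (intro DERIV_cdivide DERIV_diff)
  then show "((\<lambda>s. diff_quot \<epsilon> b F (v + s *\<^sub>R b')) has_real_derivative diff_quot \<epsilon> b F' v) (at 0)"
    by (simp add: diff_quot_def ac_simps)
qed

lemma has_real_derivative_of_quadratic_bound:
  fixes \<phi> :: "real \<Rightarrow> real"
  assumes "\<And>s. \<bar>\<phi> s - \<phi> 0 - s * d\<bar> \<le> L * s\<^sup>2"
  shows "(\<phi> has_real_derivative d) (at 0)"
  unfolding has_field_derivative_iff
proof (rule LIM_zero_cancel, rule Lim_null_comparison)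
  show "\<forall>\<^sub>F s in at 0. norm ((\<phi> s - \<phi> 0) / (s - 0) - d) \<le> L * \<bar>s\<bar>"
  proof (rule eventually_at_topological[THEN iffD2], intro exI[of _ UNIV] conjI ballI impI)
    fix s :: real assume s: "s \<noteq> 0"
    have "(\<phi> s - \<phi> 0) / (s - 0) - d = (\<phi> s - \<phi> 0 - s * d) / s" using s by (simp add: field_simps)
    then have "norm ((\<phi> s - \<phi> 0) / (s - 0) - d) = \<bar>\<phi> s - \<phi> 0 - s * d\<bar> / \<bar>s\<bar>" by (simp add: abs_divide)
    also have "\<dots> \<le> L * s\<^sup>2 / \<bar>s\<bar>" using assms[of s] by (rule divide_right_mono) simp
    also have "L * s\<^sup>2 / \<bar>s\<bar> = L * \<bar>s\<bar>"
      using s by (simp add: power2_eq_square field_simps flip: abs_mult)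
    finally show "norm ((\<phi> s - \<phi> 0) / (s - 0) - d) \<le> L * \<bar>s\<bar>" .
  qed auto
  have "((\<lambda>s::real. L * \<bar>s\<bar>) \<longlongrightarrow> L * \<bar>0\<bar>) (at 0)"
    by (intro tendsto_intros)
  then show "((\<lambda>s::real. L * \<bar>s\<bar>) \<longlongrightarrow> 0) (at 0)" by simp
qed

text \<open>A derivative with Lipschitz values has a remainder that is quadratic uniformly in the base point,
  and such a bound survives averaging.\<close>

lemma deriv_along_box_avg:
  assumes d: "deriv_along b' F F'" and F: "Lip1 K F" and F': "Lip1 L F'"
  shows "deriv_along b' (box_avg \<epsilon> b F) (box_avg \<epsilon> b F')"
  unfolding deriv_along_def
proof
  fix v
  let ?L = "L * ell1 b'"
  have L: "0 \<le> ?L" using Lip1_nonneg[OF F'] by simp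
  have quad: "\<bar>F (w + s *\<^sub>R b') - F w - s * F' w\<bar> \<le> ?L * s\<^sup>2" for w s
  proof -
    have "\<bar>(F (w + s *\<^sub>R b') - s * F' w) - (F (w + 0 *\<^sub>R b') - 0 * F' w)\<bar> \<le> (?L * \<bar>s\<bar>) * \<bar>s\<bar>"
    proof (rule real_increment_le)
      show "((\<lambda>s. F (w + s *\<^sub>R b') - s * F' w) has_real_derivative F' (w + r *\<^sub>R b') - F' w) (at r)" for r
        using deriv_along_at[OF d, of w r] by (auto intro!: derivative_eq_intros)
      fix r assume r: "\<bar>r\<bar> \<le> \<bar>s\<bar>"
      have "\<bar>F' (w + r *\<^sub>R b') - F' w\<bar> \<le> ?L * \<bar>r\<bar>"
        using Lip1D[OF F', of "w + r *\<^sub>R b'" w] by (simp add: mult_ac)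
      also have "\<dots> \<le> ?L * \<bar>s\<bar>" using r L by (rule mult_left_mono)
      finally show "\<bar>F' (w + r *\<^sub>R b') - F' w\<bar> \<le> ?L * \<bar>s\<bar>" .
    qed
    then show ?thesis by (simp add: power2_eq_square mult.assoc algebra_simps)
  qed
  show "((\<lambda>s. box_avg \<epsilon> b F (v + s *\<^sub>R b')) has_real_derivative box_avg \<epsilon> b F' v) (at 0)"
  proof (rule has_real_derivative_of_quadratic_bound)
    fix s :: real
    let ?I = "integral {0..1}"
    note int = Lip1_segment_integrable[OF F] Lip1_segment_integrable[OF F']
    have "box_avg \<epsilon> b F (v + s *\<^sub>R b') - box_avg \<epsilon> b F (v + 0 *\<^sub>R b') - s * box_avg \<epsilon> b F' v
        = ?I (\<lambda>r. F ((v + s *\<^sub>R b') + (\<epsilon> * r) *\<^sub>R b) - F (v + (\<epsilon> * r) *\<^sub>R b) - s * F' (v + (\<epsilon> * r) *\<^sub>R b))"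
      unfolding box_avg_def
      by (subst Henstock_Kurzweil_Integration.integral_diff integral_mult_right;
          (intro integrable_diff integrable_on_mult_right int)?)+ simp
    also have "norm \<dots> \<le> (?L * s\<^sup>2) * (1 - 0)"
    proof (rule integral_bound)
      show "continuous_on {0..1} (\<lambda>r. F ((v + s *\<^sub>R b') + (\<epsilon> * r) *\<^sub>R b) - F (v + (\<epsilon> * r) *\<^sub>R b) - s * F' (v + (\<epsilon> * r) *\<^sub>R b))"
        by (intro continuous_on_diff continuous_on_mult continuous_on_const Lip1_segment_continuous[OF F] Lip1_segment_continuous[OF F'])
      fix r
      show "norm (F ((v + s *\<^sub>R b') + (\<epsilon> * r) *\<^sub>R b) - F (v + (\<epsilon> * r) *\<^sub>R b) - s * F' (v + (\<epsilon> * r) *\<^sub>R b)) \<le> ?L * s\<^sup>2"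
        using quad[of "v + (\<epsilon> * r) *\<^sub>R b" s] by (simp add: ac_simps)
    qed simp
    finally show "\<bar>box_avg \<epsilon> b F (v + s *\<^sub>R b') - box_avg \<epsilon> b F (v + 0 *\<^sub>R b') - s * box_avg \<epsilon> b F' v\<bar> \<le> ?L * s\<^sup>2"
      by simp
  qed
qed

lemma deriv_along_box_avg_own:
  assumes f: "Lip1 K f" and \<epsilon>: "0 < \<epsilon>"
  shows "deriv_along b (box_avg \<epsilon> b f) (diff_quot \<epsilon> b f)"
  unfolding deriv_along_def
proof
  fix v
  let ?c = "\<lambda>r::real. f (v + r *\<^sub>R b)"
  have "continuous_on UNIV ?c" using Lip1_segment_continuous[OF f, of UNIV v 1 b] by simp
  then have "isCont ?c x" for x by (simp add: continuous_on_eq_continuous_at)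
  \<comment> \<open>\<open>\<Psi>\<close> is an antiderivative along the line, so the average is a difference quotient of \<open>\<Psi>\<close>\<close>
  then obtain \<Psi> where \<Psi>: "\<And>x. (\<Psi> has_real_derivative ?c x) (at x)"
    using einterval_antiderivative[of "-\<infinity>" "\<infinity>" ?c] by (auto simp: has_real_derivative_iff_has_vector_derivative)
  have avg: "box_avg \<epsilon> b f (v + s *\<^sub>R b) = (\<Psi> (s + \<epsilon>) - \<Psi> s) / \<epsilon>" for s
  proof -
    have "((\<lambda>r. ?c (s + \<epsilon> * r)) has_integral (\<Psi> (s + \<epsilon> * 1) / \<epsilon> - \<Psi> (s + \<epsilon> * 0) / \<epsilon>)) {0..1}"
    proof (rule fundamental_theorem_of_calculus)
      fix r :: real
      have "((\<lambda>r. \<Psi> (s + \<epsilon> * r) / \<epsilon>) has_real_derivative ?c (s + \<epsilon> * r)) (at r within {0..1})"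
        using \<epsilon> by (auto intro!: derivative_eq_intros DERIV_chain2[OF \<Psi>])
      then show "((\<lambda>r. \<Psi> (s + \<epsilon> * r) / \<epsilon>) has_vector_derivative ?c (s + \<epsilon> * r)) (at r within {0..1})"
        by (simp add: has_real_derivative_iff_has_vector_derivative)
    qed simp
    then have "integral {0..1} (\<lambda>r. ?c (s + \<epsilon> * r)) = (\<Psi> (s + \<epsilon>) - \<Psi> s) / \<epsilon>"
      by (auto dest!: integral_unique simp: diff_divide_distrib)
    then show ?thesis by (simp add: box_avg_def scaleR_left_distrib add.assoc)
  qed
  have "((\<lambda>s. (\<Psi> (s + \<epsilon>) - \<Psi> s) / \<epsilon>) has_real_derivative (?c (0 + \<epsilon>) - ?c 0) / \<epsilon>) (at 0)"
    using \<epsilon> by (auto intro!: derivative_eq_intros DERIV_chain2[OF \<Psi>])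
  then show "((\<lambda>s. box_avg \<epsilon> b f (v + s *\<^sub>R b)) has_real_derivative diff_quot \<epsilon> b f v) (at 0)"
    unfolding avg by (simp add: diff_quot_def)
qed

text \<open>In each direction as many averages as \<open>smooth3\<close> requires derivatives.\<close>

definition mollify :: "real \<Rightarrow> (R3 \<Rightarrow> real) \<Rightarrow> R3 \<Rightarrow> real" where
  "mollify \<epsilon> f = box_avg \<epsilon> dir_x (box_avg \<epsilon> dir_x (box_avg \<epsilon> dir_y
     (box_avg \<epsilon> dir_z (box_avg \<epsilon> dir_z (box_avg \<epsilon> dir_z f)))))"

lemma mollify_Lip1: "Lip1 K f \<Longrightarrow> Lip1 K (mollify \<epsilon> f)"
  unfolding mollify_def by (intro box_avg_Lip1)

lemma mollify_bounded:
  assumes f: "Lip1 K f" and b: "bounded (range f)"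
  shows "bounded (range (mollify \<epsilon> f))"
  unfolding mollify_def by (rule box_avg_bounded[of K] box_avg_Lip1 f b)+

lemma mollify_close:
  assumes f: "Lip1 K f" and \<epsilon>: "0 \<le> \<epsilon>"
  shows "\<bar>mollify \<epsilon> f v - f v\<bar> \<le> 6 * K * \<epsilon>"
proof -
  let ?X = "box_avg \<epsilon> dir_x" and ?Y = "box_avg \<epsilon> dir_y" and ?Z = "box_avg \<epsilon> dir_z"
  note L = box_avg_Lip1
  note z1 = f
  note z2 = L[OF z1, of \<epsilon> dir_z]
  note z3 = L[OF z2, of \<epsilon> dir_z]
  note y1 = L[OF z3, of \<epsilon> dir_z]
  note x1 = L[OF y1, of \<epsilon> dir_y]
  note x2 = L[OF x1, of \<epsilon> dir_x]
  show ?thesis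
    using box_avg_close[OF z1 ell1_dirs(3) \<epsilon>, of v] box_avg_close[OF z2 ell1_dirs(3) \<epsilon>, of v]
      box_avg_close[OF z3 ell1_dirs(3) \<epsilon>, of v] box_avg_close[OF y1 ell1_dirs(2) \<epsilon>, of v]
      box_avg_close[OF x1 ell1_dirs(1) \<epsilon>, of v] box_avg_close[OF x2 ell1_dirs(1) \<epsilon>, of v]
    unfolding mollify_def by linarith
qed

lemma smooth3_mollify:
  assumes f: "Lip1 K f" and b: "bounded (range f)" and \<epsilon>: "0 < \<epsilon>"
  shows "\<exists>gy gxx. smooth3 K (2 * K / \<epsilon>) (4 * K / \<epsilon>\<^sup>2) (mollify \<epsilon> f) gy gxx"
proof -
  let ?X = "box_avg \<epsilon> dir_x" and ?Y = "box_avg \<epsilon> dir_y" and ?Z = "box_avg \<epsilon> dir_z"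
  let ?dx = "diff_quot \<epsilon> dir_x" and ?dy = "diff_quot \<epsilon> dir_y" and ?dz = "diff_quot \<epsilon> dir_z"
  let ?z = "?Z (?Z (?Z f))"
  have K2: "2 * (2 * K / \<epsilon>) / \<epsilon> = 4 * K / \<epsilon>\<^sup>2" by (simp add: power2_eq_square)
  note L = box_avg_Lip1 and D = diff_quot_Lip1[OF _ \<epsilon>]
  note zL = L[OF L[OF L[OF f]]]
  have 1: "deriv_along dir_y (mollify \<epsilon> f) (?X (?X (?dy ?z)))"
    unfolding mollify_def
    by (rule deriv_along_box_avg deriv_along_box_avg_own[OF _ \<epsilon>] L D zL)+
  have 2: "Lip1 (2 * K / \<epsilon>) (?X (?X (?dy ?z)))" by (rule L D zL)+
  have 3: "deriv_along dir_x (mollify \<epsilon> f) (?dx (?X (?Y ?z)))"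
    unfolding mollify_def by (rule deriv_along_box_avg_own[OF _ \<epsilon>] L zL)+
  have 4: "Lip1 (2 * K / \<epsilon>) (?dx (?X (?Y ?z)))" by (rule L D zL)+
  have 5: "deriv_along dir_x (?dx (?X (?Y ?z))) (?dx (?dx (?Y ?z)))"
    by (rule deriv_along_diff_quot deriv_along_box_avg_own[OF _ \<epsilon>] L zL)+
  have 6: "Lip1 (4 * K / \<epsilon>\<^sup>2) (?dx (?dx (?Y ?z)))"
    unfolding K2[symmetric] by (rule L D zL)+
  have 7: "deriv_along dir_z (mollify \<epsilon> f) (?X (?X (?Y (?dz (?Z (?Z f))))))"
    unfolding mollify_def
    by (rule deriv_along_box_avg_own[OF _ \<epsilon>] deriv_along_box_avg L D f)+
  have 8: "Lip1 (2 * K / \<epsilon>) (?X (?X (?Y (?dz (?Z (?Z f))))))" by (rule L D f)+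
  have 9: "deriv_along dir_z (?X (?X (?Y (?dz (?Z (?Z f)))))) (?X (?X (?Y (?dz (?dz (?Z f))))))"
    by (rule deriv_along_box_avg_own[OF _ \<epsilon>] deriv_along_box_avg deriv_along_diff_quot L D f)+
  have 10: "Lip1 (4 * K / \<epsilon>\<^sup>2) (?X (?X (?Y (?dz (?dz (?Z f))))))"
    unfolding K2[symmetric] by (rule L D f)+
  have 11: "deriv_along dir_z (?X (?X (?Y (?dz (?dz (?Z f)))))) (?X (?X (?Y (?dz (?dz (?dz f))))))"
    by (rule deriv_along_box_avg_own[OF _ \<epsilon>] deriv_along_box_avg deriv_along_diff_quot L D f)+
  have 12: "Lip1 (2 * (2 * (2 * K / \<epsilon>) / \<epsilon>) / \<epsilon>) (?X (?X (?Y (?dz (?dz (?dz f))))))"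
    by (rule L D f)+
  have 13: "bounded (range (?X (?X (?Y (?dz (?dz (?dz f)))))))"
    by (rule bounded_range_realI, rule deriv_along_abs_le[OF 11 10]) simp
  show ?thesis
    unfolding smooth3_def
    using mollify_bounded[OF f b] mollify_Lip1[OF f] 1 2 3 is_LipI[OF 4] 5 6 7 8 9 10 11
      Lip1_continuous_on[OF 12, of UNIV] 13 by blast
qed


section \<open>Comparison of two step sizes\<close>

lemma box_avg_Riemann:
  assumes f: "Lip1 K f" "ell1 b = 1" "0 \<le> \<epsilon>" and N: "0 < N"
  shows "\<bar>box_avg \<epsilon> b f v - (\<Sum>i<N. (1 / real N) * f (v + (\<epsilon> * (real i / real N)) *\<^sub>R b))\<bar> \<le> K * \<epsilon> / real N"
proof -
  let ?g = "\<lambda>s. f (v + (\<epsilon> * s) *\<^sub>R b)"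
  have K: "0 \<le> K" using f(1) by (rule Lip1_nonneg)
  have int: "?g integrable_on {c..d}" for c d :: real by (rule Lip1_segment_integrable[OF f(1)])
  have "\<bar>integral {0..real m / real N} ?g - (\<Sum>i<m. (1 / real N) * ?g (real i / real N))\<bar>
      \<le> real m * (K * \<epsilon> / real N * (1 / real N))" for m
  proof (induction m)
    case (Suc m)
    let ?a = "real m / real N" and ?b = "real (Suc m) / real N"
    have ab: "?a \<le> ?b" "?b - ?a = 1 / real N" using N by (auto simp: field_simps)
    have "integral {0..?b} ?g = integral {0..?a} ?g + integral {?a..?b} ?g"
      using ab N by (intro Henstock_Kurzweil_Integration.integral_combine[symmetric] int) auto
    moreover have "\<bar>integral {?a..?b} ?g - (1 / real N) * ?g ?a\<bar> \<le> K * \<epsilon> / real N * (1 / real N)"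
    proof -
      have "integral {?a..?b} ?g - (1 / real N) * ?g ?a = integral {?a..?b} (\<lambda>s. ?g s - ?g ?a)"
        using ab int by (subst Henstock_Kurzweil_Integration.integral_diff) auto
      also have "norm \<dots> \<le> K * \<epsilon> / real N * (?b - ?a)"
      proof (rule integral_bound[OF ab(1)])
        show "continuous_on {?a..?b} (\<lambda>s. ?g s - ?g ?a)"
          by (intro continuous_on_diff continuous_on_const Lip1_segment_continuous[OF f(1)])
        fix s assume s: "s \<in> {?a..?b}"
        have "\<bar>?g s - ?g ?a\<bar> \<le> K * ell1 ((v + (\<epsilon> * s) *\<^sub>R b) - (v + (\<epsilon> * ?a) *\<^sub>R b))"
          by (rule Lip1D[OF f(1)])
        also have "(v + (\<epsilon> * s) *\<^sub>R b) - (v + (\<epsilon> * ?a) *\<^sub>R b) = (\<epsilon> * (s - ?a)) *\<^sub>R b"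
          by (simp add: right_diff_distrib scaleR_left_diff_distrib)
        also have "K * ell1 \<dots> = K * (\<epsilon> * (s - ?a))" using f(2,3) s by simp
        also have "\<dots> \<le> K * (\<epsilon> * (1 / real N))"
          using K f(3) s ab(2) by (intro mult_left_mono) auto
        finally show "norm (?g s - ?g ?a) \<le> K * \<epsilon> / real N" by simp
      qed
      finally show ?thesis unfolding ab(2) by simp
    qed
    ultimately show ?case using Suc.IH by (simp add: ring_distribs abs_le_iff del: times_divide_eq_left times_divide_eq_right)
  qed simp
  from this[of N] show ?thesis using N by (simp add: box_avg_def)
qed

context scheme
begin

lemma T_sum_shifts_le:
  assumes f: "is_Lip f" and w: "0 \<le> w"
  shows "is_Lip (\<lambda>v. \<Sum>i<m::nat. w * f (v + a i)) \<and> T h (\<lambda>v. \<Sum>i<m. w * f (v + a i)) v \<le> (\<Sum>i<m. w * T h f (v + a i))"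
proof (induction m)
  case (Suc m)
  let ?S = "\<lambda>v. \<Sum>i<m. w * f (v + a i)" and ?t = "\<lambda>v. w * f (v + a m)"
  have Lt: "is_Lip ?t" by (intro is_Lip_cmult is_Lip_shift f)
  have "T h (\<lambda>v. ?S v + ?t v) v \<le> T h ?S v + T h ?t v"
    using Suc Lt by (intro T_add_le) auto
  also have "T h ?t v = w * T h f (v + a m)"
    using T_cmult[OF is_Lip_shift[OF f] w] T_shift by simp
  finally show ?case using Suc Lt is_Lip_add[of ?S ?t] by simp
qed (simp add: is_Lip_const T_const)

text \<open>Jensen's inequality. Riemann sums are positive combinations of translates, for which it is
  subadditivity together with translation invariance.\<close>

lemma T_box_avg_le:
  assumes f: "Lip1 K f" and b: "ell1 b = 1" and \<epsilon>: "0 \<le> \<epsilon>"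
  shows "T h (box_avg \<epsilon> b f) v \<le> box_avg \<epsilon> b (T h f) v"
proof -
  have K: "0 \<le> K" using f by (rule Lip1_nonneg)
  have *: "T h (box_avg \<epsilon> b f) v \<le> box_avg \<epsilon> b (T h f) v + 2 * (K * \<epsilon>) / real N" if N: "0 < N" for N
  proof -
    let ?R = "\<lambda>f v. \<Sum>i<N. (1 / real N) * f (v + (\<epsilon> * (real i / real N)) *\<^sub>R b)"
    note R = T_sum_shifts_le[OF is_LipI[OF f], where w = "1 / real N" and m = N and h = h
        and a = "\<lambda>i. (\<epsilon> * (real i / real N)) *\<^sub>R b"]
    have "\<bar>T h (box_avg \<epsilon> b f) v - T h (?R f) v\<bar> \<le> K * \<epsilon> / real N"
    proof (rule T_contraction)
      show "is_Lip (box_avg \<epsilon> b f)" using box_avg_Lip1[OF f] by (rule is_LipI)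
      show "is_Lip (?R f)" using R by simp
      show "\<bar>box_avg \<epsilon> b f v - ?R f v\<bar> \<le> K * \<epsilon> / real N" for v
        by (rule box_avg_Riemann[OF f b \<epsilon> N])
    qed
    moreover have "T h (?R f) v \<le> ?R (T h f) v" using R[of v] by simp
    moreover have "\<bar>box_avg \<epsilon> b (T h f) v - ?R (T h f) v\<bar> \<le> K * \<epsilon> / real N"
      by (rule box_avg_Riemann[OF T_Lip1[OF f] b \<epsilon> N])
    ultimately show ?thesis by (simp only: mult_2 add_divide_distrib)
  qed
  have "(\<lambda>N. 2 * (K * \<epsilon>) / real N) \<longlonglongrightarrow> 0" by (rule lim_const_over_n)
  then have "(\<lambda>N. box_avg \<epsilon> b (T h f) v + 2 * (K * \<epsilon>) / real N) \<longlonglongrightarrow> box_avg \<epsilon> b (T h f) v + 0"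
    by (intro tendsto_add tendsto_const)
  then have "T h (box_avg \<epsilon> b f) v \<le> box_avg \<epsilon> b (T h f) v + 0"
    by (rule tendsto_lowerbound) (use * in \<open>auto intro!: eventually_sequentiallyI[of 1]\<close>)
  then show ?thesis by simp
qed

lemma T_mollify_le:
  assumes f: "Lip1 K f" and \<epsilon>: "0 \<le> \<epsilon>"
  shows "T h (mollify \<epsilon> f) v \<le> mollify \<epsilon> (T h f) v"
proof -
  have le: "T h (box_avg \<epsilon> b F) v \<le> box_avg \<epsilon> b G v"
    if F: "Lip1 K F" "Lip1 K G" and FG: "\<And>v. T h F v \<le> G v" and b: "ell1 b = 1" for F G b v
  proof -
    have "T h (box_avg \<epsilon> b F) v \<le> box_avg \<epsilon> b (T h F) v" by (rule T_box_avg_le[OF F(1) b \<epsilon>])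
    also have "\<dots> \<le> box_avg \<epsilon> b G v" by (rule box_avg_mono[OF T_Lip1[OF F(1)] F(2) FG])
    finally show ?thesis .
  qed
  show ?thesis
    unfolding mollify_def by (intro le box_avg_Lip1 T_Lip1 f ell1_dirs order_refl)
qed

lemma Tn_mollify_le:
  assumes f: "Lip1 K f" and \<epsilon>: "0 \<le> \<epsilon>"
  shows "(T h ^^ n) (mollify \<epsilon> f) v \<le> mollify \<epsilon> ((T h ^^ n) f) v"
proof (induction n arbitrary: v)
  case (Suc n)
  have "(T h ^^ Suc n) (mollify \<epsilon> f) v \<le> T h (mollify \<epsilon> ((T h ^^ n) f)) v"
    using Suc is_LipI[OF mollify_Lip1[OF f]] is_LipI[OF mollify_Lip1[OF Tn_Lip1[OF f]]]
    by (auto intro!: T_mono Tn_is_Lip)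
  also have "\<dots> \<le> mollify \<epsilon> ((T h ^^ Suc n) f) v"
    using T_mollify_le[OF Tn_Lip1[OF f] \<epsilon>] by simp
  finally show ?case .
qed simp

lemma Tn_bounded:
  assumes "Lip1 K f" "\<And>v. \<bar>f v\<bar> \<le> B"
  shows "\<bar>(T h ^^ n) f v\<bar> \<le> B"
  using Tn_contraction[OF is_LipI[OF assms(1)] is_Lip_const[of 0], of B n h v] assms(2)
  by (simp add: Tn_const)

text \<open>Mollification commutes with the schemes up to an inequality only, but this suffices: in each round
  the first scheme is replaced by the second one on a mollified function, and the mollification is
  then pulled out by Jensen's inequality for the second scheme. Exchanging the schemes gives the
  reverse estimate.\<close>

lemma scheme_comparison:
  assumes \<phi>: "Lip1 K \<phi>" and B: "\<And>v. \<bar>\<phi> v\<bar> \<le> B" and \<epsilon>: "0 \<le> \<epsilon>"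
    and close: "\<And>f v. Lip1 K f \<Longrightarrow> bounded (range f) \<Longrightarrow>
      (T h\<^sub>1 ^^ m\<^sub>1) (mollify \<epsilon> f) v \<le> (T h\<^sub>2 ^^ m\<^sub>2) (mollify \<epsilon> f) v + d"
  shows "(T h\<^sub>1 ^^ (m\<^sub>1 * n)) \<phi> v \<le> (T h\<^sub>2 ^^ (m\<^sub>2 * n)) \<phi> v + 12 * K * \<epsilon> + real n * d"
proof -
  let ?f = "\<lambda>k. (T h\<^sub>2 ^^ (m\<^sub>2 * k)) \<phi>"
  have Lf: "Lip1 K (?f k)" for k by (rule Tn_Lip1[OF \<phi>])
  have Lm: "is_Lip (mollify \<epsilon> (?f k))" for k by (rule is_LipI[OF mollify_Lip1[OF Lf]])
  have main: "(T h\<^sub>1 ^^ (m\<^sub>1 * k)) (mollify \<epsilon> \<phi>) v \<le> mollify \<epsilon> (?f k) v + real k * d" for k v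
  proof (induction k arbitrary: v)
    case (Suc k)
    have "(T h\<^sub>1 ^^ (m\<^sub>1 * Suc k)) (mollify \<epsilon> \<phi>) v = (T h\<^sub>1 ^^ m\<^sub>1) ((T h\<^sub>1 ^^ (m\<^sub>1 * k)) (mollify \<epsilon> \<phi>)) v"
      by (simp add: funpow_add)
    also have "\<dots> \<le> (T h\<^sub>1 ^^ m\<^sub>1) (mollify \<epsilon> (?f k)) v + real k * d"
      by (intro Tn_le_add_const Tn_is_Lip Lm Suc.IH) (use Lm[of 0] in simp)
    also have "(T h\<^sub>1 ^^ m\<^sub>1) (mollify \<epsilon> (?f k)) v \<le> (T h\<^sub>2 ^^ m\<^sub>2) (mollify \<epsilon> (?f k)) v + d"
      by (intro close Lf bounded_range_realI[of _ B] Tn_bounded[OF \<phi> B])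
    also have "(T h\<^sub>2 ^^ m\<^sub>2) (mollify \<epsilon> (?f k)) v \<le> mollify \<epsilon> ((T h\<^sub>2 ^^ m\<^sub>2) (?f k)) v"
      by (rule Tn_mollify_le[OF Lf \<epsilon>])
    also have "(T h\<^sub>2 ^^ m\<^sub>2) (?f k) = ?f (Suc k)" by (simp add: funpow_add)
    finally show ?case by (simp add: algebra_simps)
  qed simp
  have "(T h\<^sub>1 ^^ (m\<^sub>1 * n)) \<phi> v \<le> (T h\<^sub>1 ^^ (m\<^sub>1 * n)) (mollify \<epsilon> \<phi>) v + 6 * K * \<epsilon>"
  proof (rule Tn_le_add_const[OF is_LipI[OF \<phi>]])
    show "is_Lip (mollify \<epsilon> \<phi>)" using Lm[of 0] by simp
    show "\<phi> v \<le> mollify \<epsilon> \<phi> v + 6 * K * \<epsilon>" for v using mollify_close[OF \<phi> \<epsilon>, of v] by linarith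
  qed
  moreover have "mollify \<epsilon> (?f n) v \<le> ?f n v + 6 * K * \<epsilon>"
    using mollify_close[OF Lf \<epsilon>, of n v] by linarith
  ultimately show ?thesis using main[of n v] by linarith
qed

end

context consistent_scheme
begin

lemma step_error_mono:
  assumes "0 \<le> N1" "0 \<le> N2" "0 \<le> N3" "0 < h'" "h' \<le> h"
  shows "step_error N1 N2 N3 h' \<le> step_error N1 N2 N3 h"
  unfolding step_error_def using assms c_nonneg q0_pos alpha
  by (intro add_mono mult_left_mono powr_mono2 real_sqrt_le_mono mult_nonneg_nonneg add_nonneg_nonneg) auto

text \<open>The consistency errors of one step \<open>h\<close> and of \<open>m\<close> steps \<open>h / m\<close> for a \<open>K\<close>-Lipschitz function that is
  mollified at scale \<open>\<epsilon>\<close>.\<close>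

definition refinement_error :: "real \<Rightarrow> real \<Rightarrow> real \<Rightarrow> real" where
  "refinement_error K \<epsilon> h = 2 * step_error K (2 * K / \<epsilon>) (4 * K / \<epsilon>\<^sup>2) h
     + (2 * c + 2 * M) * (2 * K / \<epsilon> + 4 * K / \<epsilon>\<^sup>2) * (Omega * sqrt h)"

lemma refinement_one_step:
  assumes f: "Lip1 K f" "bounded (range f)" and \<epsilon>: "0 < \<epsilon>" and h: "0 < h" "h \<le> 1" and m: "1 \<le> m"
  shows "\<bar>T h (mollify \<epsilon> f) v - (T (h / real m) ^^ m) (mollify \<epsilon> f) v\<bar> \<le> h * refinement_error K \<epsilon> h"
proof -
  obtain gy gxx where g: "smooth3 K (2 * K / \<epsilon>) (4 * K / \<epsilon>\<^sup>2) (mollify \<epsilon> f) gy gxx"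
    using smooth3_mollify[OF f \<epsilon>] by blast
  let ?e = "step_error K (2 * K / \<epsilon>) (4 * K / \<epsilon>\<^sup>2)"
  let ?L = "(2 * c + 2 * M) * (2 * K / \<epsilon> + 4 * K / \<epsilon>\<^sup>2) * (Omega * sqrt h)"
  have K: "0 \<le> K" using f(1) by (rule Lip1_nonneg)
  have h': "0 < h / real m" "h / real m \<le> h" "real m * (h / real m) = h"
    using h m by (auto simp: field_simps)
  have "\<bar>T h (mollify \<epsilon> f) v - mollify \<epsilon> f v - h * Gen (mollify \<epsilon> f) gy gxx v\<bar> \<le> h * ?e h"
    by (rule step_consistent[OF g h])
  moreover have "\<bar>(T (h / real m) ^^ m) (mollify \<epsilon> f) v - mollify \<epsilon> f v - h * Gen (mollify \<epsilon> f) gy gxx v\<bar>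
      \<le> h * (?e (h / real m) + ?L)"
    using steps_consistent[OF g h'(1), of m v] h h' by simp
  moreover have "h * (?e (h / real m) + ?L) \<le> h * (?e h + ?L)"
    using h h' K \<epsilon> by (intro mult_left_mono add_right_mono step_error_mono) auto
  moreover have "h * refinement_error K \<epsilon> h = h * ?e h + h * (?e h + ?L)"
    by (simp add: refinement_error_def algebra_simps)
  ultimately show ?thesis by linarith
qed

lemma refinement:
  assumes \<phi>: "Lip1 K \<phi>" "bounded (range \<phi>)" and \<epsilon>: "0 < \<epsilon>" and h: "0 < h" "h \<le> 1" and m: "1 \<le> m"
  shows "\<bar>(T h ^^ n) \<phi> v - (T (h / real m) ^^ (m * n)) \<phi> v\<bar>
    \<le> 12 * K * \<epsilon> + real n * (h * refinement_error K \<epsilon> h)"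
proof -
  obtain B where B: "\<And>v. \<bar>\<phi> v\<bar> \<le> B" using \<phi>(2) by (auto simp: bounded_iff)
  have \<epsilon>0: "0 \<le> \<epsilon>" using \<epsilon> by simp
  have "(T h ^^ (1 * n)) \<phi> v \<le> (T (h / real m) ^^ (m * n)) \<phi> v + 12 * K * \<epsilon> + real n * (h * refinement_error K \<epsilon> h)"
  proof (rule scheme_comparison[OF \<phi>(1) B \<epsilon>0])
    fix f v assume "Lip1 K f" "bounded (range f)"
    from refinement_one_step[OF this \<epsilon> h m, of v]
    show "(T h ^^ 1) (mollify \<epsilon> f) v \<le> (T (h / real m) ^^ m) (mollify \<epsilon> f) v + h * refinement_error K \<epsilon> h"
      by (simp add: abs_le_iff)
  qed
  moreover have "(T (h / real m) ^^ (m * n)) \<phi> v \<le> (T h ^^ (1 * n)) \<phi> v + 12 * K * \<epsilon> + real n * (h * refinement_error K \<epsilon> h)"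
  proof (rule scheme_comparison[OF \<phi>(1) B \<epsilon>0])
    fix f v assume "Lip1 K f" "bounded (range f)"
    from refinement_one_step[OF this \<epsilon> h m, of v]
    show "(T (h / real m) ^^ m) (mollify \<epsilon> f) v \<le> (T h ^^ 1) (mollify \<epsilon> f) v + h * refinement_error K \<epsilon> h"
      by (simp add: abs_le_iff)
  qed
  ultimately show ?thesis by (simp add: abs_le_iff)
qed

definition rate_const :: real where
  "rate_const = 12 + 48 * M\<^sup>2 + 10 * c + 12 * (c + M) * Omega"

text \<open>The mollification error is of order \<open>\<epsilon>\<close>, and the consistency errors relative to \<open>h\<close> are of the orders
  \<open>sqrt h / \<epsilon>\<^sup>2\<close>, \<open>h powr q\<^sub>0 / \<epsilon>\<close> and \<open>h powr ((2 - \<alpha>) / \<alpha>) / \<epsilon>\<close>. For \<open>\<epsilon> = h powr r\<close> the conditions on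
  \<open>r\<close> say that none of them exceeds \<open>\<epsilon>\<close>.\<close>

lemma refinement_rate:
  assumes \<phi>: "Lip1 K \<phi>" "bounded (range \<phi>)" and h: "0 < h" "h \<le> 1" "real n * h \<le> 1" and m: "1 \<le> m"
    and r: "0 < r" "3 * r \<le> 1/2" "2 * r \<le> q\<^sub>0" "2 * r \<le> (2 - \<alpha>) / \<alpha>"
  shows "\<bar>(T h ^^ n) \<phi> v - (T (h / real m) ^^ (m * n)) \<phi> v\<bar> \<le> K * rate_const * h powr r"
proof -
  have K: "0 \<le> K" using \<phi>(1) by (rule Lip1_nonneg)
  define \<epsilon> where "\<epsilon> = h powr r"
  have \<epsilon>: "0 < \<epsilon>" "\<epsilon> \<le> 1" using h r by (auto simp: \<epsilon>_def powr_le1)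
  have e1: "h powr a / \<epsilon> \<le> \<epsilon>" if "2 * r \<le> a" for a
  proof -
    have "h powr a / \<epsilon> = h powr (a - r)" by (simp add: \<epsilon>_def powr_diff)
    also have "\<dots> \<le> h powr r" using h that by (intro powr_mono') auto
    finally show ?thesis by (simp add: \<epsilon>_def)
  qed
  have e2: "sqrt h / \<epsilon>\<^sup>2 \<le> \<epsilon>"
  proof -
    have "sqrt h / \<epsilon>\<^sup>2 = h powr (1/2 - 2 * r)"
      using h by (simp add: \<epsilon>_def powr_diff powr_half_sqrt powr_power mult.commute)
    also have "\<dots> \<le> h powr r" using h r by (intro powr_mono') auto
    finally show ?thesis by (simp add: \<epsilon>_def)
  qed
  have inv: "1 / \<epsilon> \<le> 1 / \<epsilon>\<^sup>2" "1 \<le> 1 / \<epsilon>"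
    using \<epsilon> by (auto simp: field_simps power2_eq_square)
  have n1: "K + 2 * K / \<epsilon> \<le> 3 * K * (1 / \<epsilon>)"
  proof -
    have "K \<le> K / \<epsilon>" using mult_left_mono[OF inv(2) K] by simp
    moreover have "3 * K * (1 / \<epsilon>) = K / \<epsilon> + 2 * K / \<epsilon>" by (simp flip: add_divide_distrib)
    ultimately show ?thesis by linarith
  qed
  have n2: "2 * K / \<epsilon> + 4 * K / \<epsilon>\<^sup>2 \<le> 6 * K * (1 / \<epsilon>\<^sup>2)"
  proof -
    have "2 * K / \<epsilon> \<le> 2 * K / \<epsilon>\<^sup>2" using mult_left_mono[OF inv(1), of "2 * K"] K by simp
    moreover have "6 * K * (1 / \<epsilon>\<^sup>2) = 2 * K / \<epsilon>\<^sup>2 + 4 * K / \<epsilon>\<^sup>2" by (simp flip: add_divide_distrib)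
    ultimately show ?thesis by linarith
  qed
  have s: "(2 * K / \<epsilon> + 4 * K / \<epsilon>\<^sup>2) * sqrt h \<le> 6 * K * \<epsilon>"
  proof -
    have "(2 * K / \<epsilon> + 4 * K / \<epsilon>\<^sup>2) * sqrt h \<le> (6 * K * (1 / \<epsilon>\<^sup>2)) * sqrt h"
      using n2 h by (intro mult_right_mono) auto
    also have "\<dots> = 6 * K * (sqrt h / \<epsilon>\<^sup>2)" by simp
    also have "\<dots> \<le> 6 * K * \<epsilon>" using e2 K by (intro mult_left_mono) auto
    finally show ?thesis .
  qed
  have a: "(K + 2 * K / \<epsilon>) * h powr q\<^sub>0 \<le> 3 * K * \<epsilon>"
  proof -
    have "(K + 2 * K / \<epsilon>) * h powr q\<^sub>0 \<le> (3 * K * (1 / \<epsilon>)) * h powr q\<^sub>0"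
      using n1 by (intro mult_right_mono) auto
    also have "\<dots> = 3 * K * (h powr q\<^sub>0 / \<epsilon>)" by simp
    also have "\<dots> \<le> 3 * K * \<epsilon>" using e1[OF r(3)] K by (intro mult_left_mono) auto
    finally show ?thesis .
  qed
  have b: "2 * K / \<epsilon> * h powr ((2 - \<alpha>) / \<alpha>) \<le> 2 * K * \<epsilon>"
    using mult_left_mono[OF e1[OF r(4)], of "2 * K"] K by (simp add: mult_ac)
  have e: "step_error K (2 * K / \<epsilon>) (4 * K / \<epsilon>\<^sup>2) h \<le> K * \<epsilon> * (24 * M\<^sup>2 + 5 * c)"
  proof -
    have "step_error K (2 * K / \<epsilon>) (4 * K / \<epsilon>\<^sup>2) h
        = 4 * M\<^sup>2 * ((2 * K / \<epsilon> + 4 * K / \<epsilon>\<^sup>2) * sqrt h)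
          + c * ((K + 2 * K / \<epsilon>) * h powr q\<^sub>0 + 2 * K / \<epsilon> * h powr ((2 - \<alpha>) / \<alpha>))"
      by (simp only: step_error_def mult.assoc)
    also have "\<dots> \<le> 4 * M\<^sup>2 * (6 * K * \<epsilon>) + c * (3 * K * \<epsilon> + 2 * K * \<epsilon>)"
      using s a b c_nonneg by (intro add_mono mult_left_mono) auto
    also have "\<dots> = K * \<epsilon> * (24 * M\<^sup>2 + 5 * c)" by (simp add: algebra_simps)
    finally show ?thesis .
  qed
  have l: "(2 * c + 2 * M) * (2 * K / \<epsilon> + 4 * K / \<epsilon>\<^sup>2) * (Omega * sqrt h) \<le> K * \<epsilon> * (12 * (c + M) * Omega)"
  proof -
    have "(2 * c + 2 * M) * (2 * K / \<epsilon> + 4 * K / \<epsilon>\<^sup>2) * (Omega * sqrt h)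
        = (2 * c + 2 * M) * Omega * ((2 * K / \<epsilon> + 4 * K / \<epsilon>\<^sup>2) * sqrt h)" by (simp only: mult_ac)
    also have "\<dots> \<le> (2 * c + 2 * M) * Omega * (6 * K * \<epsilon>)"
      using s c_nonneg M_ge_1 Omega_ge_1 by (intro mult_left_mono) auto
    also have "\<dots> = K * \<epsilon> * (12 * (c + M) * Omega)" by (simp add: algebra_simps)
    finally show ?thesis .
  qed
  define R where "R = K * \<epsilon> * (48 * M\<^sup>2 + 10 * c + 12 * (c + M) * Omega)"
  have R0: "0 \<le> R" unfolding R_def using K \<epsilon> c_nonneg M_ge_1 Omega_ge_1 by (intro mult_nonneg_nonneg add_nonneg_nonneg) auto
  have R: "refinement_error K \<epsilon> h \<le> R"
    using e l unfolding refinement_error_def R_def by (simp add: algebra_simps)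
  have "\<bar>(T h ^^ n) \<phi> v - (T (h / real m) ^^ (m * n)) \<phi> v\<bar> \<le> 12 * K * \<epsilon> + real n * (h * refinement_error K \<epsilon> h)"
    by (rule refinement[OF \<phi> \<epsilon>(1) h(1,2) m])
  also have "real n * (h * refinement_error K \<epsilon> h) \<le> real n * (h * R)"
    using R h by (intro mult_left_mono) auto
  also have "real n * (h * R) = (real n * h) * R" by simp
  also have "\<dots> \<le> 1 * R" using h R0 by (intro mult_right_mono) auto
  also have "12 * K * \<epsilon> + 1 * R = K * rate_const * h powr r"
    by (simp add: R_def rate_const_def \<epsilon>_def algebra_simps)
  finally show ?thesis by simp
qed

end

section \<open>Slices of test functions\<close>

lemma has_real_derivative_vector_derivative:
  fixes f :: "real \<Rightarrow> real"
  assumes "f differentiable (at x within S)"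
  shows "(f has_real_derivative vector_derivative f (at x within S)) (at x within S)"
  using assms vector_derivative_works has_real_derivative_iff_has_vector_derivative by blast

lemma C_b_along_bound: "C_b_along S B m f \<Longrightarrow> \<exists>C. \<forall>v\<in>S. \<bar>f v\<bar> \<le> C"
  by (cases m) (auto simp: bounded_iff)

lemma C_b_along_continuous: "C_b_along S B m f \<Longrightarrow> continuous_on S f"
  by (cases m) auto

text \<open>Spatial directions do not leave the domain, so the relative derivative is a two-sided one.\<close>

lemma deriv_along_slice:
  assumes f: "C_b_along PIDE_domain B (Suc m) f" and b: "(0, b) \<in> B" and t: "t \<in> {0<..1}"
  shows "deriv_along b (\<lambda>w. f (t, w)) (\<lambda>w. dir_deriv PIDE_domain (0, b) f (t, w))"
  unfolding deriv_along_def
proof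
  fix w :: R3
  have all: "{s. (t, w) + s *\<^sub>R (0, b) \<in> PIDE_domain} = UNIV" using t by (auto simp: PIDE_domain_def)
  have "(t, w) \<in> PIDE_domain" using t by (simp add: PIDE_domain_def)
  then have "(\<lambda>s. f ((t, w) + s *\<^sub>R (0, b))) differentiable (at 0 within {s. (t, w) + s *\<^sub>R (0, b) \<in> PIDE_domain})"
    using f b unfolding C_b_along.simps by blast
  from has_real_derivative_vector_derivative[OF this]
  show "((\<lambda>s. f (t, w + s *\<^sub>R b)) has_real_derivative dir_deriv PIDE_domain (0, b) f (t, w)) (at 0)"
    unfolding dir_deriv_def all by simp
qed

lemma Lip1_of_bounded_derivs:
  assumes x: "deriv_along dir_x F Fx" "\<And>v. \<bar>Fx v\<bar> \<le> C"
    and y: "deriv_along dir_y F Fy" "\<And>v. \<bar>Fy v\<bar> \<le> C"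
    and z: "deriv_along dir_z F Fz" "\<And>v. \<bar>Fz v\<bar> \<le> C"
  shows "Lip1 C F"
  unfolding Lip1_def
proof (intro conjI allI)
  show "0 \<le> C" using x(2) abs_ge_zero order_trans by blast
  have inc: "\<bar>F (v + a *\<^sub>R b) - F v\<bar> \<le> C * \<bar>a\<bar>"
    if "deriv_along b F F'" "\<And>v. \<bar>F' v\<bar> \<le> C" for b F' v a
    using real_increment_le[of "\<lambda>s. F (v + s *\<^sub>R b)" "\<lambda>s. F' (v + s *\<^sub>R b)" a C] deriv_along_at[OF that(1)] that(2)
    by simp
  fix v w :: R3
  obtain x1 y1 z1 x2 y2 z2 where vw: "v = (x1, y1, z1)" "w = (x2, y2, z2)" by (cases v, cases w) auto
  have "\<bar>F (x1, y1, z1) - F (x2, y1, z1)\<bar> \<le> C * \<bar>x1 - x2\<bar>"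
    using inc[OF x, of "(x2, y1, z1)" "x1 - x2"] by (simp add: dir_x_def)
  moreover have "\<bar>F (x2, y1, z1) - F (x2, y2, z1)\<bar> \<le> C * \<bar>y1 - y2\<bar>"
    using inc[OF y, of "(x2, y2, z1)" "y1 - y2"] by (simp add: dir_y_def)
  moreover have "\<bar>F (x2, y2, z1) - F (x2, y2, z2)\<bar> \<le> C * \<bar>z1 - z2\<bar>"
    using inc[OF z, of "(x2, y2, z2)" "z1 - z2"] by (simp add: dir_z_def)
  ultimately show "\<bar>F v - F w\<bar> \<le> C * ell1 (v - w)"
    by (simp add: vw distrib_left) linarith
qed

lemma e_t_eq: "e_t = (1, 0)"
  by (simp add: e_t_def zero_prod_def)

lemma e_dirs: "e_x = (0, dir_x)" "e_y = (0, dir_y)" "e_z = (0, dir_z)"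
  by (simp_all add: e_x_def e_y_def e_z_def dir_x_def dir_y_def dir_z_def)

lemma slice_Lip1:
  assumes f: "C_b_along PIDE_domain {e_x, e_y, e_z} (Suc m) f" and t: "t \<in> {0<..1}"
  shows "\<exists>C. Lip1 C (\<lambda>w. f (t, w))"
proof -
  let ?D = "\<lambda>b. dir_deriv PIDE_domain b f"
  have "C_b_along PIDE_domain {e_x, e_y, e_z} m (?D b)" if "b \<in> {e_x, e_y, e_z}" for b
    using f that by auto
  then have "\<exists>C. \<forall>v\<in>PIDE_domain. \<bar>?D e_x v\<bar> \<le> C" "\<exists>C. \<forall>v\<in>PIDE_domain. \<bar>?D e_y v\<bar> \<le> C"
      "\<exists>C. \<forall>v\<in>PIDE_domain. \<bar>?D e_z v\<bar> \<le> C"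
    using C_b_along_bound by blast+
  then obtain C1 C2 C3 where "\<forall>v\<in>PIDE_domain. \<bar>?D e_x v\<bar> \<le> C1"
      "\<forall>v\<in>PIDE_domain. \<bar>?D e_y v\<bar> \<le> C2" "\<forall>v\<in>PIDE_domain. \<bar>?D e_z v\<bar> \<le> C3"
    by blast
  then have C: "\<And>v. v \<in> PIDE_domain \<Longrightarrow> \<bar>?D e_x v\<bar> \<le> C1"
      "\<And>v. v \<in> PIDE_domain \<Longrightarrow> \<bar>?D e_y v\<bar> \<le> C2" "\<And>v. v \<in> PIDE_domain \<Longrightarrow> \<bar>?D e_z v\<bar> \<le> C3"
    by blast+
  let ?C = "max C1 (max C2 C3)"
  have dom: "(t, w) \<in> PIDE_domain" for w using t by (simp add: PIDE_domain_def)
  have b: "\<bar>?D e_x (t, w)\<bar> \<le> ?C" "\<bar>?D e_y (t, w)\<bar> \<le> ?C" "\<bar>?D e_z (t, w)\<bar> \<le> ?C" for w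
    using C(1)[OF dom[of w]] C(2)[OF dom[of w]] C(3)[OF dom[of w]] by auto
  have d: "deriv_along dir_x (\<lambda>w. f (t, w)) (\<lambda>w. ?D e_x (t, w))"
    "deriv_along dir_y (\<lambda>w. f (t, w)) (\<lambda>w. ?D e_y (t, w))"
    "deriv_along dir_z (\<lambda>w. f (t, w)) (\<lambda>w. ?D e_z (t, w))"
    unfolding e_dirs by (rule deriv_along_slice[OF f _ t], simp add: e_dirs)+
  have "Lip1 ?C (\<lambda>w. f (t, w))"
    by (rule Lip1_of_bounded_derivs[OF d(1) b(1) d(2) b(2) d(3) b(3)])
  then show ?thesis by blast
qed

lemma smooth3_slice:
  assumes \<psi>: "C_b_along PIDE_domain {e_x, e_y, e_z} 3 \<psi>" and t: "t \<in> {0<..1}"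
  shows "\<exists>N1 N2 N3. smooth3 N1 N2 N3 (\<lambda>w. \<psi> (t, w)) (\<lambda>w. dir_deriv PIDE_domain e_y \<psi> (t, w))
    (\<lambda>w. dir_deriv PIDE_domain e_x (dir_deriv PIDE_domain e_x \<psi>) (t, w))"
proof -
  let ?B = "{e_x, e_y, e_z}" and ?S = PIDE_domain
  let ?D = "\<lambda>b f. dir_deriv PIDE_domain b f"
  have sub: "C_b_along ?S ?B m (?D b f)" if "C_b_along ?S ?B (Suc m) f" "b \<in> ?B" for m f b
    using that by auto
  have c3: "C_b_along ?S ?B (Suc (Suc (Suc 0))) \<psi>" using \<psi> by (simp only: numeral_3_eq_3)
  have cx: "C_b_along ?S ?B (Suc (Suc 0)) (?D e_x \<psi>)" and cy: "C_b_along ?S ?B (Suc (Suc 0)) (?D e_y \<psi>)"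
    and cz: "C_b_along ?S ?B (Suc (Suc 0)) (?D e_z \<psi>)"
    by (rule sub[OF c3], simp)+
  have cxx: "C_b_along ?S ?B (Suc 0) (?D e_x (?D e_x \<psi>))" by (rule sub[OF cx]) simp
  have czz: "C_b_along ?S ?B (Suc 0) (?D e_z (?D e_z \<psi>))" by (rule sub[OF cz]) simp
  have czzz: "C_b_along ?S ?B 0 (?D e_z (?D e_z (?D e_z \<psi>)))" by (rule sub[OF czz]) simp
  note L = slice_Lip1[OF _ t]
  obtain A1 where A1: "Lip1 A1 (\<lambda>w. \<psi> (t, w))" using L[OF c3] by blast
  obtain Ax where Ax: "Lip1 Ax (\<lambda>w. ?D e_x \<psi> (t, w))" using L[OF cx] by blast
  obtain Ay where Ay: "Lip1 Ay (\<lambda>w. ?D e_y \<psi> (t, w))" using L[OF cy] by blast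
  obtain Az where Az: "Lip1 Az (\<lambda>w. ?D e_z \<psi> (t, w))" using L[OF cz] by blast
  obtain Axx where Axx: "Lip1 Axx (\<lambda>w. ?D e_x (?D e_x \<psi>) (t, w))" using L[OF cxx] by blast
  obtain Azz where Azz: "Lip1 Azz (\<lambda>w. ?D e_z (?D e_z \<psi>) (t, w))" using L[OF czz] by blast
  have d: "deriv_along dir_x (\<lambda>w. \<psi> (t, w)) (\<lambda>w. ?D e_x \<psi> (t, w))"
    "deriv_along dir_y (\<lambda>w. \<psi> (t, w)) (\<lambda>w. ?D e_y \<psi> (t, w))"
    "deriv_along dir_z (\<lambda>w. \<psi> (t, w)) (\<lambda>w. ?D e_z \<psi> (t, w))"
    unfolding e_dirs by (rule deriv_along_slice[OF c3 _ t], simp add: e_dirs)+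
  have dxx: "deriv_along dir_x (\<lambda>w. ?D e_x \<psi> (t, w)) (\<lambda>w. ?D e_x (?D e_x \<psi>) (t, w))"
    unfolding e_dirs(1) by (rule deriv_along_slice[OF cx[unfolded e_dirs(1)] _ t]) simp
  have dzz: "deriv_along dir_z (\<lambda>w. ?D e_z \<psi> (t, w)) (\<lambda>w. ?D e_z (?D e_z \<psi>) (t, w))"
    unfolding e_dirs(3) by (rule deriv_along_slice[OF cz[unfolded e_dirs(3)] _ t]) simp
  have dzzz: "deriv_along dir_z (\<lambda>w. ?D e_z (?D e_z \<psi>) (t, w)) (\<lambda>w. ?D e_z (?D e_z (?D e_z \<psi>)) (t, w))"
    unfolding e_dirs(3) by (rule deriv_along_slice[OF czz[unfolded e_dirs(3)] _ t]) simp
  have dom: "(t, w) \<in> ?S" for w using t by (simp add: PIDE_domain_def)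
  have bnd: "bounded (range (\<lambda>w. f (t, w)))" if f: "C_b_along ?S ?B m f" for f m
  proof -
    obtain C where "\<forall>v\<in>?S. \<bar>f v\<bar> \<le> C" using C_b_along_bound[OF f] by blast
    then show ?thesis using dom by (intro bounded_range_realI[of _ C]) blast
  qed
  have cont: "continuous_on UNIV (\<lambda>w. ?D e_z (?D e_z (?D e_z \<psi>)) (t, w))"
    by (rule continuous_on_compose2[OF C_b_along_continuous[OF czzz]]) (auto intro!: continuous_intros dom)
  have M: "Lip1 (max Ay Az) (\<lambda>w. ?D e_y \<psi> (t, w))" "Lip1 (max Ay Az) (\<lambda>w. ?D e_z \<psi> (t, w))"
    "Lip1 (max Axx Azz) (\<lambda>w. ?D e_x (?D e_x \<psi>) (t, w))" "Lip1 (max Axx Azz) (\<lambda>w. ?D e_z (?D e_z \<psi>) (t, w))"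
    using Lip1_mono[OF Ay, of "max Ay Az"] Lip1_mono[OF Az, of "max Ay Az"]
      Lip1_mono[OF Axx, of "max Axx Azz"] Lip1_mono[OF Azz, of "max Axx Azz"] by simp_all
  have "smooth3 A1 (max Ay Az) (max Axx Azz) (\<lambda>w. \<psi> (t, w)) (\<lambda>w. ?D e_y \<psi> (t, w)) (\<lambda>w. ?D e_x (?D e_x \<psi>) (t, w))"
    unfolding smooth3_def
    by (intro conjI exI, rule bnd[OF c3], rule A1, rule d, rule M, rule M, rule d, rule is_LipI[OF Ax], rule dxx,
        rule d, rule M, rule dzz, rule M, rule dzzz, rule cont, rule bnd[OF czzz])
  then show ?thesis by blast
qed

lemma time_derivative:
  assumes f: "C_b_along PIDE_domain {e_t} (Suc m) f" and t: "t \<in> {0<..1}"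
  shows "((\<lambda>\<tau>. f (\<tau>, w)) has_real_derivative dir_deriv PIDE_domain e_t f (t, w)) (at t within {0<..1})"
proof -
  let ?S = "{s. (t, w) + s *\<^sub>R e_t \<in> PIDE_domain}"
  have S: "(+) t ` ?S = {0<..1}"
  proof
    show "{0<..1} \<subseteq> (+) t ` ?S"
    proof
      fix \<tau> :: real assume "\<tau> \<in> {0<..1}"
      then show "\<tau> \<in> (+) t ` ?S" by (intro image_eqI[of _ _ "\<tau> - t"]) (auto simp: PIDE_domain_def e_t_eq)
    qed
  qed (auto simp: PIDE_domain_def e_t_eq)
  have "(t, w) \<in> PIDE_domain" using t by (simp add: PIDE_domain_def)
  then have "(\<lambda>s. f ((t, w) + s *\<^sub>R e_t)) differentiable (at 0 within ?S)"
    using f unfolding C_b_along.simps by blast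
  from has_real_derivative_vector_derivative[OF this]
  have "((\<lambda>s. f (t + s, w)) has_real_derivative dir_deriv PIDE_domain e_t f (t, w)) (at 0 within ?S)"
    unfolding dir_deriv_def by (simp add: e_t_eq)
  then have "((\<lambda>\<tau>. f (\<tau>, w)) has_real_derivative dir_deriv PIDE_domain e_t f (t, w)) (at (t + 0) within (+) t ` ?S)"
    by (subst DERIV_at_within_shift)
  then show ?thesis unfolding S by simp
qed

lemma time_taylor:
  assumes \<psi>: "C_b_along PIDE_domain {e_t} 2 \<psi>" and t: "t \<in> {0<..1}"
  shows "\<exists>C\<ge>0. \<forall>s w. 0 \<le> s \<longrightarrow> s < t \<longrightarrow>
    \<bar>\<psi> (t - s, w) - \<psi> (t, w) + s * dir_deriv PIDE_domain e_t \<psi> (t, w)\<bar> \<le> C * s\<^sup>2"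
proof -
  let ?d = "dir_deriv PIDE_domain e_t"
  have c2: "C_b_along PIDE_domain {e_t} (Suc (Suc 0)) \<psi>" using \<psi> by (simp only: numeral_2_eq_2)
  then have c1: "C_b_along PIDE_domain {e_t} (Suc 0) (?d \<psi>)" by simp
  then have c0: "C_b_along PIDE_domain {e_t} 0 (?d (?d \<psi>))" by simp
  obtain C where C: "\<And>v. v \<in> PIDE_domain \<Longrightarrow> \<bar>?d (?d \<psi>) v\<bar> \<le> C" using C_b_along_bound[OF c0] by blast
  have C0: "0 \<le> C" using C[of "(t, 0)"] t by (simp add: PIDE_domain_def)
  have "\<bar>\<psi> (t - s, w) - \<psi> (t, w) + s * ?d \<psi> (t, w)\<bar> \<le> C * s\<^sup>2" if s: "0 \<le> s" "s < t" for s w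
  proof -
    have d1: "\<bar>?d \<psi> (\<tau>, w) - ?d \<psi> (t, w)\<bar> \<le> C * \<bar>\<tau> - t\<bar>" if "\<tau> \<in> {0<..1}" for \<tau>
    proof -
      have "norm (?d \<psi> (\<tau>, w) - ?d \<psi> (t, w)) \<le> C * norm (\<tau> - t)"
      proof (rule field_differentiable_bound[where S = "{0<..1::real}" and f' = "\<lambda>\<tau>. ?d (?d \<psi>) (\<tau>, w)"])
        show "((\<lambda>\<tau>. ?d \<psi> (\<tau>, w)) has_real_derivative ?d (?d \<psi>) (z, w)) (at z within {0<..1})"
          if "z \<in> {0<..1}" for z by (rule time_derivative[OF c1 that])
        show "norm (?d (?d \<psi>) (z, w)) \<le> C" if "z \<in> {0<..1}" for z
          using C[of "(z, w)"] that by (simp add: PIDE_domain_def)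
      qed (use that t in auto)
      then show ?thesis by simp
    qed
    let ?F = "\<lambda>\<tau>. \<psi> (\<tau>, w) - \<tau> * ?d \<psi> (t, w)"
    have sub: "{t - s..t} \<subseteq> {0<..1}" using s t by auto
    have "norm (?F (t - s) - ?F t) \<le> (C * s) * norm ((t - s) - t)"
    proof (rule field_differentiable_bound[where S = "{t - s..t}" and f' = "\<lambda>\<tau>. ?d \<psi> (\<tau>, w) - ?d \<psi> (t, w)"])
      fix z assume z: "z \<in> {t - s..t}"
      then have z1: "z \<in> {0<..1}" using sub by blast
      have "((\<lambda>\<tau>. \<psi> (\<tau>, w)) has_real_derivative ?d \<psi> (z, w)) (at z within {t - s..t})"
        using time_derivative[OF c2 z1] sub by (rule DERIV_subset)
      then show "(?F has_real_derivative ?d \<psi> (z, w) - ?d \<psi> (t, w)) (at z within {t - s..t})"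
        by (auto intro!: derivative_eq_intros)
      have "\<bar>?d \<psi> (z, w) - ?d \<psi> (t, w)\<bar> \<le> C * \<bar>z - t\<bar>" by (rule d1[OF z1])
      also have "\<dots> \<le> C * s" using z C0 by (intro mult_left_mono) auto
      finally show "norm (?d \<psi> (z, w) - ?d \<psi> (t, w)) \<le> C * s" by simp
    qed (use s in auto)
    then show ?thesis using s by (simp add: algebra_simps power2_eq_square)
  qed
  then show ?thesis using C0 by blast
qed

text \<open>The time derivative of a test function need not be Lipschitz in space. Away from the base point its
  oscillation is absorbed by a multiple of the distance, to which the displacement bound applies.\<close>

lemma bounded_continuous_linear_modulus:
  fixes f :: "R3 \<Rightarrow> real"
  assumes c: "continuous_on UNIV f" and b: "\<And>w. \<bar>f w\<bar> \<le> B" and \<eta>: "0 < \<eta>"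
  shows "\<exists>C\<ge>0. \<forall>w. \<bar>f w - f v\<bar> \<le> \<eta> + C * ell1 (w - v)"
proof -
  have "isCont f v" using c unfolding continuous_on_eq_continuous_at[OF open_UNIV] by blast
  then obtain d where d: "0 < d" "\<And>w. dist w v < d \<Longrightarrow> dist (f w) (f v) < \<eta>"
    using \<eta> unfolding continuous_at_eps_delta by blast
  have B: "0 \<le> B" using b abs_ge_zero order_trans by blast
  have "\<bar>f w - f v\<bar> \<le> \<eta> + (2 * B / d) * ell1 (w - v)" for w
  proof (cases "dist w v < d")
    case True
    then have "\<bar>f w - f v\<bar> \<le> \<eta>" using d(2)[of w] by (simp add: dist_real_def)
    then show ?thesis using d(1) B by (simp add: add_increasing2)
  next
    case False
    then have "d \<le> ell1 (w - v)" using norm_le_ell1[of "w - v"] by (simp add: dist_norm)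
    then have "2 * B \<le> (2 * B / d) * ell1 (w - v)"
      using d(1) B mult_left_mono[of d "ell1 (w - v)" "2 * B"] by (simp add: field_simps)
    moreover have "\<bar>f w - f v\<bar> \<le> 2 * B" using b[of w] b[of v] by linarith
    ultimately show ?thesis using \<eta> by linarith
  qed
  then show ?thesis using d(1) B by (intro exI[of _ "2 * B / d"]) auto
qed


section \<open>The limit of the scheme\<close>

locale convergent_scheme = consistent_scheme +
  fixes r K B :: real and \<phi> :: "R3 \<Rightarrow> real"
  assumes r: "0 < r" "3 * r \<le> 1/2" "2 * r \<le> q\<^sub>0" "2 * r \<le> (2 - \<alpha>) / \<alpha>"
    and \<phi>_Lip: "Lip1 K \<phi>" and \<phi>_bound: "\<And>v. \<bar>\<phi> v\<bar> \<le> B"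
begin

lemma K_nonneg: "0 \<le> K"
  using \<phi>_Lip by (rule Lip1_nonneg)

definition dyadic_steps :: "nat \<Rightarrow> real \<Rightarrow> nat" where
  "dyadic_steps m t = nat \<lfloor>t * 2 ^ m\<rfloor>"

definition dyadic_scheme :: "nat \<Rightarrow> real \<Rightarrow> R3 \<Rightarrow> real" where
  "dyadic_scheme m t = (T (1 / 2 ^ m) ^^ dyadic_steps m t) \<phi>"

definition solution :: "real \<Rightarrow> R3 \<Rightarrow> real" where
  "solution t v = lim (\<lambda>m. dyadic_scheme m t v)"

text \<open>The first summand is the error of refining the step size, the second one that of rounding the time
  down to the grid.\<close>

definition dyadic_error :: "nat \<Rightarrow> real" where
  "dyadic_error m = K * rate_const * (1 / 2 ^ m) powr r + K * (Omega * sqrt (1 / 2 ^ m))"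

lemma dyadic_steps_bounds:
  assumes "0 \<le> t"
  shows "real (dyadic_steps m t) * (1 / 2 ^ m) \<le> t" "t < real (dyadic_steps m t) * (1 / 2 ^ m) + 1 / 2 ^ m"
proof -
  have "real (dyadic_steps m t) = of_int \<lfloor>t * 2 ^ m\<rfloor>" using assms by (simp add: dyadic_steps_def)
  then have "real (dyadic_steps m t) \<le> t * 2 ^ m" "t * 2 ^ m < real (dyadic_steps m t) + 1" by linarith+
  then show "real (dyadic_steps m t) * (1 / 2 ^ m) \<le> t" "t < real (dyadic_steps m t) * (1 / 2 ^ m) + 1 / 2 ^ m"
    by (auto simp: field_simps)
qed

lemma dyadic_steps_mono: "s \<le> t \<Longrightarrow> dyadic_steps m s \<le> dyadic_steps m t"
  unfolding dyadic_steps_def by (intro nat_mono floor_mono mult_right_mono) auto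

lemma Tn_time_increment:
  assumes "n\<^sub>1 \<le> n\<^sub>2" "0 < h" "real n\<^sub>2 * h \<le> 1" "(real n\<^sub>2 - real n\<^sub>1) * h \<le> d"
  shows "\<bar>(T h ^^ n\<^sub>2) \<phi> v - (T h ^^ n\<^sub>1) \<phi> v\<bar> \<le> K * (Omega * sqrt d)"
proof -
  define j where "j = n\<^sub>2 - n\<^sub>1"
  have j: "n\<^sub>2 = n\<^sub>1 + j" using assms(1) by (simp add: j_def)
  have jh: "real j * h \<le> 1" "real j * h \<le> d"
    using assms(2-4) by (auto simp: j algebra_simps intro: order_trans[rotated])
  have "\<bar>(T h ^^ n\<^sub>1) ((T h ^^ j) \<phi>) v - (T h ^^ n\<^sub>1) \<phi> v\<bar> \<le> K * (Omega * sqrt (real j * h))"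
    by (intro Tn_contraction Tn_is_Lip is_LipI[OF \<phi>_Lip] Tn_displacement_abs \<phi>_Lip assms(2) jh(1))
  also have "\<dots> \<le> K * (Omega * sqrt d)"
    using jh K_nonneg Omega_ge_1 by (intro mult_left_mono real_sqrt_le_mono) auto
  finally show ?thesis by (simp add: j funpow_add)
qed

lemma bounded_\<phi>: "bounded (range \<phi>)"
  using \<phi>_bound by (rule bounded_range_realI)

text \<open>Refining the grid from \<open>m\<close> to \<open>m'\<close> costs the rate; the two roundings of \<open>t\<close> then differ by less than
  one coarse step.\<close>

lemma dyadic_scheme_Cauchy:
  assumes t: "0 \<le> t" "t \<le> 1" and m: "m \<le> m'"
  shows "\<bar>dyadic_scheme m t v - dyadic_scheme m' t v\<bar> \<le> dyadic_error m"
proof -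
  obtain k where k: "m' = m + k" using m by (auto simp: le_iff_add)
  define p :: nat where "p = 2 ^ k"
  have p: "1 \<le> p" "1 / 2 ^ m / real p = 1 / (2 ^ m' :: real)"
    by (auto simp: p_def k power_add)
  let ?n = "dyadic_steps m t" and ?n' = "dyadic_steps m' t" and ?h = "1 / 2 ^ m :: real" and ?h' = "1 / 2 ^ m' :: real"
  have nh: "real ?n * ?h \<le> 1" using dyadic_steps_bounds(1)[OF t(1), of m] t by linarith
  have "\<bar>(T ?h ^^ ?n) \<phi> v - (T (?h / real p) ^^ (p * ?n)) \<phi> v\<bar> \<le> K * rate_const * ?h powr r"
    by (rule refinement_rate[OF \<phi>_Lip bounded_\<phi> _ _ nh p(1) r]) auto
  then have 1: "\<bar>(T ?h ^^ ?n) \<phi> v - (T ?h' ^^ (p * ?n)) \<phi> v\<bar> \<le> K * rate_const * ?h powr r"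
    by (simp only: p(2))
  have hp: "real (p * ?n) * ?h' = real ?n * ?h"
    by (simp add: p_def k power_add field_simps)
  have le: "p * ?n \<le> ?n'"
  proof -
    have "real (p * ?n) * ?h' \<le> t" unfolding hp by (rule dyadic_steps_bounds(1)[OF t(1)])
    then have "real (p * ?n) \<le> t * 2 ^ m'" by (simp add: pos_divide_le_eq del: of_nat_mult)
    then show ?thesis by (simp add: dyadic_steps_def le_nat_floor)
  qed
  have 2: "\<bar>(T ?h' ^^ ?n') \<phi> v - (T ?h' ^^ (p * ?n)) \<phi> v\<bar> \<le> K * (Omega * sqrt ?h)"
  proof (rule Tn_time_increment[OF le])
    show "real ?n' * ?h' \<le> 1" using dyadic_steps_bounds(1)[OF t(1), of m'] t by linarith
    have "(real ?n' - real (p * ?n)) * ?h' = real ?n' * ?h' - real ?n * ?h"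
      unfolding left_diff_distrib hp ..
    then show "(real ?n' - real (p * ?n)) * ?h' \<le> ?h"
      using dyadic_steps_bounds(1)[OF t(1), of m'] dyadic_steps_bounds(2)[OF t(1), of m] by linarith
  qed simp
  show ?thesis
    unfolding dyadic_scheme_def dyadic_error_def using 1 2 by linarith
qed

lemma inverse_power_2_tendsto: "(\<lambda>m. 1 / 2 ^ m :: real) \<longlonglongrightarrow> 0"
  using LIMSEQ_inverse_realpow_zero[of 2] by (simp add: inverse_eq_divide)

lemma dyadic_error_tendsto: "dyadic_error \<longlonglongrightarrow> 0"
proof -
  have "(\<lambda>m. (1 / 2 ^ m :: real) powr r) \<longlonglongrightarrow> 0"
    by (rule tendsto_zero_powrI[OF inverse_power_2_tendsto tendsto_const]) (use r in auto)
  moreover have "(\<lambda>m. sqrt (1 / 2 ^ m :: real)) \<longlonglongrightarrow> sqrt 0"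
    by (rule tendsto_real_sqrt[OF inverse_power_2_tendsto])
  ultimately have "dyadic_error \<longlonglongrightarrow> K * rate_const * 0 + K * (Omega * sqrt 0)"
    unfolding dyadic_error_def[abs_def] by (intro tendsto_add tendsto_mult tendsto_const)
  then show ?thesis by simp
qed

lemma dyadic_scheme_tendsto:
  assumes t: "0 \<le> t" "t \<le> 1"
  shows "(\<lambda>m. dyadic_scheme m t v) \<longlonglongrightarrow> solution t v"
proof -
  have "Cauchy (\<lambda>m. dyadic_scheme m t v)"
  proof (rule metric_CauchyI)
    fix e :: real assume "0 < e"
    then have "\<forall>\<^sub>F m in sequentially. dyadic_error m < e / 2"
      using order_tendstoD(2)[OF dyadic_error_tendsto, of "e / 2"] by simp
    then obtain N where N: "dyadic_error N < e / 2" by (auto simp: eventually_sequentially)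
    have "dist (dyadic_scheme m t v) (dyadic_scheme n t v) < e" if "m \<ge> N" "n \<ge> N" for m n
      using dyadic_scheme_Cauchy[OF t that(1), of v] dyadic_scheme_Cauchy[OF t that(2), of v] N
      by (simp add: dist_real_def)
    then show "\<exists>M. \<forall>m\<ge>M. \<forall>n\<ge>M. dist (dyadic_scheme m t v) (dyadic_scheme n t v) < e" by blast
  qed
  then show ?thesis
    unfolding solution_def using Cauchy_convergent convergent_LIMSEQ_iff by blast
qed

lemma solution_close:
  assumes t: "0 \<le> t" "t \<le> 1"
  shows "\<bar>dyadic_scheme m t v - solution t v\<bar> \<le> dyadic_error m"
proof (rule tendsto_upperbound)
  show "(\<lambda>m'. \<bar>dyadic_scheme m t v - dyadic_scheme m' t v\<bar>) \<longlonglongrightarrow> \<bar>dyadic_scheme m t v - solution t v\<bar>"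
    by (intro tendsto_rabs tendsto_diff tendsto_const dyadic_scheme_tendsto t)
  show "\<forall>\<^sub>F m' in sequentially. \<bar>dyadic_scheme m t v - dyadic_scheme m' t v\<bar> \<le> dyadic_error m"
    using dyadic_scheme_Cauchy[OF t] by (intro eventually_sequentiallyI[of m])
qed simp

lemma solution_Lip:
  assumes t: "0 \<le> t" "t \<le> 1"
  shows "Lip1 K (solution t)"
  unfolding Lip1_def
proof (intro conjI allI)
  fix v w
  show "\<bar>solution t v - solution t w\<bar> \<le> K * ell1 (v - w)"
  proof (rule tendsto_upperbound)
    show "(\<lambda>m. \<bar>dyadic_scheme m t v - dyadic_scheme m t w\<bar>) \<longlonglongrightarrow> \<bar>solution t v - solution t w\<bar>"
      by (intro tendsto_rabs tendsto_diff dyadic_scheme_tendsto t)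
    show "\<forall>\<^sub>F m in sequentially. \<bar>dyadic_scheme m t v - dyadic_scheme m t w\<bar> \<le> K * ell1 (v - w)"
      unfolding dyadic_scheme_def by (intro always_eventually allI Lip1D[OF Tn_Lip1[OF \<phi>_Lip]])
  qed simp
qed (rule K_nonneg)

lemma solution_bounded:
  assumes t: "0 \<le> t" "t \<le> 1"
  shows "\<bar>solution t v\<bar> \<le> B"
proof (rule tendsto_upperbound)
  show "(\<lambda>m. \<bar>dyadic_scheme m t v\<bar>) \<longlonglongrightarrow> \<bar>solution t v\<bar>"
    by (intro tendsto_rabs dyadic_scheme_tendsto t)
  show "\<forall>\<^sub>F m in sequentially. \<bar>dyadic_scheme m t v\<bar> \<le> B"
    unfolding dyadic_scheme_def by (intro always_eventually allI Tn_bounded[OF \<phi>_Lip] \<phi>_bound)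
qed simp

lemma solution_0: "solution 0 v = \<phi> v"
proof -
  have "(\<lambda>m. dyadic_scheme m 0 v) = (\<lambda>m. \<phi> v)" by (simp add: dyadic_scheme_def dyadic_steps_def)
  then have "(\<lambda>m. \<phi> v) \<longlonglongrightarrow> solution 0 v" using dyadic_scheme_tendsto[of 0 v] by simp
  then show ?thesis by (simp add: LIMSEQ_const_iff)
qed

lemma solution_time_increment:
  assumes s: "0 \<le> s" "s \<le> t" "t \<le> 1"
  shows "\<bar>solution t v - solution s v\<bar> \<le> K * (Omega * sqrt (t - s))"
proof (rule tendsto_le)
  show "(\<lambda>m. \<bar>dyadic_scheme m t v - dyadic_scheme m s v\<bar>) \<longlonglongrightarrow> \<bar>solution t v - solution s v\<bar>"
    using s by (intro tendsto_rabs tendsto_diff dyadic_scheme_tendsto) auto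
  have "(\<lambda>m. K * (Omega * sqrt (t - s + 1 / 2 ^ m))) \<longlonglongrightarrow> K * (Omega * sqrt (t - s + 0))"
    by (intro tendsto_mult tendsto_const tendsto_real_sqrt tendsto_add inverse_power_2_tendsto)
  then show "(\<lambda>m. K * (Omega * sqrt (t - s + 1 / 2 ^ m))) \<longlonglongrightarrow> K * (Omega * sqrt (t - s))" by simp
  show "\<forall>\<^sub>F m in sequentially. \<bar>dyadic_scheme m t v - dyadic_scheme m s v\<bar> \<le> K * (Omega * sqrt (t - s + 1 / 2 ^ m))"
  proof (intro always_eventually allI)
    fix m
    let ?h = "1 / 2 ^ m :: real"
    have t0: "0 \<le> t" using s by linarith
    note b = dyadic_steps_bounds[OF s(1), of m] dyadic_steps_bounds[OF t0, of m]
    show "\<bar>dyadic_scheme m t v - dyadic_scheme m s v\<bar> \<le> K * (Omega * sqrt (t - s + ?h))"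
      unfolding dyadic_scheme_def
    proof (rule Tn_time_increment[OF dyadic_steps_mono[OF s(2)]])
      show "real (dyadic_steps m t) * ?h \<le> 1" using b s by linarith
      show "(real (dyadic_steps m t) - real (dyadic_steps m s)) * ?h \<le> t - s + ?h"
        unfolding left_diff_distrib using b by linarith
    qed simp
  qed
qed simp

lemma step_error_tendsto: "(\<lambda>m. step_error N1 N2 N3 (1 / 2 ^ m)) \<longlonglongrightarrow> 0"
proof -
  have p: "(\<lambda>m. (1 / 2 ^ m :: real) powr a) \<longlonglongrightarrow> 0" if "0 < a" for a
    by (rule tendsto_zero_powrI[OF inverse_power_2_tendsto tendsto_const]) (use that in auto)
  have "(\<lambda>m. sqrt (1 / 2 ^ m :: real)) \<longlonglongrightarrow> sqrt 0"
    by (rule tendsto_real_sqrt[OF inverse_power_2_tendsto])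
  then have "(\<lambda>m. step_error N1 N2 N3 (1 / 2 ^ m)) \<longlonglongrightarrow>
      4 * M\<^sup>2 * (N2 + N3) * sqrt 0 + c * ((N1 + N2) * 0 + N2 * 0)"
    unfolding step_error_def using q0_pos alpha
    by (intro tendsto_add tendsto_mult tendsto_const p) auto
  then show ?thesis by simp
qed

text \<open>The scheme at time \<open>t\<close> restarts from the scheme at time \<open>t - s\<close>. The number of steps in between,
  times the step size, is only asymptotically equal to \<open>s\<close>.\<close>

lemma evolution_steps:
  assumes s: "0 \<le> s" "s \<le> t" "t \<le> 1"
  obtains j where "\<And>m v. dyadic_scheme m t v = (T (1 / 2 ^ m) ^^ j m) (dyadic_scheme m (t - s)) v"
    and "\<And>m. real (j m) * (1 / 2 ^ m) \<le> 1" and "(\<lambda>m. real (j m) * (1 / 2 ^ m)) \<longlonglongrightarrow> s"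
proof
  let ?j = "\<lambda>m. dyadic_steps m t - dyadic_steps m (t - s)"
  have le: "dyadic_steps m (t - s) \<le> dyadic_steps m t" for m using s by (intro dyadic_steps_mono) simp
  have t0: "0 \<le> t" "0 \<le> t - s" using s by auto
  note b = dyadic_steps_bounds[OF t0(1)] dyadic_steps_bounds[OF t0(2)]
  have j: "real (?j m) * (1 / 2 ^ m) = real (dyadic_steps m t) * (1 / 2 ^ m) - real (dyadic_steps m (t - s)) * (1 / 2 ^ m)" for m
    using le[of m] by (simp add: of_nat_diff left_diff_distrib diff_divide_distrib)
  show "dyadic_scheme m t v = (T (1 / 2 ^ m) ^^ ?j m) (dyadic_scheme m (t - s)) v" for m v
  proof -
    have "(T (1 / 2 ^ m) ^^ (a + b)) \<phi> v = (T (1 / 2 ^ m) ^^ a) ((T (1 / 2 ^ m) ^^ b) \<phi>) v" for a b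
      by (simp add: funpow_add)
    from this[of "?j m" "dyadic_steps m (t - s)"] show ?thesis
      unfolding dyadic_scheme_def le_add_diff_inverse2[OF le] .
  qed
  show "real (?j m) * (1 / 2 ^ m) \<le> 1" for m
  proof -
    have "0 \<le> real (dyadic_steps m (t - s)) * (1 / 2 ^ m)" by simp
    then show ?thesis unfolding j using b(1)[of m] s by linarith
  qed
  show "(\<lambda>m. real (?j m) * (1 / 2 ^ m)) \<longlonglongrightarrow> s"
  proof (rule LIM_zero_cancel, rule Lim_null_comparison)
    show "\<forall>\<^sub>F m in sequentially. norm (real (?j m) * (1 / 2 ^ m) - s) \<le> 1 / 2 ^ m"
    proof (intro always_eventually allI)
      fix m show "norm (real (?j m) * (1 / 2 ^ m) - s) \<le> 1 / 2 ^ m"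
        unfolding j real_norm_def using b(1)[of m] b(2)[of m] b(3)[of m] b(4)[of m] by linarith
    qed
  qed (rule inverse_power_2_tendsto)
qed

lemma evolution_bound_limit:
  assumes j: "\<And>m. real (j m) * (1 / 2 ^ m) \<le> 1" "(\<lambda>m. real (j m) * (1 / 2 ^ m)) \<longlonglongrightarrow> s"
  shows "(\<lambda>m. real (j m) * (1 / 2 ^ m) * G
      + real (j m) * (1 / 2 ^ m) * (step_error N1 N2 N3 (1 / 2 ^ m) + L * (Omega * sqrt (real (j m) * (1 / 2 ^ m))))
      + b * (Omega * sqrt (real (j m) * (1 / 2 ^ m))) + dyadic_error m)
    \<longlonglongrightarrow> s * G + s * (L * (Omega * sqrt s)) + b * (Omega * sqrt s)"
proof -
  have "(\<lambda>m. real (j m) * (1 / 2 ^ m) * G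
      + real (j m) * (1 / 2 ^ m) * (step_error N1 N2 N3 (1 / 2 ^ m) + L * (Omega * sqrt (real (j m) * (1 / 2 ^ m))))
      + b * (Omega * sqrt (real (j m) * (1 / 2 ^ m))) + dyadic_error m)
    \<longlonglongrightarrow> s * G + s * (0 + L * (Omega * sqrt s)) + b * (Omega * sqrt s) + 0"
    by (intro tendsto_add tendsto_mult[OF j(2)] tendsto_mult[OF tendsto_const] tendsto_const step_error_tendsto
        tendsto_real_sqrt j(2) dyadic_error_tendsto)
  then show ?thesis by simp
qed

text \<open>The bound for finitely many steps from \<open>steps_consistent\<close> and \<open>displacement_le\<close>, in the limit of
  vanishing step size. The term linear in the distance to \<open>v\<close> admits comparison functions that are
  close to \<open>solution\<close> near \<open>v\<close> only.\<close>

lemma solution_evolution_le: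
  assumes g: "smooth3 N1 N2 N3 g gy gxx" and s: "0 \<le> s" "s \<le> t" "t \<le> 1" and b: "0 \<le> b"
    and le: "\<And>w. solution (t - s) w \<le> g w + a + b * ell1 (w - v)"
  shows "solution t v \<le> g v + a + (s * Gen g gy gxx v
    + s * ((2 * c + 2 * M) * (N2 + N3) * (Omega * sqrt s)) + b * (Omega * sqrt s))"
proof -
  let ?G = "Gen g gy gxx v" and ?L = "(2 * c + 2 * M) * (N2 + N3)"
  obtain j where j: "\<And>m v. dyadic_scheme m t v = (T (1 / 2 ^ m) ^^ j m) (dyadic_scheme m (t - s)) v"
    "\<And>m. real (j m) * (1 / 2 ^ m) \<le> 1" "(\<lambda>m. real (j m) * (1 / 2 ^ m)) \<longlonglongrightarrow> s"
    using evolution_steps[OF s] by blast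
  have Lg: "is_Lip g" using g by (auto simp: smooth3_def is_Lip_def)
  have Lb: "is_Lip (\<lambda>w. b * ell1 (w - v))" by (intro is_Lip_intros)
  have ts: "0 \<le> t - s" "t - s \<le> 1" using s by auto
  define bound where "bound m = real (j m) * (1 / 2 ^ m) * ?G
      + real (j m) * (1 / 2 ^ m) * (step_error N1 N2 N3 (1 / 2 ^ m) + ?L * (Omega * sqrt (real (j m) * (1 / 2 ^ m))))
      + b * (Omega * sqrt (real (j m) * (1 / 2 ^ m))) + dyadic_error m" for m
  have main: "dyadic_scheme m t v \<le> g v + a + bound m" for m
  proof -
    let ?h = "1 / 2 ^ m :: real"
    have "dyadic_scheme m t v = (T ?h ^^ j m) (dyadic_scheme m (t - s)) v" by (rule j)
    also have "\<dots> \<le> (T ?h ^^ j m) (\<lambda>w. g w + b * ell1 (w - v)) v + (a + dyadic_error m)"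
    proof (rule Tn_le_add_const)
      show "is_Lip (dyadic_scheme m (t - s))" unfolding dyadic_scheme_def by (rule Tn_is_Lip[OF is_LipI[OF \<phi>_Lip]])
      show "is_Lip (\<lambda>w. g w + b * ell1 (w - v))" by (rule is_Lip_add[OF Lg Lb])
      show "dyadic_scheme m (t - s) w \<le> g w + b * ell1 (w - v) + (a + dyadic_error m)" for w
        using le[of w] solution_close[OF ts, of m w] by linarith
    qed
    also have "(T ?h ^^ j m) (\<lambda>w. g w + b * ell1 (w - v)) v
        \<le> (T ?h ^^ j m) g v + (T ?h ^^ j m) (\<lambda>w. b * ell1 (w - v)) v"
      by (rule Tn_add_le[OF Lg Lb])
    also have "(T ?h ^^ j m) (\<lambda>w. b * ell1 (w - v)) v = b * (T ?h ^^ j m) (\<lambda>w. ell1 (w - v)) v"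
      by (rule Tn_cmult[OF is_Lip_ell1_dist b])
    also have "\<dots> \<le> b * (Omega * sqrt (real (j m) * ?h))"
      by (intro mult_left_mono displacement_le j b) simp
    also have "(T ?h ^^ j m) g v \<le> g v + real (j m) * ?h * ?G
        + real (j m) * ?h * (step_error N1 N2 N3 ?h + ?L * (Omega * sqrt (real (j m) * ?h)))"
      using steps_consistent[OF g, of ?h "j m" v] j(2)[of m] by (simp add: abs_le_iff)
    finally show ?thesis unfolding bound_def by linarith
  qed
  show ?thesis
  proof (rule tendsto_le)
    show "(\<lambda>m. dyadic_scheme m t v) \<longlonglongrightarrow> solution t v" using s by (intro dyadic_scheme_tendsto) auto
    show "(\<lambda>m. g v + a + bound m) \<longlonglongrightarrow> g v + a + (s * ?G + s * (?L * (Omega * sqrt s)) + b * (Omega * sqrt s))"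
      unfolding bound_def by (rule tendsto_add[OF tendsto_const evolution_bound_limit[OF j(2,3)]])
    show "\<forall>\<^sub>F m in sequentially. dyadic_scheme m t v \<le> g v + a + bound m" by (simp add: main)
  qed simp
qed

lemma solution_evolution_ge:
  assumes g: "smooth3 N1 N2 N3 g gy gxx" and s: "0 \<le> s" "s \<le> t" "t \<le> 1" and b: "0 \<le> b"
    and ge: "\<And>w. g w + a - b * ell1 (w - v) \<le> solution (t - s) w"
  shows "g v + a + (s * Gen g gy gxx v
    - (s * ((2 * c + 2 * M) * (N2 + N3) * (Omega * sqrt s)) + b * (Omega * sqrt s))) \<le> solution t v"
proof -
  let ?G = "Gen g gy gxx v" and ?L = "(2 * c + 2 * M) * (N2 + N3)"
  obtain j where j: "\<And>m v. dyadic_scheme m t v = (T (1 / 2 ^ m) ^^ j m) (dyadic_scheme m (t - s)) v"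
    "\<And>m. real (j m) * (1 / 2 ^ m) \<le> 1" "(\<lambda>m. real (j m) * (1 / 2 ^ m)) \<longlonglongrightarrow> s"
    using evolution_steps[OF s] by blast
  have Lg: "is_Lip g" using g by (auto simp: smooth3_def is_Lip_def)
  have Lb: "is_Lip (\<lambda>w. b * ell1 (w - v))" by (intro is_Lip_intros)
  have Lu: "is_Lip (dyadic_scheme m (t - s))" for m
    unfolding dyadic_scheme_def by (rule Tn_is_Lip[OF is_LipI[OF \<phi>_Lip]])
  have ts: "0 \<le> t - s" "t - s \<le> 1" using s by auto
  define bound where "bound m = real (j m) * (1 / 2 ^ m) * (- ?G)
      + real (j m) * (1 / 2 ^ m) * (step_error N1 N2 N3 (1 / 2 ^ m) + ?L * (Omega * sqrt (real (j m) * (1 / 2 ^ m))))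
      + b * (Omega * sqrt (real (j m) * (1 / 2 ^ m))) + dyadic_error m" for m
  have main: "g v + a - bound m \<le> dyadic_scheme m t v" for m
  proof -
    let ?h = "1 / 2 ^ m :: real"
    have "g v + real (j m) * ?h * ?G
        - real (j m) * ?h * (step_error N1 N2 N3 ?h + ?L * (Omega * sqrt (real (j m) * ?h))) \<le> (T ?h ^^ j m) g v"
      using steps_consistent[OF g, of ?h "j m" v] j(2)[of m] by (simp add: abs_le_iff)
    also have "(T ?h ^^ j m) g v \<le> (T ?h ^^ j m) (\<lambda>w. dyadic_scheme m (t - s) w + b * ell1 (w - v)) v + (dyadic_error m - a)"
    proof (rule Tn_le_add_const[OF Lg is_Lip_add[OF Lu Lb]])
      show "g w \<le> dyadic_scheme m (t - s) w + b * ell1 (w - v) + (dyadic_error m - a)" for w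
        using ge[of w] solution_close[OF ts, of m w] by linarith
    qed
    also have "(T ?h ^^ j m) (\<lambda>w. dyadic_scheme m (t - s) w + b * ell1 (w - v)) v
        \<le> (T ?h ^^ j m) (dyadic_scheme m (t - s)) v + (T ?h ^^ j m) (\<lambda>w. b * ell1 (w - v)) v"
      by (rule Tn_add_le[OF Lu Lb])
    also have "(T ?h ^^ j m) (\<lambda>w. b * ell1 (w - v)) v = b * (T ?h ^^ j m) (\<lambda>w. ell1 (w - v)) v"
      by (rule Tn_cmult[OF is_Lip_ell1_dist b])
    also have "\<dots> \<le> b * (Omega * sqrt (real (j m) * ?h))"
      by (intro mult_left_mono displacement_le j b) simp
    also have "(T ?h ^^ j m) (dyadic_scheme m (t - s)) v = dyadic_scheme m t v" by (rule j(1)[symmetric])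
    finally show ?thesis unfolding bound_def mult_minus_right by linarith
  qed
  have "g v + a - (s * (- ?G) + s * (?L * (Omega * sqrt s)) + b * (Omega * sqrt s)) \<le> solution t v"
  proof (rule tendsto_le)
    show "(\<lambda>m. dyadic_scheme m t v) \<longlonglongrightarrow> solution t v" using s by (intro dyadic_scheme_tendsto) auto
    show "(\<lambda>m. g v + a - bound m) \<longlonglongrightarrow> g v + a - (s * (- ?G) + s * (?L * (Omega * sqrt s)) + b * (Omega * sqrt s))"
      unfolding bound_def by (rule tendsto_diff[OF tendsto_const evolution_bound_limit[OF j(2,3)]])
    show "\<forall>\<^sub>F m in sequentially. g v + a - bound m \<le> dyadic_scheme m t v" by (simp add: main)
  qed simp
  then show ?thesis by simp
qed

end

section \<open>The limit solves the equation\<close>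

lemma le_zero_of_small_time_bounds:
  fixes X :: real
  assumes t: "0 < t" and b: "\<And>\<eta>. 0 < \<eta> \<Longrightarrow> \<exists>C. \<forall>s. 0 < s \<longrightarrow> s < t \<longrightarrow> s * X \<le> s * (\<eta> + C * sqrt s + D * s)"
  shows "X \<le> 0"
proof (rule field_le_epsilon)
  fix \<eta> :: real assume "0 < \<eta>"
  then obtain C where C: "\<And>s. 0 < s \<Longrightarrow> s < t \<Longrightarrow> s * X \<le> s * (\<eta> + C * sqrt s + D * s)" using b by blast
  have id: "((\<lambda>s::real. s) \<longlongrightarrow> 0) (at_right 0)" by (rule tendsto_ident_at)
  have "((\<lambda>s. \<eta> + C * sqrt s + D * s) \<longlongrightarrow> \<eta> + C * sqrt 0 + D * 0) (at_right 0)"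
    by (intro tendsto_add tendsto_mult tendsto_const tendsto_real_sqrt id)
  moreover have "\<forall>\<^sub>F s in at_right 0. X \<le> \<eta> + C * sqrt s + D * s"
    unfolding eventually_at_right_field
  proof (intro exI[of _ t] conjI allI impI)
    fix s :: real assume s: "0 < s" "s < t"
    from C[OF s] show "X \<le> \<eta> + C * sqrt s + D * s" by (rule mult_left_le_imp_le) (rule s)
  qed (rule t)
  ultimately have "X \<le> \<eta> + C * sqrt 0 + D * 0"
    by (rule tendsto_lowerbound) simp
  then show "X \<le> 0 + \<eta>" by simp
qed

context convergent_scheme
begin

lemma solution_continuous: "continuous_on ({0..1} \<times> UNIV) (\<lambda>(t, v). solution t v)"
  unfolding continuous_on_def
proof
  fix p0 :: "real \<times> R3" assume p0: "p0 \<in> {0..1} \<times> UNIV"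
  obtain t0 v0 where tv: "p0 = (t0, v0)" by (cases p0)
  let ?e = "\<lambda>p::real \<times> R3. K * ell1 (snd p - v0) + K * (Omega * sqrt \<bar>fst p - t0\<bar>)"
  have bd: "\<bar>solution t v - solution t0 v0\<bar> \<le> ?e (t, v)" if t: "t \<in> {0..1}" for t v
  proof -
    have t0: "t0 \<in> {0..1}" using p0 tv by simp
    have "\<bar>solution t v - solution t v0\<bar> \<le> K * ell1 (v - v0)"
      using solution_Lip[of t] t by (auto dest: Lip1D)
    moreover have "\<bar>solution t v0 - solution t0 v0\<bar> \<le> K * (Omega * sqrt \<bar>t - t0\<bar>)"
    proof (cases "t0 \<le> t")
      case True
      then show ?thesis using solution_time_increment[of t0 t v0] t t0 by simp
    next
      case False
      then show ?thesis using solution_time_increment[of t t0 v0] t t0 by (simp add: abs_minus_commute)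
    qed
    ultimately show ?thesis by simp
  qed
  have "norm ((case p of (t, v) \<Rightarrow> solution t v) - (case p0 of (t, v) \<Rightarrow> solution t v)) \<le> ?e p"
    if "p \<in> {0..1} \<times> UNIV" for p
    using bd[of "fst p" "snd p"] that by (simp add: case_prod_unfold mem_Times_iff tv)
  then have "\<forall>\<^sub>F p in at p0 within {0..1} \<times> UNIV. norm ((case p of (t, v) \<Rightarrow> solution t v) - (case p0 of (t, v) \<Rightarrow> solution t v)) \<le> ?e p"
    unfolding eventually_at_filter by (intro always_eventually allI impI)
  moreover have "(?e \<longlongrightarrow> 0) (at p0 within {0..1} \<times> UNIV)"
  proof -
    have "continuous_on UNIV ?e"
    proof -
      have "continuous_on UNIV (\<lambda>p::real \<times> R3. ell1 (snd p - v0))"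
        by (rule continuous_on_compose2[OF Lip1_continuous_on[OF Lip1_ell1_dist[of v0], of UNIV]])
           (auto intro: continuous_on_snd continuous_on_id)
      then show ?thesis by (intro continuous_intros)
    qed
    then have "(?e \<longlongrightarrow> ?e p0) (at p0)" unfolding continuous_on_def by blast
    then have "(?e \<longlongrightarrow> ?e p0) (at p0 within {0..1} \<times> UNIV)" by (rule tendsto_within_subset) simp
    then show ?thesis by (simp add: tv)
  qed
  ultimately have "((\<lambda>p. (case p of (t, v) \<Rightarrow> solution t v) - (case p0 of (t, v) \<Rightarrow> solution t v)) \<longlongrightarrow> 0)
      (at p0 within {0..1} \<times> UNIV)"
    by (rule Lim_null_comparison)
  then show "((\<lambda>(t, v). solution t v) \<longlongrightarrow> (case p0 of (t, v) \<Rightarrow> solution t v)) (at p0 within {0..1} \<times> UNIV)"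
    by (rule LIM_zero_cancel)
qed

lemma time_derivative_modulus:
  assumes \<psi>: "C_b_along PIDE_domain {e_t} 2 \<psi>" and t: "t \<in> {0<..1}" and \<eta>: "0 < \<eta>"
  shows "\<exists>C\<ge>0. \<forall>w. \<bar>dir_deriv PIDE_domain e_t \<psi> (t, w) - dir_deriv PIDE_domain e_t \<psi> (t, v)\<bar> \<le> \<eta> + C * ell1 (w - v)"
proof -
  have c: "C_b_along PIDE_domain {e_t} (Suc 0) (dir_deriv PIDE_domain e_t \<psi>)"
    using \<psi> by (simp add: numeral_2_eq_2)
  have dom: "(t, w) \<in> PIDE_domain" for w using t by (simp add: PIDE_domain_def)
  obtain B where "\<And>v. v \<in> PIDE_domain \<Longrightarrow> \<bar>dir_deriv PIDE_domain e_t \<psi> v\<bar> \<le> B"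
    using C_b_along_bound[OF c] by blast
  then have b: "\<bar>dir_deriv PIDE_domain e_t \<psi> (t, w)\<bar> \<le> B" for w using dom by blast
  have "continuous_on UNIV (\<lambda>w. dir_deriv PIDE_domain e_t \<psi> (t, w))"
    by (rule continuous_on_compose2[OF C_b_along_continuous[OF c]]) (auto intro!: continuous_intros dom)
  then show ?thesis by (rule bounded_continuous_linear_modulus[OF _ b \<eta>])
qed

lemma PIDE_op_slice:
  "PIDE_op (Theta \<alpha> P) \<psi> (t, v) = dir_deriv PIDE_domain e_t \<psi> (t, v)
    - Gen (\<lambda>w. \<psi> (t, w)) (\<lambda>w. dir_deriv PIDE_domain e_y \<psi> (t, w))
        (\<lambda>w. dir_deriv PIDE_domain e_x (dir_deriv PIDE_domain e_x \<psi>) (t, w)) v"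
  by (simp add: PIDE_op_def Gen_def e_dirs(3))

text \<open>The test function lies above \<open>solution\<close> at the earlier time \<open>t - s\<close> and agrees with it at \<open>(t, v)\<close>.
  Replacing it at time \<open>t - s\<close> by its first-order expansion around \<open>t\<close> and letting it evolve for the
  time \<open>s\<close> yields \<open>s * (\<partial>\<^sub>t\<psi> - G) \<le> o(s)\<close>.\<close>

lemma solution_subsolution:
  assumes \<psi>: "\<psi> \<in> C_b_2_3" and t: "t \<in> {0<..1}" and touch: "\<psi> (t, v) = solution t v"
    and above: "\<And>s w. s \<in> {0<..1} \<Longrightarrow> solution s w \<le> \<psi> (s, w)"
  shows "PIDE_op (Theta \<alpha> P) \<psi> (t, v) \<le> 0"
proof -
  let ?g = "\<lambda>w. \<psi> (t, w)" and ?gy = "\<lambda>w. dir_deriv PIDE_domain e_y \<psi> (t, w)"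
    and ?gxx = "\<lambda>w. dir_deriv PIDE_domain e_x (dir_deriv PIDE_domain e_x \<psi>) (t, w)"
  let ?d = "\<lambda>w. dir_deriv PIDE_domain e_t \<psi> (t, w)"
  have ct: "C_b_along PIDE_domain {e_t} 2 \<psi>" and cx: "C_b_along PIDE_domain {e_x, e_y, e_z} 3 \<psi>"
    using \<psi> by (auto simp: C_b_2_3_def)
  obtain N1 N2 N3 where g: "smooth3 N1 N2 N3 ?g ?gy ?gxx" using smooth3_slice[OF cx t] by blast
  let ?L = "(2 * c + 2 * M) * (N2 + N3)" and ?G = "Gen ?g ?gy ?gxx v"
  obtain D where D: "\<And>s w. 0 \<le> s \<Longrightarrow> s < t \<Longrightarrow> \<bar>\<psi> (t - s, w) - \<psi> (t, w) + s * ?d w\<bar> \<le> D * s\<^sup>2"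
    using time_taylor[OF ct t] by blast
  have "?d v - ?G \<le> 0"
  proof (rule le_zero_of_small_time_bounds[of t _ D])
    show "0 < t" using t by simp
    fix \<eta> :: real assume "0 < \<eta>"
    then obtain C where C: "0 \<le> C" "\<And>w. \<bar>?d w - ?d v\<bar> \<le> \<eta> + C * ell1 (w - v)"
      using time_derivative_modulus[OF ct t] by blast
    have "s * (?d v - ?G) \<le> s * (\<eta> + (?L * Omega + C * Omega) * sqrt s + D * s)" if s: "0 < s" "s < t" for s
    proof -
      have "solution (t - s) w \<le> ?g w + (s * (\<eta> - ?d v) + D * s\<^sup>2) + (s * C) * ell1 (w - v)" for w
      proof -
        have "solution (t - s) w \<le> \<psi> (t - s, w)" using s t by (intro above) auto
        also have "\<dots> \<le> ?g w + s * (- ?d w) + D * s\<^sup>2" using D[of s w] s by (simp add: abs_le_iff)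
        also have "s * (- ?d w) \<le> s * (\<eta> - ?d v + C * ell1 (w - v))"
          using C(2)[of w] s by (intro mult_left_mono) (auto simp: abs_le_iff)
        finally show ?thesis by (simp add: algebra_simps)
      qed
      then have "solution t v \<le> ?g v + (s * (\<eta> - ?d v) + D * s\<^sup>2)
          + (s * ?G + s * (?L * (Omega * sqrt s)) + (s * C) * (Omega * sqrt s))"
        using s t C(1) by (intro solution_evolution_le[OF g]) auto
      then show ?thesis using touch by (simp add: algebra_simps power2_eq_square)
    qed
    then show "\<exists>C. \<forall>s. 0 < s \<longrightarrow> s < t \<longrightarrow> s * (?d v - ?G) \<le> s * (\<eta> + C * sqrt s + D * s)" by blast
  qed
  then show ?thesis by (simp add: PIDE_op_slice)
qed

lemma solution_supersolution:
  assumes \<psi>: "\<psi> \<in> C_b_2_3" and t: "t \<in> {0<..1}" and touch: "\<psi> (t, v) = solution t v"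
    and below: "\<And>s w. s \<in> {0<..1} \<Longrightarrow> \<psi> (s, w) \<le> solution s w"
  shows "0 \<le> PIDE_op (Theta \<alpha> P) \<psi> (t, v)"
proof -
  let ?g = "\<lambda>w. \<psi> (t, w)" and ?gy = "\<lambda>w. dir_deriv PIDE_domain e_y \<psi> (t, w)"
    and ?gxx = "\<lambda>w. dir_deriv PIDE_domain e_x (dir_deriv PIDE_domain e_x \<psi>) (t, w)"
  let ?d = "\<lambda>w. dir_deriv PIDE_domain e_t \<psi> (t, w)"
  have ct: "C_b_along PIDE_domain {e_t} 2 \<psi>" and cx: "C_b_along PIDE_domain {e_x, e_y, e_z} 3 \<psi>"
    using \<psi> by (auto simp: C_b_2_3_def)
  obtain N1 N2 N3 where g: "smooth3 N1 N2 N3 ?g ?gy ?gxx" using smooth3_slice[OF cx t] by blast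
  let ?L = "(2 * c + 2 * M) * (N2 + N3)" and ?G = "Gen ?g ?gy ?gxx v"
  obtain D where D: "\<And>s w. 0 \<le> s \<Longrightarrow> s < t \<Longrightarrow> \<bar>\<psi> (t - s, w) - \<psi> (t, w) + s * ?d w\<bar> \<le> D * s\<^sup>2"
    using time_taylor[OF ct t] by blast
  have "?G - ?d v \<le> 0"
  proof (rule le_zero_of_small_time_bounds[of t _ D])
    show "0 < t" using t by simp
    fix \<eta> :: real assume "0 < \<eta>"
    then obtain C where C: "0 \<le> C" "\<And>w. \<bar>?d w - ?d v\<bar> \<le> \<eta> + C * ell1 (w - v)"
      using time_derivative_modulus[OF ct t] by blast
    have "s * (?G - ?d v) \<le> s * (\<eta> + (?L * Omega + C * Omega) * sqrt s + D * s)" if s: "0 < s" "s < t" for s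
    proof -
      have "?g w + (- (s * (\<eta> + ?d v)) - D * s\<^sup>2) - (s * C) * ell1 (w - v) \<le> solution (t - s) w" for w
      proof -
        have "s * ?d w \<le> s * (\<eta> + ?d v + C * ell1 (w - v))"
          using C(2)[of w] s by (intro mult_left_mono) (auto simp: abs_le_iff)
        moreover have "?g w - s * ?d w - D * s\<^sup>2 \<le> \<psi> (t - s, w)" using D[of s w] s by (simp add: abs_le_iff)
        moreover have "\<psi> (t - s, w) \<le> solution (t - s) w" using s t by (intro below) auto
        ultimately show ?thesis by (simp add: algebra_simps)
      qed
      then have "?g v + (- (s * (\<eta> + ?d v)) - D * s\<^sup>2)
          + (s * ?G - (s * (?L * (Omega * sqrt s)) + (s * C) * (Omega * sqrt s))) \<le> solution t v"
        using s t C(1) by (intro solution_evolution_ge[OF g]) auto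
      then show ?thesis using touch by (simp add: algebra_simps power2_eq_square)
    qed
    then show "\<exists>C. \<forall>s. 0 < s \<longrightarrow> s < t \<longrightarrow> s * (?G - ?d v) \<le> s * (\<eta> + C * sqrt s + D * s)" by blast
  qed
  then show ?thesis by (simp add: PIDE_op_slice)
qed

lemma solution_viscosity: "viscosity_solution (Theta \<alpha> P) \<phi> (\<lambda>(t, v). solution t v)"
  unfolding viscosity_solution_def
proof (intro conjI ballI allI impI)
  show "continuous_on ({0..1} \<times> UNIV) (\<lambda>(t, v). solution t v)" by (rule solution_continuous)
  show "bounded ((\<lambda>(t, v). solution t v) ` ({0..1} \<times> UNIV))"
    using solution_bounded by (auto intro!: boundedI[of _ B])
  show "(case (0, v) of (t, v) \<Rightarrow> solution t v) = \<phi> v" for v by (simp add: solution_0)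
  fix \<psi> and p :: "real \<times> R3"
  assume \<psi>: "\<psi> \<in> C_b_2_3" and p: "p \<in> PIDE_domain"
  obtain t v where tv: "p = (t, v)" by (cases p)
  have t: "t \<in> {0<..1}" using p tv by (simp add: PIDE_domain_def)
  show "PIDE_op (Theta \<alpha> P) \<psi> p \<le> 0"
    if "\<psi> p = (case p of (t, v) \<Rightarrow> solution t v) \<and> (\<forall>v'\<in>PIDE_domain. (case v' of (t, v) \<Rightarrow> solution t v) \<le> \<psi> v')"
    using that unfolding tv by (intro solution_subsolution[OF \<psi> t]) (auto simp: PIDE_domain_def)
  show "0 \<le> PIDE_op (Theta \<alpha> P) \<psi> p"
    if "\<psi> p = (case p of (t, v) \<Rightarrow> solution t v) \<and> (\<forall>v'\<in>PIDE_domain. \<psi> v' \<le> (case v' of (t, v) \<Rightarrow> solution t v))"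
    using that unfolding tv by (intro solution_supersolution[OF \<psi> t]) (auto simp: PIDE_domain_def)
qed

text \<open>The schemes with steps \<open>1/n\<close> and \<open>1/2\<^sup>m\<close> are compared through their common refinement; the error of the
  latter vanishes as \<open>m\<close> grows.\<close>

lemma convergence_rate:
  assumes n: "1 \<le> n"
  shows "\<bar>(T (1 / real n) ^^ n) \<phi> v - solution 1 v\<bar> \<le> K * rate_const * real n powr (- r)"
proof (rule tendsto_le)
  show "(\<lambda>m. \<bar>(T (1 / real n) ^^ n) \<phi> v - dyadic_scheme m 1 v\<bar>) \<longlonglongrightarrow> \<bar>(T (1 / real n) ^^ n) \<phi> v - solution 1 v\<bar>"
    by (intro tendsto_rabs tendsto_diff tendsto_const dyadic_scheme_tendsto) auto
  have "(\<lambda>m. (1 / 2 ^ m :: real) powr r) \<longlonglongrightarrow> 0"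
    by (rule tendsto_zero_powrI[OF inverse_power_2_tendsto tendsto_const]) (use r in auto)
  then have "(\<lambda>m. K * rate_const * real n powr (- r) + K * rate_const * (1 / 2 ^ m) powr r)
      \<longlonglongrightarrow> K * rate_const * real n powr (- r) + K * rate_const * 0"
    by (intro tendsto_add tendsto_mult tendsto_const)
  then show "(\<lambda>m. K * rate_const * real n powr (- r) + K * rate_const * (1 / 2 ^ m) powr r)
      \<longlonglongrightarrow> K * rate_const * real n powr (- r)" by simp
  show "\<forall>\<^sub>F m in sequentially. \<bar>(T (1 / real n) ^^ n) \<phi> v - dyadic_scheme m 1 v\<bar>
      \<le> K * rate_const * real n powr (- r) + K * rate_const * (1 / 2 ^ m) powr r"
  proof (intro always_eventually allI)
    fix m
    let ?p = "2 ^ m :: nat"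
    have "\<bar>(T (1 / real n) ^^ n) \<phi> v - (T (1 / real n / real ?p) ^^ (?p * n)) \<phi> v\<bar> \<le> K * rate_const * (1 / real n) powr r"
      using n by (intro refinement_rate \<phi>_Lip bounded_\<phi> r) auto
    moreover have "(1 / real n) powr r = real n powr (- r)" using n by (simp add: powr_divide powr_minus_divide)
    moreover have "\<bar>(T (1 / 2 ^ m) ^^ ?p) \<phi> v - (T (1 / 2 ^ m / real n) ^^ (n * ?p)) \<phi> v\<bar> \<le> K * rate_const * (1 / 2 ^ m) powr r"
      using n by (intro refinement_rate \<phi>_Lip bounded_\<phi> r) auto
    moreover have "1 / 2 ^ m / real n = 1 / real n / real ?p" by (simp add: mult.commute)
    moreover have "dyadic_scheme m 1 v = (T (1 / 2 ^ m) ^^ ?p) \<phi> v"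
      by (simp add: dyadic_scheme_def dyadic_steps_def nat_power_eq)
    ultimately show "\<bar>(T (1 / real n) ^^ n) \<phi> v - dyadic_scheme m 1 v\<bar>
        \<le> K * rate_const * real n powr (- r) + K * rate_const * (1 / 2 ^ m) powr r"
      by (simp only: mult.commute[of n] abs_le_iff) linarith
  qed
qed simp

end

section \<open>The hypotheses of the theorem\<close>

lemma Lip_const_Lip1:
  assumes "\<phi> \<in> C_b_Lip"
  shows "Lip1 (Lip_const \<phi>) \<phi>"
proof -
  define S where "S = {K. Lip1 K \<phi>}"
  have Inf: "Lip_const \<phi> = Inf S"
    unfolding Lip_const_def S_def Lip1_def split_paired_All by simp
  obtain L where L: "L-lipschitz_on UNIV \<phi>" using assms by (auto simp: C_b_Lip_def)
  have L0: "0 \<le> L" by (rule lipschitz_on_nonneg[OF L])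
  have "Lip1 L \<phi>"
    unfolding Lip1_def
  proof (intro conjI allI L0)
    fix v w
    have "\<bar>\<phi> v - \<phi> w\<bar> \<le> L * norm (v - w)"
      using lipschitz_onD[OF L UNIV_I UNIV_I, of v w] by (simp add: dist_norm)
    also have "\<dots> \<le> L * ell1 (v - w)" using norm_le_ell1 L0 by (rule mult_left_mono)
    finally show "\<bar>\<phi> v - \<phi> w\<bar> \<le> L * ell1 (v - w)" .
  qed
  then have ne: "S \<noteq> {}" by (auto simp: S_def)
  show ?thesis
    unfolding Lip1_def Inf
  proof (intro conjI allI)
    show "0 \<le> Inf S" by (rule cInf_greatest[OF ne]) (simp add: S_def Lip1_nonneg)
    fix v w
    show "\<bar>\<phi> v - \<phi> w\<bar> \<le> Inf S * ell1 (v - w)"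
    proof (cases "v = w")
      case False
      have "0 < norm (v - w)" using False by simp
      then have pos: "0 < ell1 (v - w)" using norm_le_ell1[of "v - w"] by linarith
      have "\<bar>\<phi> v - \<phi> w\<bar> / ell1 (v - w) \<le> Inf S"
      proof (rule cInf_greatest[OF ne])
        fix K assume "K \<in> S"
        then have "Lip1 K \<phi>" by (simp add: S_def)
        from Lip1D[OF this, of v w] show "\<bar>\<phi> v - \<phi> w\<bar> / ell1 (v - w) \<le> K"
          using pos by (simp add: pos_divide_le_eq)
      qed
      then show ?thesis using pos by (simp add: pos_divide_le_eq)
    qed simp
  qed
qed

lemma jump_scale_sum: "(\<Sum>i<n::nat. jump_scale \<alpha> h (w i)) = jump_scale \<alpha> h (\<Sum>i<n. w i)"
proof -
  have "jump_scale \<alpha> h 0 = 0" by (simp add: jump_scale_def prod_eq_iff)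
  moreover have "jump_scale \<alpha> h (u + v) = jump_scale \<alpha> h u + jump_scale \<alpha> h v" for u v
    by (simp add: jump_scale_def distrib_left)
  ultimately show ?thesis by (induction n) simp_all
qed

lemma normalized_sums:
  assumes "1 \<le> n"
  shows "(S1 n w / sqrt (real n), S2 n w / real n, S3 n w / real n powr (1/\<alpha>))
    = 0 + (\<Sum>i<n. jump_scale \<alpha> (1 / real n) (w i))"
proof -
  have "fst (\<Sum>i<n. w i) = S1 n w" "fst (snd (\<Sum>i<n. w i)) = S2 n w" "snd (snd (\<Sum>i<n. w i)) = S3 n w"
    by (simp_all add: S1_def S2_def S3_def X_seq_def Y_seq_def Z_seq_def fst_sum snd_sum)
  then show ?thesis
    using assms unfolding jump_scale_sum
    by (simp add: jump_scale_def real_sqrt_divide powr_divide)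
qed

text \<open>The first entry of the minimum is at most \<open>1/6\<close>: this is \<open>24 * (\<delta> - \<alpha>) \<le> 4 * \<alpha> * \<delta>\<close>.\<close>

lemma rate_exponent_bounds:
  assumes "1 < \<alpha>" "\<alpha> < 2" "max (3/4 * \<alpha>) 1 < \<delta>" "\<delta> < \<alpha>" "0 < q\<^sub>0"
  shows "0 < rate_exponent \<alpha> \<delta> q\<^sub>0" "3 * rate_exponent \<alpha> \<delta> q\<^sub>0 \<le> 1/2"
    "2 * rate_exponent \<alpha> \<delta> q\<^sub>0 \<le> q\<^sub>0" "2 * rate_exponent \<alpha> \<delta> q\<^sub>0 \<le> (2 - \<alpha>) / \<alpha>"
proof -
  let ?a = "(4 * \<delta> - 3 * \<alpha>) / (2 * \<alpha> * (2 * \<delta> + 3))" and ?b = "(2 - \<alpha>) / (2 * \<alpha>)"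
  have r: "rate_exponent \<alpha> \<delta> q\<^sub>0 = min ?a (min ?b (q\<^sub>0 / 2))" by (simp add: rate_exponent_def)
  have d: "0 < 2 * \<alpha> * (2 * \<delta> + 3)" using assms by simp
  have "0 < ?a" using d assms by (intro divide_pos_pos) auto
  then show "0 < rate_exponent \<alpha> \<delta> q\<^sub>0" unfolding r using assms by simp
  have "0 \<le> \<alpha> * \<delta>" using assms by simp
  moreover have "6 * (4 * \<delta> - 3 * \<alpha>) \<le> 6 * \<alpha>" using assms(4) by simp
  ultimately have "6 * (4 * \<delta> - 3 * \<alpha>) \<le> 4 * (\<alpha> * \<delta>) + 6 * \<alpha>" by simp
  also have "\<dots> = 2 * \<alpha> * (2 * \<delta> + 3)" by (simp add: algebra_simps)
  finally have "6 * (4 * \<delta> - 3 * \<alpha>) \<le> 2 * \<alpha> * (2 * \<delta> + 3)" .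
  then have "6 * ?a \<le> 1" using d by (simp add: pos_divide_le_eq)
  then show "3 * rate_exponent \<alpha> \<delta> q\<^sub>0 \<le> 1/2" unfolding r by linarith
  show "2 * rate_exponent \<alpha> \<delta> q\<^sub>0 \<le> q\<^sub>0" unfolding r by linarith
  have "2 * ?b = (2 - \<alpha>) / \<alpha>" using assms(1) by (simp add: field_simps)
  then show "2 * rate_exponent \<alpha> \<delta> q\<^sub>0 \<le> (2 - \<alpha>) / \<alpha>" unfolding r by linarith
qed

lemma finite_moment_first_moment_bound:
  assumes fin: "finite_E_0 P \<mu> (\<lambda>(x, y, z). \<bar>z\<bar> powr \<delta>)" and \<delta>: "1 \<le> \<delta>"
    and law: "\<And>k q Q. (k, q, Q) \<in> P \<Longrightarrow> real_distribution (\<mu> k)"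
  shows "\<exists>B. \<forall>(k, q, Q)\<in>P. (\<integral>z. \<bar>z\<bar> \<partial>\<mu> k) \<le> B"
proof -
  let ?I = "\<lambda>(k, q, Q). \<integral>\<^sup>+z. (\<integral>\<^sup>+x. ennreal (\<bar>\<bar>z\<bar> powr \<delta>\<bar> * std_normal_density x) \<partial>lborel) \<partial>\<mu> k"
  define S where "S = (SUP \<theta>\<in>P. ?I \<theta>)"
  have S: "S < top" using fin by (simp add: finite_E_0_def S_def case_prod_unfold)
  have "(\<integral>z. \<bar>z\<bar> \<partial>\<mu> k) \<le> enn2real (1 + S)" if P: "(k, q, Q) \<in> P" for k q Q
  proof -
    interpret real_distribution "\<mu> k" by (rule law[OF P])
    have one: "(\<integral>\<^sup>+x. ennreal (std_normal_density x) \<partial>lborel) = 1"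
      using nn_integral_eq_integral[of lborel std_normal_density] by simp
    have "(\<integral>\<^sup>+x. ennreal (\<bar>\<bar>z\<bar> powr \<delta>\<bar> * std_normal_density x) \<partial>lborel) = ennreal (\<bar>z\<bar> powr \<delta>)" for z :: real
      by (simp add: ennreal_mult nn_integral_cmult one)
    then have eq: "(\<integral>\<^sup>+z. ennreal (\<bar>z\<bar> powr \<delta>) \<partial>\<mu> k) = ?I (k, q, Q)" by simp
    have le: "(\<integral>\<^sup>+z. ennreal (\<bar>z\<bar> powr \<delta>) \<partial>\<mu> k) \<le> S"
      unfolding eq S_def by (rule SUP_upper[OF P])
    have "\<bar>z\<bar> \<le> 1 + \<bar>z\<bar> powr \<delta>" for z :: real
    proof (cases "\<bar>z\<bar> \<le> 1")
      case False
      then have "\<bar>z\<bar> powr 1 \<le> \<bar>z\<bar> powr \<delta>" using \<delta> by (intro powr_mono) auto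
      then show ?thesis by simp
    qed (simp add: add_increasing2)
    then have "ennreal \<bar>z\<bar> \<le> ennreal 1 + ennreal (\<bar>z\<bar> powr \<delta>)" for z :: real
      using ennreal_leI[of "\<bar>z\<bar>" "1 + \<bar>z\<bar> powr \<delta>"] by (subst ennreal_plus[symmetric]) auto
    then have "(\<integral>\<^sup>+z. ennreal \<bar>z\<bar> \<partial>\<mu> k) \<le> (\<integral>\<^sup>+z. 1 + ennreal (\<bar>z\<bar> powr \<delta>) \<partial>\<mu> k)"
      by (intro nn_integral_mono) simp
    also have "\<dots> = 1 + (\<integral>\<^sup>+z. ennreal (\<bar>z\<bar> powr \<delta>) \<partial>\<mu> k)"
      using emeasure_space_1 by (subst nn_integral_add) auto
    also have "\<dots> \<le> 1 + S" using le by (rule add_left_mono)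
    finally have "enn2real (\<integral>\<^sup>+z. ennreal \<bar>z\<bar> \<partial>\<mu> k) \<le> enn2real (1 + S)"
      by (rule enn2real_mono) (simp add: ennreal_add_less_top S)
    then show ?thesis by (simp add: integral_eq_nn_integral)
  qed
  then show ?thesis by (intro exI[of _ "enn2real (1 + S)"]) auto
qed

context moment_bounds
begin

lemma E_hat_coordinate: "E_hat P \<mu> (\<lambda>w. F (w 0)) = E1 F"
  unfolding E_hat_def by (rule product_expectation_coordinate[OF E1_const])

lemma E1_nonneg: "admissible F \<Longrightarrow> (\<And>v. 0 \<le> F v) \<Longrightarrow> 0 \<le> E1 F"
  using E1_mono[of "\<lambda>_. 0" F] by (simp add: E1_const admissible_const)

lemma moments_as_E1:
  "moment (E_hat P \<mu>) (X_seq 0) 2 = E1 (\<lambda>v. (fst v)\<^sup>2)"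
  "moment (E_hat P \<mu>) (X_seq 0) 3 = E1 (\<lambda>v. \<bar>fst v\<bar> ^ 3)"
  "moment (E_hat P \<mu>) (Y_seq 0) 1 = E1 (\<lambda>v. \<bar>fst (snd v)\<bar>)"
  "moment (E_hat P \<mu>) (Y_seq 0) 2 = E1 (\<lambda>v. (fst (snd v))\<^sup>2)"
  "moment (E_hat P \<mu>) (Z_seq 0) 1 = E1 (\<lambda>v. \<bar>snd (snd v)\<bar>)"
  unfolding moment_def X_seq_def Y_seq_def Z_seq_def
  using E_hat_coordinate[of "\<lambda>v. (fst v)\<^sup>2"] E_hat_coordinate[of "\<lambda>v. \<bar>fst v\<bar> ^ 3"]
    E_hat_coordinate[of "\<lambda>v. \<bar>fst (snd v)\<bar>"] E_hat_coordinate[of "\<lambda>v. (fst (snd v))\<^sup>2"]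
    E_hat_coordinate[of "\<lambda>v. \<bar>snd (snd v)\<bar>"]
  by simp_all

lemma M_0_ge:
  "E1 (\<lambda>v. (fst v)\<^sup>2) \<le> M_0 \<delta> P \<mu>" "E1 (\<lambda>v. \<bar>fst (snd v)\<bar>) \<le> M_0 \<delta> P \<mu>" "E1 (\<lambda>v. \<bar>snd (snd v)\<bar>) \<le> M_0 \<delta> P \<mu>"
proof -
  have n: "0 \<le> E1 (\<lambda>v. (fst v)\<^sup>2)" "0 \<le> E1 (\<lambda>v. \<bar>fst v\<bar> ^ 3)" "0 \<le> E1 (\<lambda>v. \<bar>fst (snd v)\<bar>)"
    "0 \<le> E1 (\<lambda>v. (fst (snd v))\<^sup>2)" "0 \<le> E1 (\<lambda>v. \<bar>snd (snd v)\<bar>)"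
    by (rule E1_nonneg; (rule admissible_monomials | simp))+
  have p: "0 \<le> a powr b * c powr d" for a b c d :: real by simp
  show "E1 (\<lambda>v. (fst v)\<^sup>2) \<le> M_0 \<delta> P \<mu>" "E1 (\<lambda>v. \<bar>fst (snd v)\<bar>) \<le> M_0 \<delta> P \<mu>" "E1 (\<lambda>v. \<bar>snd (snd v)\<bar>) \<le> M_0 \<delta> P \<mu>"
    unfolding M_0_def Let_def moments_as_E1
    using n p[of "E1 (\<lambda>v. \<bar>fst v\<bar> ^ 3)" "1/3" "moment (E_hat P \<mu>) (Z_seq 0) \<delta>" "2/3"]
      p[of "E1 (\<lambda>v. (fst (snd v))\<^sup>2)" "1/2" "E1 (\<lambda>v. \<bar>snd (snd v)\<bar>)" "1/2"] by linarith+
qed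

lemma parameters_le_M_0:
  assumes P: "(k, q, Q) \<in> P"
  shows "Q \<le> M_0 \<delta> P \<mu>" "\<bar>q\<bar> \<le> M_0 \<delta> P \<mu>" "(\<integral>z. \<bar>z\<bar> \<partial>\<mu> k) \<le> M_0 \<delta> P \<mu>"
proof -
  interpret real_distribution "\<mu> k" using real_distr P by blast
  have [simp]: "prob UNIV = 1" using prob_space by simp
  note Q = Q_nonneg[OF P] Q_le[OF P]
  have "mean (k, q, Q) (\<lambda>v. (fst v)\<^sup>2) = Q"
    using mean_factor[of k q Q "\<lambda>x. x\<^sup>2" "\<lambda>_. 1" "\<lambda>_. 1"] gaussian_moments(1)[OF Q] by simp
  then show "Q \<le> M_0 \<delta> P \<mu>" using E1_upper[OF P admissible_monomials(3)] M_0_ge(1)[of \<delta>] by simp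
  have "mean (k, q, Q) (\<lambda>v. \<bar>fst (snd v)\<bar>) = \<bar>q\<bar>"
    using mean_factor[of k q Q "\<lambda>x. 1" "\<lambda>_. 1" "\<lambda>y. \<bar>y\<bar>"] by simp
  then show "\<bar>q\<bar> \<le> M_0 \<delta> P \<mu>" using E1_upper[OF P admissible_monomials(6)] M_0_ge(2)[of \<delta>] by simp
  have "mean (k, q, Q) (\<lambda>v. \<bar>snd (snd v)\<bar>) = (\<integral>z. \<bar>z\<bar> \<partial>\<mu> k)"
    using mean_factor[of k q Q "\<lambda>x. 1" "\<lambda>z. \<bar>z\<bar>" "\<lambda>y. 1"] by simp
  then show "(\<integral>z. \<bar>z\<bar> \<partial>\<mu> k) \<le> M_0 \<delta> P \<mu>" using E1_upper[OF P admissible_monomials(8)] M_0_ge(3)[of \<delta>] by simp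
qed

lemma M_0_nonneg: "0 \<le> M_0 \<delta> P \<mu>"
  using M_0_ge(1)[of \<delta>] E1_nonneg[OF admissible_monomials(3)] by simp

text \<open>Any bound on the parameters makes the suprema in the moments of \<open>X\<close>, \<open>Y\<close> and \<open>Z\<close> finite. These moments,
  and with them \<open>M_0\<close>, then dominate the parameters.\<close>

lemma moment_bounds_M_0: "moment_bounds P \<mu> (1 + M_0 \<delta> P \<mu>)"
proof (rule moment_bounds.intro)
  fix k q Q assume P: "(k, q, Q) \<in> P"
  note b = parameters_le_M_0[OF P, of \<delta>]
  show "real_distribution (\<mu> k)" "0 \<le> Q" "integrable (\<mu> k) (\<lambda>z. z)"
    using real_distr[OF P] Q_nonneg[OF P] integrable_id[OF P] by blast+
  show "Q \<le> 1 + M_0 \<delta> P \<mu>" "\<bar>q\<bar> \<le> 1 + M_0 \<delta> P \<mu>" "(\<integral>z. \<bar>z\<bar> \<partial>\<mu> k) \<le> 1 + M_0 \<delta> P \<mu>"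
    using b by linarith+
qed (use P_nonempty M_0_nonneg[of \<delta>] in auto)

lemma scaled_abs_mean_1_nonneg: "0 \<le> scaled_abs_mean \<alpha> P \<mu> 1"
  using E_hat_coordinate[of "\<lambda>v. \<bar>snd (snd v)\<bar>"] E1_nonneg[OF admissible_monomials(8)]
  by (simp add: scaled_abs_mean_def S3_def Z_seq_def)

end

lemma C_b_3_sup_norm_nonneg:
  assumes "f \<in> C_b_3"
  shows "0 \<le> sup_norm (deriv f)" "0 \<le> sup_norm ((deriv ^^ 2) f)"
proof -
  have *: "0 \<le> sup_norm g" if "bounded (range g)" for g
  proof -
    obtain B where "\<And>z. \<bar>g z\<bar> \<le> B" using \<open>bounded (range g)\<close> by (auto simp: bounded_iff)
    then have "bdd_above (range (\<lambda>z. \<bar>g z\<bar>))" by (intro bdd_aboveI2)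
    then have "\<bar>g 0\<bar> \<le> sup_norm g" unfolding sup_norm_def by (rule cSUP_upper[OF UNIV_I])
    then show ?thesis by linarith
  qed
  have b: "bounded (range ((deriv ^^ i) f))" if "i \<le> 3" for i using assms that by (simp add: C_b_3_def)
  show "0 \<le> sup_norm (deriv f)" using *[OF b[of 1]] by simp
  show "0 \<le> sup_norm ((deriv ^^ 2) f)" by (rule *[OF b]) simp
qed

text \<open>An upper bound for \<open>Lip_const \<phi> * rate_const\<close> at \<open>M = 1 + m\<^sub>0\<close>, in which the Lipschitz constant and
  its product with \<open>M_star\<close> have each been replaced by \<open>c\<^sub>0\<close>. The absolute values and the leading \<open>1\<close>
  keep it positive for all arguments.\<close>

definition error_const :: "real \<Rightarrow> real \<Rightarrow> real \<Rightarrow> real" where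
  "error_const c\<^sub>0 m\<^sub>0 c =
     (let M = 1 + \<bar>m\<^sub>0\<bar> in 1 + \<bar>c\<^sub>0\<bar> * (12 + 48 * M\<^sup>2 + 10 * \<bar>c\<bar> + 12 * (\<bar>c\<bar> + M) * (2 + 2 * M)))"

lemma error_const_pos: "0 < error_const c\<^sub>0 m\<^sub>0 c"
proof -
  have "0 \<le> \<bar>c\<^sub>0\<bar> * (12 + 48 * (1 + \<bar>m\<^sub>0\<bar>)\<^sup>2 + 10 * \<bar>c\<bar> + 12 * (\<bar>c\<bar> + (1 + \<bar>m\<^sub>0\<bar>)) * (2 + 2 * (1 + \<bar>m\<^sub>0\<bar>)))"
    by (intro mult_nonneg_nonneg add_nonneg_nonneg) auto
  then show ?thesis unfolding error_const_def Let_def by linarith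
qed

text \<open>The limit of the scheme is a viscosity solution, hence by uniqueness the function \<open>E \<phi>(v + L\<^sub>t)\<close>.\<close>

lemma convergence_to_Levy_process:
  assumes \<alpha>: "1 < \<alpha>" "\<alpha> < 2" and lohi: "lo < hi" "\<gamma>lo \<le> \<gamma>hi" "0 \<le> \<sigma>lo" "\<sigma>lo \<le> \<sigma>hi"
    and P: "P = parameters lo hi \<gamma>lo \<gamma>hi \<sigma>lo \<sigma>hi"
    and W: "W_laws \<alpha> (Lambda_set lo hi) \<mu> \<beta>1 \<beta>2" and H1: "H1 (Lambda_set lo hi) \<mu>"
    and A2: "A2 \<alpha> \<delta> P \<mu>" and q0: "0 < q\<^sub>0" and A3: "A3_const \<alpha> P \<mu> q\<^sub>0 c"
    and \<phi>: "\<phi> \<in> C_b_Lip" and L: "associated_Levy_process (Theta \<alpha> P) H E L" and n: "1 \<le> n"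
  shows "\<bar>E_hat P \<mu> (\<lambda>w. \<phi> (S1 n w / sqrt (real n), S2 n w / real n, S3 n w / real n powr (1/\<alpha>)))
      - E (\<lambda>w. \<phi> (L 1 w))\<bar>
    \<le> error_const (C_0 \<alpha> P \<mu> \<phi>) (M_0 \<delta> P \<mu>) c * real n powr (- rate_exponent \<alpha> \<delta> q\<^sub>0)"
proof -
  have \<delta>: "max (3/4 * \<alpha>) 1 < \<delta>" "\<delta> < \<alpha>" and fin: "finite_E_0 P \<mu> (\<lambda>(x, y, z). \<bar>z\<bar> powr \<delta>)"
    and bdd: "bdd_above (scaled_abs_mean \<alpha> P \<mu> ` {1..})"
    using A2 by (auto simp: A2_def)
  have ne: "P \<noteq> {}"
  proof -
    have "((lo + hi) / 2, (lo + hi) / 2) \<in> Lambda_set lo hi" using lohi by (simp add: Lambda_set_def)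
    moreover have "\<sigma>lo\<^sup>2 \<le> \<sigma>hi\<^sup>2" using lohi by (simp add: power_mono)
    ultimately show ?thesis using lohi by (auto simp: P parameters_def)
  qed
  have mem: "k \<in> Lambda_set lo hi" "q \<in> {\<gamma>lo..\<gamma>hi}" "Q \<in> {\<sigma>lo\<^sup>2..\<sigma>hi\<^sup>2}" if "(k, q, Q) \<in> P" for k q Q
    using that by (auto simp: P parameters_def)
  have law: "real_distribution (\<mu> k)" "integrable (\<mu> k) (\<lambda>z. z)" if "(k, q, Q) \<in> P" for k q Q
    using mem(1)[OF that] W H1 by (auto simp: W_laws_def H1_def)
  have "1 \<le> \<delta>" using \<delta> by simp
  then have "\<exists>B. \<forall>(k, q, Q)\<in>P. (\<integral>z. \<bar>z\<bar> \<partial>\<mu> k) \<le> B"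
    by (rule finite_moment_first_moment_bound[OF fin]) (rule law(1))
  then obtain B where "\<forall>(k, q, Q)\<in>P. (\<integral>z. \<bar>z\<bar> \<partial>\<mu> k) \<le> B" ..
  then have B: "(\<integral>z. \<bar>z\<bar> \<partial>\<mu> k) \<le> B" if "(k, q, Q) \<in> P" for k q Q
    using that by fast
  \<comment> \<open>a crude parameter bound, of use only to know that suprema over \<open>P\<close> are finite\<close>
  let ?M' = "max 1 (max (\<sigma>hi\<^sup>2) (max (max \<bar>\<gamma>lo\<bar> \<bar>\<gamma>hi\<bar>) B))"
  interpret crude: moment_bounds P \<mu> ?M'
  proof (rule moment_bounds.intro)
    fix k q Q assume kqQ: "(k, q, Q) \<in> P"
    show "real_distribution (\<mu> k)" "integrable (\<mu> k) (\<lambda>z. z)" using law[OF kqQ] by blast+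
    show "0 \<le> Q" using mem(3)[OF kqQ] by (auto intro: order_trans[of _ "\<sigma>lo\<^sup>2"])
    have "Q \<le> \<sigma>hi\<^sup>2" "\<bar>q\<bar> \<le> max \<bar>\<gamma>lo\<bar> \<bar>\<gamma>hi\<bar>" using mem(2,3)[OF kqQ] by auto
    with B[OF kqQ] show "Q \<le> ?M'" "\<bar>q\<bar> \<le> ?M'" "(\<integral>z. \<bar>z\<bar> \<partial>\<mu> k) \<le> ?M'"
      by (simp_all only: le_max_iff_disj simp_thms)
  qed (use ne in auto)
  let ?M = "1 + M_0 \<delta> P \<mu>" and ?Mst = "M_star \<alpha> P \<mu>" and ?K = "Lip_const \<phi>" and ?r = "rate_exponent \<alpha> \<delta> q\<^sub>0"
  interpret moment_bounds P \<mu> ?M by (rule crude.moment_bounds_M_0)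
  have Mst: "scaled_abs_mean \<alpha> P \<mu> n \<le> ?Mst" if "1 \<le> n" for n
    unfolding M_star_def using that by (intro cSUP_upper[OF _ bdd]) simp
  have Mst0: "0 \<le> ?Mst" using scaled_abs_mean_1_nonneg[of \<alpha>] Mst[of 1] by linarith
  obtain b where b: "\<And>v. \<bar>\<phi> v\<bar> \<le> b" using \<phi> by (auto simp: C_b_Lip_def bounded_iff)
  have LK: "Lip1 ?K \<phi>" by (rule Lip_const_Lip1[OF \<phi>])
  interpret convergent_scheme P \<mu> ?M \<alpha> ?Mst "\<bar>c\<bar>" q\<^sub>0 ?r ?K b \<phi>
  proof
    fix p a f s z assume f: "f \<in> C_b_3" and s: "s \<in> {0<..(1::real)}"
    let ?e = "(sup_norm (deriv f) + sup_norm ((deriv ^^ 2) f)) * s powr q\<^sub>0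
                 + sup_norm ((deriv ^^ 2) f) * s powr ((2 - \<alpha>) / \<alpha>)"
    have "consistency_error \<alpha> P \<mu> p a f s z \<le> c * ?e" using A3 f s unfolding A3_const_def by blast
    also have "\<dots> \<le> \<bar>c\<bar> * ?e"
      using C_b_3_sup_norm_nonneg[OF f] by (intro mult_right_mono) auto
    finally show "consistency_error \<alpha> P \<mu> p a f s z \<le> \<bar>c\<bar> * ?e" .
  qed (use \<alpha> Mst0 Mst q0 LK b rate_exponent_bounds[OF \<alpha> \<delta> q0] in auto)
  have "E (\<lambda>w. \<phi> (0 + L 1 w)) = solution 1 0"
  proof -
    have "\<forall>u. viscosity_solution (Theta \<alpha> P) \<phi> u \<longrightarrow> (\<forall>t\<in>{0..1}. \<forall>v. u (t, v) = E (\<lambda>w. \<phi> (v + L t w)))"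
      using L \<phi> unfolding associated_Levy_process_def by blast
    with solution_viscosity
    have "\<forall>t\<in>{0..1}. \<forall>v. (case (t, v) of (t, v) \<Rightarrow> solution t v) = E (\<lambda>w. \<phi> (v + L t w))" by blast
    then have "\<forall>v. (case (1, v) of (t, v) \<Rightarrow> solution t v) = E (\<lambda>w. \<phi> (v + L 1 w))"
      by (rule bspec) simp
    then have "(case (1, 0) of (t, v) \<Rightarrow> solution t v) = E (\<lambda>w. \<phi> (0 + L 1 w))" by (rule spec)
    then show ?thesis unfolding prod.case by (rule sym)
  qed
  then have lim: "E (\<lambda>w. \<phi> (L 1 w)) = solution 1 0" by simp
  have "E_hat P \<mu> (\<lambda>w. \<phi> (S1 n w / sqrt (real n), S2 n w / real n, S3 n w / real n powr (1/\<alpha>)))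
      = (T (1 / real n) ^^ n) \<phi> 0"
    unfolding normalized_sums[OF n] by (rule E_hat_eq_T_power)
  then have "\<bar>E_hat P \<mu> (\<lambda>w. \<phi> (S1 n w / sqrt (real n), S2 n w / real n, S3 n w / real n powr (1/\<alpha>)))
      - E (\<lambda>w. \<phi> (L 1 w))\<bar> \<le> ?K * rate_const * real n powr (- ?r)"
    using convergence_rate[OF n, of 0] by (simp add: lim)
  also have "\<dots> \<le> error_const (C_0 \<alpha> P \<mu> \<phi>) (M_0 \<delta> P \<mu>) c * real n powr (- ?r)"
  proof (rule mult_right_mono)
    let ?C = "C_0 \<alpha> P \<mu> \<phi>"
    let ?D = "12 + 48 * ?M\<^sup>2 + 10 * \<bar>c\<bar>"
    have K0: "0 \<le> ?K" by (rule K_nonneg)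
    have KC: "?K \<le> ?C" by (simp add: C_0_def)
    have "?K * ?Mst \<le> ?K * (moment (E_hat P \<mu>) (X_seq 0) 2 powr (1/2) + moment (E_hat P \<mu>) (Y_seq 0) 1 + ?Mst)"
      using K0 E1_nonneg[OF admissible_monomials(6)] by (intro mult_left_mono) (auto simp: moments_as_E1)
    also have "\<dots> \<le> ?C" by (simp add: C_0_def)
    finally have KM: "?K * ?Mst \<le> ?C" .
    have M1: "1 \<le> ?M" by (rule M_ge_1)
    have "?K * rate_const = ?K * (?D + 12 * (\<bar>c\<bar> + ?M) * (1 + 2 * ?M)) + 12 * (\<bar>c\<bar> + ?M) * (?K * ?Mst)"
      unfolding rate_const_def Omega_def by (simp add: algebra_simps)
    also have "\<dots> \<le> ?C * (?D + 12 * (\<bar>c\<bar> + ?M) * (1 + 2 * ?M)) + 12 * (\<bar>c\<bar> + ?M) * ?C"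
      using KC KM M1 by (intro add_mono mult_right_mono mult_left_mono) auto
    also have "\<dots> = ?C * (?D + 12 * (\<bar>c\<bar> + ?M) * (2 + 2 * ?M))" by (simp add: algebra_simps)
    also have "\<dots> \<le> error_const ?C (M_0 \<delta> P \<mu>) c"
      using KC K0 M1 by (simp add: error_const_def)
    finally show "?K * rate_const \<le> error_const ?C (M_0 \<delta> P \<mu>) c" .
  qed simp
  finally show ?thesis .
qed

theorem theorem4p2:
  shows "\<exists>C :: real \<Rightarrow> real \<Rightarrow> real \<Rightarrow> real \<Rightarrow> real.
    (\<forall>c\<^sub>0 m\<^sub>0 \<kappa> c. C c\<^sub>0 m\<^sub>0 \<kappa> c > 0) \<and>
    (\<forall>\<alpha> lo hi \<gamma>lo \<gamma>hi \<sigma>lo \<sigma>hi P \<mu> \<beta>1 \<beta>2 q\<^sub>0 C\<^sub>\<beta> \<delta> C\<^sub>\<alpha>\<^sub>\<beta> \<rho> \<phi>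
        (H :: ('w \<Rightarrow> real) set) E \<xi> \<eta> \<zeta>.
      1 < \<alpha> \<and> \<alpha> < 2 \<and> 0 < lo \<and> lo < hi \<and> \<gamma>lo \<le> \<gamma>hi \<and> 0 \<le> \<sigma>lo \<and> \<sigma>lo \<le> \<sigma>hi \<and>
      P = parameters lo hi \<gamma>lo \<gamma>hi \<sigma>lo \<sigma>hi \<and>
      W_laws \<alpha> (Lambda_set lo hi) \<mu> \<beta>1 \<beta>2 \<and>
      H1 (Lambda_set lo hi) \<mu> \<and>
      H2 \<alpha> (Lambda_set lo hi) \<beta>1 \<beta>2 q\<^sub>0 C\<^sub>\<beta> \<and>
      A1 P \<mu> \<and> A2 \<alpha> \<delta> P \<mu> \<and> A3 \<alpha> P \<mu> \<and>
      A3_const \<alpha> P \<mu> q\<^sub>0 C\<^sub>\<alpha>\<^sub>\<beta> \<and>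
      mollifier \<rho> \<and>
      \<phi> \<in> C_b_Lip \<and>
      associated_Levy_process (Theta \<alpha> P) H E (\<lambda>t w. (\<xi> t w, \<eta> t w, \<zeta> t w))
      \<longrightarrow>
      (\<forall>n::nat. n \<ge> 1 \<longrightarrow>
        \<bar>E_hat P \<mu> (\<lambda>w. \<phi> (S1 n w / sqrt (real n), S2 n w / real n, S3 n w / real n powr (1/\<alpha>)))
          - E (\<lambda>w. \<phi> (\<xi> 1 w, \<eta> 1 w, \<zeta> 1 w))\<bar>
        \<le> C (C_0 \<alpha> P \<mu> \<phi>) (M_0 \<delta> P \<mu>) (K_rho \<rho>) C\<^sub>\<alpha>\<^sub>\<beta> * real n powr (- rate_exponent \<alpha> \<delta> q\<^sub>0)))"
proof (intro exI[of _ "\<lambda>c\<^sub>0 m\<^sub>0 \<kappa> c. error_const c\<^sub>0 m\<^sub>0 c"] conjI allI impI, goal_cases)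
  case (1 c\<^sub>0 m\<^sub>0 \<kappa> c)
  show ?case by (rule error_const_pos)
next
  case (2 \<alpha> lo hi \<gamma>lo \<gamma>hi \<sigma>lo \<sigma>hi P \<mu> \<beta>1 \<beta>2 q\<^sub>0 C\<^sub>\<beta> \<delta> C\<^sub>\<alpha>\<^sub>\<beta> \<rho> \<phi> H E \<xi> \<eta> \<zeta> n)
  then have h: "1 < \<alpha>" "\<alpha> < 2" "lo < hi" "\<gamma>lo \<le> \<gamma>hi" "0 \<le> \<sigma>lo" "\<sigma>lo \<le> \<sigma>hi"
      "P = parameters lo hi \<gamma>lo \<gamma>hi \<sigma>lo \<sigma>hi" "W_laws \<alpha> (Lambda_set lo hi) \<mu> \<beta>1 \<beta>2"
      "H1 (Lambda_set lo hi) \<mu>" "A2 \<alpha> \<delta> P \<mu>" "A3_const \<alpha> P \<mu> q\<^sub>0 C\<^sub>\<alpha>\<^sub>\<beta>" "\<phi> \<in> C_b_Lip"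
      "associated_Levy_process (Theta \<alpha> P) H E (\<lambda>t w. (\<xi> t w, \<eta> t w, \<zeta> t w))" "1 \<le> n"
      and H2: "H2 \<alpha> (Lambda_set lo hi) \<beta>1 \<beta>2 q\<^sub>0 C\<^sub>\<beta>"
    by blast+
  have "0 < q\<^sub>0" using H2 by (simp add: H2_def)
  with convergence_to_Levy_process[OF h(1-10) _ h(11-14)] show ?case by simp
qed

end
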